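(* Let $p\geq 5$ be a prime. Then $${_{3}G}_{3}\left[\begin{array}{ccc}\frac14,&\frac12,&\frac34\\ 0,&\frac13,&\frac23\end{array}\Big|\ 1\right]=1+\phi(-2).$$
   Context: $\phi$ is the quadratic character on $\mathbb{F}_p$, with $\phi(0)=0$. McCarthy's $p$-adic hypergeometric series: $\Gamma_p:\mathbb{Z}_p\to\mathbb{Z}_p^\times$ is the $p$-adic gamma function, i.e. the unique continuous function with $\Gamma_p(0)=1$ and $\Gamma_p(n)=(-1)^n\prod_{0<j<n,\,p\nmid j}j$ for positive integers $n$. $\omega:\mathbb{F}_p^\times\to\mathbb{Z}_p^\times$ is the Teichmüller character ($\omega(a)$ is the $(p-1)$-th root of unity with $\omega(a)\equiv a \pmod p$) and $\overline{\omega}$ its inverse; all characters, including the trivial one $\overline\omega^0$, are extended to $\mathbb{F}_p$ by the value $0$ at $0$. $\lfloor x\rfloor$ is the floor and $\langle x\rangle=x-\lfloor x\rfloor$ the fractional part of $x\in\mathbb{Q}$. For an odd prime $p$, $t\in\mathbb{F}_p$, $n\ge 1$ and $a_i,b_i\in\mathbb{Q}\cap\mathbb{Z}_p$ ($1\le i\le n$), $${_nG}_n\left[\begin{array}{cccc}a_1,&a_2,&\ldots,&a_n\\ b_1,&b_2,&\ldots,&b_n\end{array}\Big|\ t\right]:=\frac{-1}{p-1}\sum_{j=0}^{p-2}(-1)^{jn}\,\overline{\omega}^j(t)\prod_{i=1}^n(-p)^{-\lfloor\langle a_i\rangle-\frac{j}{p-1}\rfloor-\lfloor\langle -b_i\rangle+\frac{j}{p-1}\rfloor}\frac{\Gamma_p(\langle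 a_i-\frac{j}{p-1}\rangle)}{\Gamma_p(\langle a_i\rangle)}\frac{\Gamma_p(\langle -b_i+\frac{j}{p-1}\rangle)}{\Gamma_p(\langle -b_i\rangle)}.$$ *)

theory Defs
  imports
    "Berlekamp_Zassenhaus.Finite_Field"
    "HOL-Computational_Algebra.Polynomial_Factorial"
begin

text \<open>
  The prime \<open>p\<close> is the cardinality of a type of class \<^class>\<open>prime_card\<close>, as in
  \<open>'p mod_ring\<close>, which is the field \<open>F\<^sub>p\<close>.

  \<open>'p padic_int\<close> is the inverse limit of the rings \<open>Z/p\<^sup>nZ\<close>: the \<open>n\<close>-th entry of a sequence is
  the canonical representative of the residue modulo \<open>p\<^sup>n\<close>.
\<close>

typedef ('p :: prime_card) padic_int =
  "{x :: nat \<Rightarrow> int. \<forall>n. x n \<in> {0..<int CARD('p) ^ n} \<and> x (Suc n) mod int CARD('p) ^ n = x n}"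
  morphisms padic_residue Abs_padic_int
  by (rule exI[of _ "\<lambda>_. 0"]) (simp add: prime_gt_0_nat prime_card)

setup_lifting type_definition_padic_int

lemma padic_coherent_mod:
  fixes p u v :: int
  assumes "p > 0" and "u mod p ^ n = v mod p ^ n"
  shows "v mod p ^ n \<in> {0..<p ^ n} \<and> u mod p ^ Suc n mod p ^ n = v mod p ^ n"
  using assms by (simp add: mod_mod_cancel)

instantiation padic_int :: (prime_card) comm_ring_1
begin

lift_definition zero_padic_int :: "'a padic_int" is "\<lambda>_. 0"
  by simp

lift_definition one_padic_int :: "'a padic_int" is "\<lambda>n. 1 mod int CARD('a) ^ n"
  by (rule padic_coherent_mod) simp_all

lift_definition plus_padic_int :: "'a padic_int \<Rightarrow> 'a padic_int \<Rightarrow> 'a padic_int"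
  is "\<lambda>x y n. (x n + y n) mod int CARD('a) ^ n"
  by (rule padic_coherent_mod) (simp, metis mod_add_eq mod_mod_trivial)

lift_definition uminus_padic_int :: "'a padic_int \<Rightarrow> 'a padic_int"
  is "\<lambda>x n. (- x n) mod int CARD('a) ^ n"
  by (rule padic_coherent_mod) (simp, metis mod_minus_eq mod_mod_trivial)

lift_definition minus_padic_int :: "'a padic_int \<Rightarrow> 'a padic_int \<Rightarrow> 'a padic_int"
  is "\<lambda>x y n. (x n - y n) mod int CARD('a) ^ n"
  by (rule padic_coherent_mod) (simp, metis mod_diff_eq mod_mod_trivial)

lift_definition times_padic_int :: "'a padic_int \<Rightarrow> 'a padic_int \<Rightarrow> 'a padic_int"
  is "\<lambda>x y n. (x n * y n) mod int CARD('a) ^ n"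
  by (rule padic_coherent_mod) (simp, metis mod_mult_eq mod_mod_trivial)

instance
proof
  fix a b c :: "'a padic_int"
  show "a * b * c = a * (b * c)"
    by transfer (simp add: mod_simps mult.assoc)
  show "a * b = b * a"
    by transfer (simp add: mult.commute)
  show "1 * a = a"
    by transfer (auto simp: mod_simps fun_eq_iff)
  show "a + b + c = a + (b + c)"
    by transfer (simp add: mod_simps add.assoc)
  show "a + b = b + a"
    by transfer (simp add: add.commute)
  show "0 + a = a"
    by transfer (auto simp: fun_eq_iff)
  show "- a + a = 0"
    by transfer (simp add: mod_simps)
  show "a - b = a + - b"
    by transfer (simp add: mod_simps)
  show "(a + b) * c = a * c + b * c"
    by transfer (simp add: mod_simps distrib_right)
  show "(0 :: 'a padic_int) \<noteq> 1"
  proof (transfer, rule notI)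
    assume "(\<lambda>_. 0) = (\<lambda>n. 1 mod int CARD('a) ^ n)"
    from fun_cong[OF this, of 1] show False
      by simp
  qed
qed

end

lemma padic_residue_bounds:
  "0 \<le> padic_residue (x :: 'p :: prime_card padic_int) n" "padic_residue x n < int CARD('p) ^ n"
  using padic_residue[of x] by auto

lemma padic_residue_mod:
  fixes x :: "'p :: prime_card padic_int"
  assumes "m \<le> n"
  shows "padic_residue x n mod int CARD('p) ^ m = padic_residue x m"
  using assms
proof (induction n rule: dec_induct)
  case base
  show ?case using padic_residue_bounds[of x m] by simp
next
  case (step n)
  have "padic_residue x (Suc n) mod int CARD('p) ^ n = padic_residue x n"
    using padic_residue[of x] by auto
  moreover have "int CARD('p) ^ m dvd int CARD('p) ^ n"
    using step by (simp add: le_imp_power_dvd)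
  ultimately show ?case using step.IH by (metis mod_mod_cancel)
qed

lemma padic_residue_nonzero_mono:
  fixes x :: "'p :: prime_card padic_int"
  assumes "padic_residue x m \<noteq> 0" "m \<le> n"
  shows "\<not> int CARD('p) ^ m dvd padic_residue x n"
  using padic_residue_mod[OF assms(2), of x] assms(1) by (simp add: dvd_eq_mod_eq_0)

lemma padic_int_nonzeroE:
  fixes x :: "'p :: prime_card padic_int"
  assumes "x \<noteq> 0"
  obtains n where "padic_residue x n \<noteq> 0"
  using assms by (auto simp: padic_residue_inject[symmetric] zero_padic_int.rep_eq fun_eq_iff)

instance padic_int :: (prime_card) idom
proof
  fix a b :: "'a padic_int"
  assume "a \<noteq> 0" "b \<noteq> 0"
  then obtain m k where "padic_residue a m \<noteq> 0" "padic_residue b k \<noteq> 0"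
    by (metis padic_int_nonzeroE)
  define p u v where "p = int CARD('a)"
    and "u = padic_residue a (m + k)" and "v = padic_residue b (m + k)"
  have p: "prime p"
    unfolding p_def by (rule prime_card_int)
  have u: "\<not> p ^ m dvd u"
    unfolding p_def u_def
    by (rule padic_residue_nonzero_mono[OF \<open>padic_residue a m \<noteq> 0\<close> le_add1])
  have v: "\<not> p ^ k dvd v"
    unfolding p_def v_def
    by (rule padic_residue_nonzero_mono[OF \<open>padic_residue b k \<noteq> 0\<close> le_add2])
  have uv0: "u \<noteq> 0" "v \<noteq> 0"
    using u v by auto
  have "\<not> is_unit p"
    using p not_prime_unit by blast
  then have "multiplicity p u < m" "multiplicity p v < k"
    using u v uv0 by (simp_all add: power_dvd_iff_le_multiplicity)
  then have "multiplicity p (u * v) < m + k"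
    using prime_elem_multiplicity_mult_distrib[OF prime_imp_prime_elem[OF p] uv0] by simp
  then have "\<not> p ^ (m + k) dvd u * v"
    using \<open>\<not> is_unit p\<close> uv0 by (simp add: power_dvd_iff_le_multiplicity)
  then have "padic_residue (a * b) (m + k) \<noteq> 0"
    by (simp add: times_padic_int.rep_eq p_def u_def v_def dvd_eq_mod_eq_0)
  then show "a * b \<noteq> 0"
    by (auto simp: zero_padic_int.rep_eq)
qed

text \<open>
  The \<open>p\<close>-adic metric \<open>|x - y|\<^sub>p\<close>. For \<open>x \<noteq> 0\<close> the valuation is the largest \<open>n\<close> with
  \<open>p\<^sup>n dvd x\<close>, i.e. the least \<open>n\<close> such that the residue modulo \<open>p\<^sup>n\<^sup>+\<^sup>1\<close> does not vanish.
\<close>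

definition padic_val :: "'p :: prime_card padic_int \<Rightarrow> nat" where
  "padic_val x = (LEAST n. padic_residue x (Suc n) \<noteq> 0)"

lemma padic_residue_0 [simp]: "padic_residue (x :: 'p :: prime_card padic_int) 0 = 0"
  using padic_residue_bounds[of x 0] by simp

lemma le_padic_val_iff:
  fixes x :: "'p :: prime_card padic_int"
  assumes "x \<noteq> 0"
  shows "n \<le> padic_val x \<longleftrightarrow> padic_residue x n = 0"
proof -
  obtain m where m: "padic_residue x m \<noteq> 0"
    using assms by (rule padic_int_nonzeroE)
  then obtain m' where "m = Suc m'"
    by (cases m) auto
  with m have nz: "padic_residue x (Suc (padic_val x)) \<noteq> 0"
    unfolding padic_val_def by (metis (mono_tags, lifting) LeastI)
  show ?thesis
  proof
    assume "n \<le> padic_val x"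
    then show "padic_residue x n = 0"
      by (cases n) (auto simp: padic_val_def Suc_le_eq dest: not_less_Least)
  next
    assume 0: "padic_residue x n = 0"
    show "n \<le> padic_val x"
    proof (rule ccontr)
      assume "\<not> n \<le> padic_val x"
      then have "padic_residue x n mod int CARD('p) ^ Suc (padic_val x)
                   = padic_residue x (Suc (padic_val x))"
        by (intro padic_residue_mod) simp
      with 0 nz show False by simp
    qed
  qed
qed

lemma padic_val_add:
  fixes x y :: "'p :: prime_card padic_int"
  assumes "x \<noteq> 0" "y \<noteq> 0" "x + y \<noteq> 0"
  shows "min (padic_val x) (padic_val y) \<le> padic_val (x + y)"
proof -
  let ?n = "min (padic_val x) (padic_val y)"
  have "padic_residue x ?n = 0" "padic_residue y ?n = 0"
    using assms by (simp_all flip: le_padic_val_iff)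
  then show ?thesis
    using assms by (simp add: le_padic_val_iff plus_padic_int.rep_eq)
qed

lemma padic_val_minus_commute:
  fixes x y :: "'p :: prime_card padic_int"
  shows "padic_val (x - y) = padic_val (y - x)"
proof -
  have "padic_residue (x - y) n = 0 \<longleftrightarrow> padic_residue (y - x) n = 0" for n
    unfolding minus_padic_int.rep_eq dvd_eq_mod_eq_0[symmetric] by (rule dvd_diff_commute)
  then show ?thesis
    by (simp add: padic_val_def)
qed

instantiation padic_int :: (prime_card) metric_space
begin

definition dist_padic_int :: "'a padic_int \<Rightarrow> 'a padic_int \<Rightarrow> real" where
  "dist_padic_int x y = (if x = y then 0 else (1 / real CARD('a)) ^ padic_val (x - y))"

definition uniformity_padic_int :: "('a padic_int \<times> 'a padic_int) filter" where
  "uniformity_padic_int = (INF e\<in>{0<..}. principal {(x, y). dist x y < e})"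

definition open_padic_int :: "'a padic_int set \<Rightarrow> bool" where
  "open_padic_int U \<longleftrightarrow> (\<forall>x\<in>U. \<forall>\<^sub>F (x', y) in uniformity. x' = x \<longrightarrow> y \<in> U)"

instance
proof
  fix x y z :: "'a padic_int"
  show "dist x y = 0 \<longleftrightarrow> x = y"
    by (simp add: dist_padic_int_def)
  have ge0: "dist u v \<ge> 0" for u v :: "'a padic_int"
    by (simp add: dist_padic_int_def)
  have comm: "dist u v = dist v u" for u v :: "'a padic_int"
    by (simp add: dist_padic_int_def padic_val_minus_commute)
  show "dist x y \<le> dist x z + dist y z"
  proof (cases "x = y \<or> x = z \<or> y = z")
    case True
    then show ?thesis
      using ge0 comm[of x y] by (auto simp: dist_padic_int_def)
  next
    case False
    define q where "q = 1 / real CARD('a)"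
    have q: "0 \<le> q" "q \<le> 1"
      by (auto simp: q_def Suc_le_eq)
    have "min (padic_val (x - z)) (padic_val (z - y)) \<le> padic_val (x - y)"
      using padic_val_add[of "x - z" "z - y"] False by auto
    then have "q ^ padic_val (x - y) \<le> q ^ min (padic_val (x - z)) (padic_val (z - y))"
      using q by (intro power_decreasing)
    also have "\<dots> \<le> q ^ padic_val (x - z) + q ^ padic_val (z - y)"
      using q by (auto simp: min_def)
    finally show ?thesis
      using False by (simp add: dist_padic_int_def q_def padic_val_minus_commute[of y z])
  qed
qed (simp_all add: uniformity_padic_int_def open_padic_int_def)

end

text \<open>\<open>Q\<^sub>p\<close> as the field of fractions of \<open>Z\<^sub>p\<close>.\<close>

type_synonym 'p padic = "'p padic_int fract"

text \<open>
  The inclusion of \<open>Q \<inter> Z\<^sub>p\<close> into \<open>Z\<^sub>p\<close>; unspecified on rationals whose denominator is divisible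
  by \<open>p\<close>.
\<close>

definition padic_of_rat :: "rat \<Rightarrow> 'p :: prime_card padic_int" where
  "padic_of_rat r = (THE x. case quotient_of r of (a, b) \<Rightarrow> of_int b * x = of_int a)"

text \<open>
  The description determines a unique function for odd \<open>p\<close>: the positive integers are dense in
  \<open>Z\<^sub>p\<close>. The range condition says that the values are units.
\<close>

definition padic_Gamma :: "'p :: prime_card padic_int \<Rightarrow> 'p padic_int" where
  "padic_Gamma = (THE f. continuous_on UNIV f \<and> range f \<subseteq> {u. u dvd 1} \<and> f 0 = 1 \<and>
     (\<forall>n>0. f (of_nat n) = (-1) ^ n * of_nat (\<Prod>j | 0 < j \<and> j < n \<and> \<not> CARD('p) dvd j. j)))"

text \<open>The Teichmueller character; the value at 0 is irrelevant.\<close>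

definition teichmuller :: "'p :: prime_card mod_ring \<Rightarrow> 'p padic_int" where
  "teichmuller a = (THE w. w ^ (CARD('p) - 1) = 1 \<and>
     of_nat CARD('p) dvd w - of_int (to_int_mod_ring a))"

text \<open>
  The \<open>j\<close>-th power of the inverse Teichmueller character. All of these characters, including the
  trivial one \<open>j = 0\<close>, vanish at 0.
\<close>

definition teichmuller_inv_power :: "nat \<Rightarrow> 'p :: prime_card mod_ring \<Rightarrow> 'p padic" where
  "teichmuller_inv_power j t = (if t = 0 then 0 else inverse (to_fract (teichmuller t)) ^ j)"

definition quadratic_char :: "'p :: prime_card mod_ring \<Rightarrow> int" where
  "quadratic_char x = Legendre (to_int_mod_ring x) (int CARD('p))"

text \<open>
  McCarthy's \<open>p\<close>-adic hypergeometric series with parameter lists \<open>as\<close> and \<open>bs\<close> of common length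
  \<open>n \<ge> 1\<close> and entries in \<open>Q \<inter> Z\<^sub>p\<close>.
\<close>

definition padic_nGn :: "rat list \<Rightarrow> rat list \<Rightarrow> 'p :: prime_card mod_ring \<Rightarrow> 'p padic" where
  "padic_nGn as bs t =
    (let p = CARD('p); n = length as;
         \<Gamma> = (\<lambda>r. to_fract (padic_Gamma (padic_of_rat r)) :: 'p padic)
     in (- 1) / (of_nat p - 1) *
        (\<Sum>j = 0..p - 2. (- 1) ^ (j * n) * teichmuller_inv_power j t *
          (\<Prod>i<n. let a = as ! i; b = bs ! i; x = of_nat j / (of_nat p - 1) in
             (- of_nat p) powi (- \<lfloor>frac a - x\<rfloor> - \<lfloor>frac (- b) + x\<rfloor>) *
             (\<Gamma> (frac (a - x)) / \<Gamma> (frac a)) *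
             (\<Gamma> (frac (- b + x)) / \<Gamma> (frac (- b))))))"

end

theory Submission
  imports Defs "HOL-Computational_Algebra.Formal_Power_Series"
begin

text \<open>
  By the multiplication and reflection formulas for \<open>\<Gamma>\<^sub>p\<close>, the \<open>j\<close>-th term of the series is, up to sign
  and powers of \<open>p\<close>, the product of \<open>\<Gamma>\<^sub>p(\<langle>3j/(p-1)\<rangle>)\<close>, \<open>\<Gamma>\<^sub>p(\<langle>-4j/(p-1)\<rangle>)\<close>, \<open>\<Gamma>\<^sub>p(j/(p-1))\<close> and
  \<open>\<omega>(27/256)\<^sup>j\<close>. By the Gross-Koblitz formula these gamma values are Gauss sums, so that the series
  counts the zeros of \<open>3x\<^sup>4 - 4x\<^sup>3 + 1 = (x - 1)\<^sup>2 (3x\<^sup>2 + 2x + 1)\<close> in \<open>F\<^sub>p\<close>, minus one.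

  For the Gross-Koblitz formula, let \<open>c\<^sub>n\<close> be the coefficients of \<open>exp (X + X\<^sup>p/p)\<close>. The recurrence
  \<open>n c\<^sub>n = c\<^sub>n\<^sub>-\<^sub>1 + c\<^sub>n\<^sub>-\<^sub>p\<close> shows that \<open>\<Sum>\<^sub>i (-p)\<^sup>i n(n-1)\<dots>(n-i+1) c\<^sub>a\<^sub>+\<^sub>p\<^sub>i\<close> is \<open>\<plusminus>1/\<Gamma>\<^sub>p(pn+a+1)\<close>, and, by
  telescoping, that for \<open>n\<close> close to \<open>a/(1-p)\<close> it is close to \<open>(1-p) \<Sum>\<^sub>l (-p)\<^sup>l c\<^sub>a\<^sub>+\<^sub>l\<^sub>(\<^sub>p\<^sub>-\<^sub>1\<^sub>)\<close>, a
  Fourier coefficient of the additive character \<open>x \<mapsto> exp (\<pi>x + (\<pi>x)\<^sup>p/p)\<close>, \<open>\<pi>\<^sup>p\<^sup>-\<^sup>1 = -p\<close>.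
\<close>

section \<open>The ring of p-adic integers\<close>

text \<open>The parameters dictate the trinomial. When the sum of psi(y f(x)) over nonzero x, y is
  expanded, f having the monomials x^4, x^3 and 1, orthogonality leaves the powers 3t, -4t, t of the
  Teichmueller character, and the multiplication formulas turn exactly these into the thirds and
  quarters of the series. The coefficients 3 and -4 contribute 3^(3t) (-4)^(-4t) = (27/256)^t and so
  make the argument equal to 1. The obstacle is convergence: c_n has to be small enough against
  \<pi>^n, of valuation n/(p-1). The bound obtained is that p^(n div p) c_n is integral; it suffices
  because 1/p < 1/(p-1), both for the rate of convergence of the Gross-Koblitz sums and for showing
  that congruence modulo X^(p-1) + p still separates constants. It comes from the gamma function
  itself: the values 1/\<Gamma>_p are integral, hence so are their finite differences (-p)^i i!
  c_(a+pi), and an extra divisibility of these by p^(i div 2) pays for i!.\<close>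

instance fract :: ("{idom,ring_char_0}") field_char_0
proof
  show "inj (of_nat :: nat \<Rightarrow> 'a fract)"
    by (auto intro!: injI simp: of_nat_fract eq_fract)
qed

abbreviation pp :: "'p :: prime_card padic_int" where
  "pp \<equiv> of_nat CARD('p)"

lemma CARD_gt_1: "CARD('p :: prime_card) > 1"
  using prime_card[where ?'a = 'p] by (rule prime_gt_1_nat)

lemma padic_eqI:
  fixes x y :: "'p :: prime_card padic_int"
  assumes "\<And>n. padic_residue x n = padic_residue y n"
  shows "x = y"
  using assms by (auto simp: padic_residue_inject[symmetric])

lemma padic_residue_mod_self [simp]:
  fixes x :: "'p :: prime_card padic_int"
  shows "padic_residue x n mod int CARD('p) ^ n = padic_residue x n"
  using padic_residue_mod[of n n x] by simp

lemma padic_residue_of_nat: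
  "padic_residue (of_nat k :: 'p :: prime_card padic_int) n = int k mod int CARD('p) ^ n"
  by (induction k)
    (auto simp: zero_padic_int.rep_eq one_padic_int.rep_eq plus_padic_int.rep_eq mod_simps)

lemma padic_residue_of_int:
  "padic_residue (of_int k :: 'p :: prime_card padic_int) n = k mod int CARD('p) ^ n"
proof (cases k)
  case (nonneg m)
  then show ?thesis by (simp add: padic_residue_of_nat)
next
  case (neg m)
  then show ?thesis
    by (simp add: uminus_padic_int.rep_eq padic_residue_of_nat mod_simps del: of_nat_Suc)
qed

lemma padic_residue_add_cong:
  fixes x y x' y' :: "'p :: prime_card padic_int"
  assumes "padic_residue x n = padic_residue x' n" "padic_residue y n = padic_residue y' n"
  shows "padic_residue (x + y) n = padic_residue (x' + y') n"
  using assms by (simp add: plus_padic_int.rep_eq)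

lemma padic_residue_diff_cong:
  fixes x y x' y' :: "'p :: prime_card padic_int"
  assumes "padic_residue x n = padic_residue x' n" "padic_residue y n = padic_residue y' n"
  shows "padic_residue (x - y) n = padic_residue (x' - y') n"
  using assms by (simp add: minus_padic_int.rep_eq)

lemma padic_residue_uminus_cong:
  fixes x x' :: "'p :: prime_card padic_int"
  assumes "padic_residue x n = padic_residue x' n"
  shows "padic_residue (- x) n = padic_residue (- x') n"
  using assms by (simp add: uminus_padic_int.rep_eq)

lemma padic_residue_mult_cong:
  fixes x y x' y' :: "'p :: prime_card padic_int"
  assumes "padic_residue x n = padic_residue x' n" "padic_residue y n = padic_residue y' n"
  shows "padic_residue (x * y) n = padic_residue (x' * y') n"
  using assms by (simp add: times_padic_int.rep_eq)

lemma padic_residue_power_cong: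
  fixes x x' :: "'p :: prime_card padic_int"
  assumes "padic_residue x n = padic_residue x' n"
  shows "padic_residue (x ^ k) n = padic_residue (x' ^ k) n"
  by (induction k) (auto intro!: padic_residue_mult_cong assms)

lemma padic_residue_prod_cong:
  fixes f g :: "'a \<Rightarrow> 'p :: prime_card padic_int"
  assumes "\<And>i. i \<in> A \<Longrightarrow> padic_residue (f i) n = padic_residue (g i) n"
  shows "padic_residue (prod f A) n = padic_residue (prod g A) n"
  using assms by (induction A rule: infinite_finite_induct) (auto intro!: padic_residue_mult_cong)

lemma padic_residue_cong_mono:
  fixes x y :: "'p :: prime_card padic_int"
  assumes "padic_residue x n = padic_residue y n" "m \<le> n"
  shows "padic_residue x m = padic_residue y m"
  by (metis assms padic_residue_mod)

lemma pp_power_dvd_iff: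
  fixes x :: "'p :: prime_card padic_int"
  shows "pp ^ n dvd x \<longleftrightarrow> padic_residue x n = 0"
proof
  assume "pp ^ n dvd x"
  then obtain y where "x = of_nat (CARD('p) ^ n) * y"
    by auto
  then show "padic_residue x n = 0"
    by (simp only: times_padic_int.rep_eq padic_residue_of_nat) simp
next
  let ?p = "int CARD('p)"
  assume 0: "padic_residue x n = 0"
  have pos: "?p ^ n > 0" by simp
  have dvd: "?p ^ n dvd padic_residue x (n + k)" for k
    using padic_residue_mod[of n "n + k" x] 0 by (simp add: dvd_eq_mod_eq_0)
  \<comment> \<open>The quotient of x by p^n: its residue modulo p^k is determined by x modulo
    p^(n+k).\<close>
  define y where "y = (\<lambda>k. padic_residue x (n + k) div ?p ^ n)"
  have y: "?p ^ n * y k = padic_residue x (n + k)" for k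
    using dvd[of k] by (simp add: y_def)
  have "y k \<in> {0..<?p ^ k} \<and> y (Suc k) mod ?p ^ k = y k" for k
  proof -
    have "0 \<le> ?p ^ n * y k" "?p ^ n * y k < ?p ^ n * ?p ^ k"
      unfolding y using padic_residue_bounds[of x "n + k"] by (simp_all add: power_add)
    then have 1: "0 \<le> y k" "y k < ?p ^ k"
      using pos by (simp_all add: zero_le_mult_iff)
    have "?p ^ n * (y (Suc k) mod ?p ^ k) = (?p ^ n * y (Suc k)) mod (?p ^ n * ?p ^ k)"
      by (rule mult_mod_right)
    also have "\<dots> = ?p ^ n * y k"
      unfolding y using padic_residue_mod[of "n + k" "n + Suc k" x] by (simp add: power_add)
    finally show ?thesis using 1 pos by simp
  qed
  then have rep: "padic_residue (Abs_padic_int y :: 'p padic_int) = y"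
    by (subst Abs_padic_int_inverse) auto
  have "x = of_nat (CARD('p) ^ n) * Abs_padic_int y"
  proof (rule padic_eqI)
    fix m
    have "padic_residue (of_nat (CARD('p) ^ n) * Abs_padic_int y :: 'p padic_int) m
        = (?p ^ n * y m) mod ?p ^ m"
      by (simp only: times_padic_int.rep_eq padic_residue_of_nat rep) (simp add: mod_simps)
    also have "\<dots> = padic_residue x m"
      unfolding y by (rule padic_residue_mod) simp
    finally show "padic_residue x m
        = padic_residue (of_nat (CARD('p) ^ n) * Abs_padic_int y :: 'p padic_int) m" ..
  qed
  then show "pp ^ n dvd x" by simp
qed

lemma padic_residue_eq_iff_dvd:
  fixes x y :: "'p :: prime_card padic_int"
  shows "padic_residue x n = padic_residue y n \<longleftrightarrow> pp ^ n dvd x - y"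
proof -
  have "padic_residue x n = padic_residue y n \<longleftrightarrow>
        padic_residue x n mod int CARD('p) ^ n = padic_residue y n mod int CARD('p) ^ n"
    by (simp only: padic_residue_mod_self)
  also have "\<dots> \<longleftrightarrow> padic_residue (x - y) n = 0"
    by (simp only: minus_padic_int.rep_eq mod_eq_dvd_iff dvd_eq_mod_eq_0)
  finally show ?thesis by (simp only: pp_power_dvd_iff)
qed

lemma pp_dvd_iff:
  fixes x :: "'p :: prime_card padic_int"
  shows "pp dvd x \<longleftrightarrow> padic_residue x 1 = 0"
  using pp_power_dvd_iff[of 1 x] by simp

instance padic_int :: (prime_card) ring_char_0
proof
  show "inj (of_nat :: nat \<Rightarrow> 'a padic_int)"
  proof (rule injI)
    fix x y :: nat
    assume *: "(of_nat x :: 'a padic_int) = of_nat y"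
    define n where "n = x + y"
    have "n < CARD('a) ^ n"
      using CARD_gt_1[where ?'p = 'a] by (simp add: power_gt_expt)
    then have "int x < int CARD('a) ^ n" "int y < int CARD('a) ^ n"
      unfolding n_def by (metis of_nat_less_iff of_nat_power le_add1 le_add2 le_less_trans)+
    moreover have "int x mod int CARD('a) ^ n = int y mod int CARD('a) ^ n"
      using * by (metis padic_residue_of_nat)
    ultimately show "x = y" by simp
  qed
qed

lemma padic_nat_approx:
  fixes x :: "'p :: prime_card padic_int"
  obtains k where "k > 0" "k \<ge> m" "padic_residue (of_nat k :: 'p padic_int) n = padic_residue x n"
proof
  \<comment> \<open>The added multiple of p^n makes the representative positive and at least
    m.\<close>
  let ?k = "nat (padic_residue x n) + (m + 1) * CARD('p) ^ n"
  have "(m + 1) * 1 \<le> (m + 1) * CARD('p) ^ n" by (rule mult_le_mono2) (simp add: Suc_le_eq)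
  then have "m + 1 \<le> ?k" by (intro order_trans[OF _ trans_le_add2]) auto
  then show "?k > 0" "?k \<ge> m" by simp_all
  have "int ?k = padic_residue x n + int (m + 1) * int CARD('p) ^ n"
    using padic_residue_bounds[of x n] by (simp add: algebra_simps)
  then show "padic_residue (of_nat ?k :: 'p padic_int) n = padic_residue x n"
    unfolding padic_residue_of_nat by (simp only: mod_mult_self1 padic_residue_mod_self)
qed

text \<open>A residue prime to p is invertible modulo every p^n, and uniqueness of inverses modulo
  p^n makes the chosen inverses coherent.\<close>

lemma padic_unit_iff:
  fixes x :: "'p :: prime_card padic_int"
  shows "x dvd 1 \<longleftrightarrow> \<not> pp dvd x"
proof
  assume "x dvd 1"
  show "\<not> pp dvd x"
  proof
    assume "pp dvd x"
    then have "pp ^ 1 dvd (1 :: 'p padic_int)"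
      using \<open>x dvd 1\<close> dvd_trans by simp blast
    then show False
      unfolding pp_power_dvd_iff by (simp add: one_padic_int.rep_eq)
  qed
next
  assume "\<not> pp dvd x"
  let ?p = "int CARD('p)"
  have cop: "coprime (padic_residue x n) (?p ^ n)" for n
  proof (cases n)
    case (Suc k)
    have "padic_residue x n mod ?p = padic_residue x 1"
      using padic_residue_mod[of 1 n x] Suc by simp
    then have "\<not> ?p dvd padic_residue x n"
      using \<open>\<not> pp dvd x\<close> pp_dvd_iff[of x] by (simp add: dvd_eq_mod_eq_0)
    then show ?thesis
      using prime_imp_coprime[OF prime_card_int[where ?'a = 'p]] by (simp add: coprime_commute)
  qed simp
  have "\<exists>y\<in>{0..<?p ^ n}. (padic_residue x n * y) mod ?p ^ n = 1 mod ?p ^ n" for n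
  proof -
    obtain y where "[padic_residue x n * y = 1] (mod ?p ^ n)"
      using cong_solve_coprime_int[OF cop] by blast
    then show ?thesis
      by (intro bexI[of _ "y mod ?p ^ n"]) (simp_all add: cong_def mod_simps)
  qed
  then obtain y where y: "\<And>n. y n \<in> {0..<?p ^ n}"
      "\<And>n. (padic_residue x n * y n) mod ?p ^ n = 1 mod ?p ^ n"
    by metis
  have "y (Suc n) mod ?p ^ n = y n" for n
  proof -
    have "?p ^ n dvd ?p ^ Suc n" by simp
    have "(padic_residue x n * y (Suc n)) mod ?p ^ n
        = (padic_residue x (Suc n) * y (Suc n)) mod ?p ^ Suc n mod ?p ^ n"
      unfolding mod_mod_cancel[OF \<open>?p ^ n dvd ?p ^ Suc n\<close>]
      by (rule mod_mult_cong) (use padic_residue_mod[of n "Suc n" x] in simp_all)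
    also have "\<dots> = (padic_residue x n * y n) mod ?p ^ n"
      using y(2)[of "Suc n"] y(2)[of n] \<open>?p ^ n dvd ?p ^ Suc n\<close> by (simp add: mod_mod_cancel)
    finally have "[padic_residue x n * y (Suc n) = padic_residue x n * y n] (mod ?p ^ n)"
      by (simp add: cong_def)
    then have "[y (Suc n) = y n] (mod ?p ^ n)"
      using cop[of n] by (simp add: cong_mult_lcancel)
    then show ?thesis using y(1)[of n] by (simp add: cong_def)
  qed
  then have "y \<in> {x. \<forall>n. x n \<in> {0..<?p ^ n} \<and> x (Suc n) mod ?p ^ n = x n}"
    using y(1) by blast
  then have "padic_residue (Abs_padic_int y :: 'p padic_int) = y"
    by (rule Abs_padic_int_inverse)
  then have "x * Abs_padic_int y = 1"
    by (intro padic_eqI) (simp add: times_padic_int.rep_eq y(2) one_padic_int.rep_eq)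
  then show "x dvd 1" by (rule dvdI[OF sym])
qed

lemma pp_dvd_of_nat_iff: "(pp :: 'p :: prime_card padic_int) dvd of_nat k \<longleftrightarrow> CARD('p) dvd k"
  unfolding pp_dvd_iff padic_residue_of_nat
  by (simp add: dvd_eq_mod_eq_0[symmetric])

lemma pp_dvd_of_int_iff: "(pp :: 'p :: prime_card padic_int) dvd of_int k \<longleftrightarrow> int CARD('p) dvd k"
  unfolding pp_dvd_iff padic_residue_of_int by (simp add: dvd_eq_mod_eq_0)

lemma pp_prime:
  fixes x y :: "'p :: prime_card padic_int"
  shows "pp dvd x * y \<longleftrightarrow> pp dvd x \<or> pp dvd y"
  using is_unit_mult_iff[of x y] unfolding padic_unit_iff by blast

text \<open>\<open>padic_of_rat\<close> is defined through the reduced fraction;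
  cross-multiplication lets later computations use whatever fraction arises.\<close>

lemma padic_of_rat_unique:
  fixes x :: "'p :: prime_card padic_int"
  assumes "of_int b * x = of_int a" "\<not> int CARD('p) dvd b"
  shows "padic_of_rat (of_int a / of_int b) = x"
proof -
  obtain c d where cd: "quotient_of (of_int a / of_int b) = (c, d)" by force
  have b: "b \<noteq> 0" using assms(2) by auto
  have d: "d > 0" and eq: "of_int a / of_int b = (of_int c / of_int d :: rat)"
    using cd quotient_of_denom_pos quotient_of_div by blast+
  have "(of_int (a * d) :: rat) = of_int (c * b)"
    using eq b d by (simp add: field_simps)
  then have ad: "a * d = c * b" by (simp only: of_int_eq_iff)
  have "of_int b * (of_int d * x) = of_int (a * d)"
    using assms(1) by (simp add: mult_ac)
  also have "\<dots> = of_int b * (of_int c :: 'p padic_int)" by (simp add: ad mult_ac)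
  finally have dx: "of_int d * x = of_int c" using b by simp
  have "(THE y :: 'p padic_int. of_int d * y = of_int c) = x"
  proof (rule the_equality)
    show "of_int d * x = of_int c" by (rule dx)
    fix y :: "'p padic_int" assume "of_int d * y = of_int c"
    then have "of_int d * y = of_int d * x" using dx by simp
    then show "y = x" using d by simp
  qed
  then show ?thesis by (simp add: padic_of_rat_def cd)
qed

lemma padic_of_rat_exists:
  assumes "\<not> int CARD('p :: prime_card) dvd b"
  shows "of_int b * (padic_of_rat (of_int a / of_int b) :: 'p padic_int) = of_int a"
proof -
  have "(of_int b :: 'p padic_int) dvd 1"
    using assms by (simp add: padic_unit_iff pp_dvd_of_int_iff)
  then obtain y :: "'p padic_int" where "1 = of_int b * y" by (elim dvdE)
  then have "of_int b * (y * of_int a) = of_int a" by (metis mult.assoc mult_1)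
  from padic_of_rat_unique[OF this assms] this show ?thesis by simp
qed

section \<open>The p-adic gamma function\<close>

text \<open>Multiples of p, among them 0, become 1, so that the factorial without multiples of p is
  a plain product over all i < n with a one-step recursion.\<close>

definition prime_to :: "nat \<Rightarrow> nat \<Rightarrow> nat" where
  "prime_to p i = (if p dvd i then 1 else i)"

definition fact_prime_to :: "nat \<Rightarrow> nat \<Rightarrow> nat" where
  "fact_prime_to p n = (\<Prod>i<n. prime_to p i)"

lemma fact_prime_to_0 [simp]: "fact_prime_to p 0 = 1"
  by (simp add: fact_prime_to_def)

lemma fact_prime_to_Suc: "fact_prime_to p (Suc n) = fact_prime_to p n * prime_to p n"
  by (simp add: fact_prime_to_def)

lemma fact_prime_to_conv_set:
  "fact_prime_to p n = \<Prod>{j. 0 < j \<and> j < n \<and> \<not> p dvd j}"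
proof -
  have "fact_prime_to p n = (\<Prod>i\<in>{..<n}. if \<not> p dvd i then i else 1)"
    unfolding fact_prime_to_def prime_to_def by (intro prod.cong) auto
  also have "\<dots> = \<Prod>{i\<in>{..<n}. \<not> p dvd i}"
    by (rule prod.inter_filter[symmetric]) simp
  also have "{i\<in>{..<n}. \<not> p dvd i} = {j. 0 < j \<and> j < n \<and> \<not> p dvd j}"
    by (auto intro!: Nat.gr0I)
  finally show ?thesis .
qed

lemma coprime_fact_prime_to:
  assumes "prime p"
  shows "\<not> p dvd fact_prime_to p n"
  using assms prime_gt_1_nat[OF assms]
  by (induction n) (auto simp: fact_prime_to_Suc prime_dvd_mult_iff prime_to_def)

text \<open>Translation by m changes neither the residues modulo p^N nor, since p divides m, the
  choice of the skipped factors.\<close>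

lemma fact_prime_to_add_cong:
  assumes "p ^ N dvd m" "N > 0"
  shows "[fact_prime_to p (m + n) = fact_prime_to p m * fact_prime_to p n] (mod p ^ N)"
proof -
  have pm: "p dvd m"
    using assms by (meson dvd_power dvd_trans)
  have "[prime_to p (m + i) = prime_to p i] (mod p ^ N)" for i
    using assms pm by (auto simp: prime_to_def cong_def dvd_add_right_iff mod_add_eq[symmetric, of m])
  then show ?thesis
    by (induction n) (auto simp: fact_prime_to_Suc mult.assoc[symmetric] intro: cong_mult)
qed

lemma fact_prime_to_mult_cong:
  assumes "p ^ N dvd m" "N > 0"
  shows "[fact_prime_to p (k * m) = fact_prime_to p m ^ k] (mod p ^ N)"
proof (induction k)
  case (Suc k)
  have "[fact_prime_to p (m + k * m) = fact_prime_to p m * fact_prime_to p (k * m)] (mod p ^ N)"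
    using assms by (rule fact_prime_to_add_cong)
  also have "[fact_prime_to p m * fact_prime_to p (k * m) = fact_prime_to p m * fact_prime_to p m ^ k] (mod p ^ N)"
    by (intro cong_mult cong_refl Suc)
  finally show ?case by simp
qed simp

lemma fact_prime_to_prime: "prime p \<Longrightarrow> fact_prime_to p p = fact (p - 1)"
proof -
  assume "prime p"
  have "fact_prime_to p p = \<Prod>{1..p - 1}"
    unfolding fact_prime_to_conv_set using prime_gt_1_nat[OF \<open>prime p\<close>]
    by (intro prod.cong) (auto dest: dvd_imp_le)
  then show ?thesis by (simp add: fact_prod)
qed

text \<open>Inversion permutes the units modulo p^N, so their product equals the product of their
  inverses.\<close>

lemma fact_prime_to_square_cong:
  assumes p: "prime p"
  shows "[fact_prime_to p (p ^ N) * fact_prime_to p (p ^ N) = 1] (mod p ^ N)"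
proof (cases "N = 0")
  case False
  define U where "U = {j. 0 < j \<and> j < p ^ N \<and> \<not> p dvd j}"
  have fin: "finite U" by (simp add: U_def)
  have "\<exists>i\<in>U. [j * i = 1] (mod p ^ N)" if j: "j \<in> U" for j
  proof -
    have "coprime j (p ^ N)"
      using prime_imp_coprime[OF p, of j] j by (simp add: U_def coprime_commute)
    then obtain i where i: "[j * i = 1] (mod p ^ N)"
      using cong_solve_coprime_nat[of j "p ^ N"] by auto
    have pN: "p ^ N > 1"
      using prime_gt_1_nat[OF p] False by (intro one_less_power) auto
    have *: "[j * (i mod p ^ N) = 1] (mod p ^ N)"
      using i by (simp add: cong_def mod_simps)
    have "\<not> p dvd i mod p ^ N"
    proof
      assume "p dvd i mod p ^ N"
      then have "[j * (i mod p ^ N) = 0] (mod p)"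
        by (simp add: cong_0_iff)
      moreover have "[j * (i mod p ^ N) = 1] (mod p)"
        using * by (rule cong_dvd_modulus_nat) (use False in simp)
      ultimately have "[0 = 1] (mod p)"
        using cong_sym cong_trans by blast
      then show False
        using prime_gt_1_nat[OF p] by (simp add: cong_def)
    qed
    then have "i mod p ^ N \<in> U"
      using pN by (auto simp: U_def intro!: Nat.gr0I mod_less_divisor)
    then show ?thesis using * by blast
  qed
  then obtain iv where iv: "\<And>j. j \<in> U \<Longrightarrow> iv j \<in> U"
      "\<And>j. j \<in> U \<Longrightarrow> [j * iv j = 1] (mod p ^ N)"
    by metis
  have "inj_on iv U"
  proof (rule inj_onI)
    fix x y assume xy: "x \<in> U" "y \<in> U" "iv x = iv y"
    have "[x * 1 = x * (y * iv y)] (mod p ^ N)"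
      by (rule cong_mult[OF cong_refl cong_sym[OF iv(2)[OF xy(2)]]])
    also have "x * (y * iv y) = y * (x * iv x)"
      by (simp add: xy(3))
    also have "[y * (x * iv x) = y * 1] (mod p ^ N)"
      by (rule cong_mult[OF cong_refl iv(2)[OF xy(1)]])
    finally have "[x = y] (mod p ^ N)" by simp
    then show "x = y"
      using xy by (simp add: cong_def U_def)
  qed
  then have "bij_betw iv U U"
    using fin iv(1) by (simp add: bij_betw_def endo_inj_surj image_subsetI)
  then have "prod (\<lambda>j. iv j) U = \<Prod>U"
    by (rule prod.reindex_bij_betw)
  then have "\<Prod>U * \<Prod>U = (\<Prod>j\<in>U. j * iv j)"
    by (simp add: prod.distrib)
  also have "[(\<Prod>j\<in>U. j * iv j) = (\<Prod>j\<in>U. 1)] (mod p ^ N)"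
    by (rule cong_prod) (rule iv(2))
  finally show ?thesis
    by (simp add: fact_prime_to_conv_set U_def)
qed simp

text \<open>The product P of all units satisfies P^2 = 1. Modulo p it is a power of (p-1)! with the
  odd exponent p^(N-1), hence -1. So P - 1 is prime to p, and in (P - 1)(P + 1) the second factor
  must carry all of p^N.\<close>

lemma wilson_prime_power:
  assumes p: "prime p" "odd p" and "N > 0"
  shows "[int (fact_prime_to p (p ^ N)) = - 1] (mod int p ^ N)"
proof -
  define P where "P = int (fact_prime_to p (p ^ N))"
  have "[fact_prime_to p (p ^ (N - 1) * p) = fact_prime_to p p ^ p ^ (N - 1)] (mod p ^ 1)"
    by (rule fact_prime_to_mult_cong) auto
  then have "[P = int (fact_prime_to p p) ^ p ^ (N - 1)] (mod int p)"
    using \<open>N > 0\<close> unfolding P_def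
    by (cases N) (simp_all add: mult.commute flip: cong_int_iff)
  also have "[int (fact_prime_to p p) = - 1] (mod int p)"
    using wilson_theorem[OF p(1)] by (simp add: fact_prime_to_prime p)
  then have "[int (fact_prime_to p p) ^ p ^ (N - 1) = (- 1) ^ p ^ (N - 1)] (mod int p)"
    by (rule cong_pow)
  also have "(- 1 :: int) ^ p ^ (N - 1) = - 1"
    using p(2) by simp
  finally have "int p dvd P + 1"
    by (simp add: cong_iff_dvd_diff)
  have "p > 2"
    using p prime_ge_2_nat[OF p(1)] by (cases "p = 2") auto
  have "\<not> int p dvd P - 1"
  proof
    assume "int p dvd P - 1"
    then have "int p dvd (P + 1) - (P - 1)"
      using \<open>int p dvd P + 1\<close> by (rule dvd_diff[rotated])
    then show False
      using \<open>p > 2\<close> by (auto dest: zdvd_imp_le)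
  qed
  then have cop: "coprime (P - 1) (int p ^ N)"
    using p(1) prime_imp_coprime[of "int p" "P - 1"] by (simp add: coprime_commute)
  have "[P * P = 1] (mod int p ^ N)"
    using fact_prime_to_square_cong[OF p(1), of N]
    unfolding P_def by (simp flip: cong_int_iff)
  then have "int p ^ N dvd (P - 1) * (P + 1)"
    by (simp add: cong_iff_dvd_diff algebra_simps)
  then have "int p ^ N dvd P + 1"
    using cop by (simp add: coprime_dvd_mult_right_iff coprime_commute)
  then show ?thesis
    by (simp add: P_def cong_iff_dvd_diff)
qed

section \<open>The gamma sequence and its extension to the p-adic integers\<close>

definition gamma_seq :: "nat \<Rightarrow> nat \<Rightarrow> int" where
  "gamma_seq p n = (- 1) ^ n * int (fact_prime_to p n)"

text \<open>By Wilson's theorem a shift by k p^N multiplies the product by (-1)^k; as p is odd, k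
  p^N has the parity of k, and the sign of \<open>gamma_seq\<close> compensates.\<close>

lemma gamma_seq_cong:
  assumes p: "prime p" "odd p" and mn: "[m = n] (mod p ^ N)"
  shows "[gamma_seq p m = gamma_seq p n] (mod int p ^ N)"
proof (cases "N = 0")
  case False
  have step: "[gamma_seq p (n + k * p ^ N) = gamma_seq p n] (mod int p ^ N)" for n k
  proof -
    have "[fact_prime_to p (k * p ^ N + n) = fact_prime_to p (k * p ^ N) * fact_prime_to p n] (mod p ^ N)"
      using False by (intro fact_prime_to_add_cong) auto
    also have "[fact_prime_to p (k * p ^ N) * fact_prime_to p n
        = fact_prime_to p (p ^ N) ^ k * fact_prime_to p n] (mod p ^ N)"
      using False by (intro cong_mult fact_prime_to_mult_cong) auto
    finally have "[int (fact_prime_to p (n + k * p ^ N))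
        = int (fact_prime_to p (p ^ N)) ^ k * int (fact_prime_to p n)] (mod int p ^ N)"
      by (simp add: add.commute flip: cong_int_iff)
    also have "[int (fact_prime_to p (p ^ N)) ^ k * int (fact_prime_to p n)
        = (- 1) ^ k * int (fact_prime_to p n)] (mod int p ^ N)"
      using False p by (intro cong_mult cong_pow wilson_prime_power) auto
    finally have "[(- 1) ^ (n + k * p ^ N) * int (fact_prime_to p (n + k * p ^ N))
        = (- 1) ^ (n + k * p ^ N) * ((- 1) ^ k * int (fact_prime_to p n))] (mod int p ^ N)"
      by (intro cong_mult cong_refl)
    also have "(- 1 :: int) ^ (n + k * p ^ N) * ((- 1) ^ k * int (fact_prime_to p n)) = gamma_seq p n"
    proof -
      have "(- 1 :: int) ^ (k * p ^ N) = (- 1) ^ k"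
        using p(2) by (simp add: minus_one_power_iff)
      then show ?thesis
        by (simp add: gamma_seq_def power_add minus_one_power_iff)
    qed
    finally show ?thesis by (simp add: gamma_seq_def)
  qed
  have red: "[gamma_seq p n = gamma_seq p (n mod p ^ N)] (mod int p ^ N)" for n
    using step[of "n mod p ^ N" "n div p ^ N"] by (simp add: mult.commute)
  show ?thesis
    using red[of m] red[of n] mn by (metis cong_def)
qed simp

lemma gamma_seq_conv:
  "n > 0 \<Longrightarrow> gamma_seq p n = (- 1) ^ n * int (\<Prod>j | 0 < j \<and> j < n \<and> \<not> p dvd j. j)"
  by (simp add: gamma_seq_def fact_prime_to_conv_set)

text \<open>F x modulo p^n is s evaluated at the representative of x modulo p^n; the hypothesis
  makes these residues coherent and F Lipschitz.\<close>

lemma padic_extension: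
  fixes s :: "nat \<Rightarrow> int"
  assumes s: "\<And>N m n. [m = n] (mod CARD('p :: prime_card) ^ N) \<Longrightarrow> [s m = s n] (mod int CARD('p) ^ N)"
  obtains F :: "'p :: prime_card padic_int \<Rightarrow> 'p padic_int"
  where "\<And>n. F (of_nat n) = of_int (s n)"
    "\<And>x y N. padic_residue x N = padic_residue y N \<Longrightarrow> padic_residue (F x) N = padic_residue (F y) N"
proof -
  let ?p = "int CARD('p)"
  define f :: "'p padic_int \<Rightarrow> nat \<Rightarrow> int" where "f x n = s (nat (padic_residue x n)) mod ?p ^ n" for x n
  have "f x \<in> {x. \<forall>n. x n \<in> {0..<?p ^ n} \<and> x (Suc n) mod ?p ^ n = x n}" for x
  proof -
    have "f x (Suc n) mod ?p ^ n = f x n" for n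
    proof -
      have "[nat (padic_residue x (Suc n)) = nat (padic_residue x n)] (mod CARD('p) ^ n)"
        using padic_residue_mod[of n "Suc n" x] padic_residue_bounds[of x n] padic_residue_bounds[of x "Suc n"]
        unfolding cong_int_iff[symmetric] by (simp add: cong_def)
      from s[OF this] show ?thesis
        unfolding f_def by (simp add: cong_def mod_mod_cancel)
    qed
    then show ?thesis by (auto simp: f_def)
  qed
  then have rep: "padic_residue (Abs_padic_int (f x) :: 'p padic_int) = f x" for x
    by (rule Abs_padic_int_inverse)
  show ?thesis
  proof (rule that)
    fix n
    show "Abs_padic_int (f (of_nat n)) = (of_int (s n) :: 'p padic_int)"
    proof (rule padic_eqI)
      fix k
      have "[nat (int n mod ?p ^ k) = n] (mod CARD('p) ^ k)"
        unfolding cong_int_iff[symmetric] by (simp add: cong_def)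
      from s[OF this] show "padic_residue (Abs_padic_int (f (of_nat n)) :: 'p padic_int) k
          = padic_residue (of_int (s n) :: 'p padic_int) k"
        unfolding rep padic_residue_of_int f_def padic_residue_of_nat by (simp add: cong_def)
    qed
  next
    fix x y :: "'p padic_int" and N
    assume "padic_residue x N = padic_residue y N"
    then show "padic_residue (Abs_padic_int (f x) :: 'p padic_int) N = padic_residue (Abs_padic_int (f y) :: 'p padic_int) N"
      unfolding rep f_def by simp
  qed
qed

lemma dist_padic_le_iff:
  fixes x y :: "'p :: prime_card padic_int"
  shows "dist x y \<le> (1 / real CARD('p)) ^ N \<longleftrightarrow> padic_residue x N = padic_residue y N"
proof (cases "x = y")
  case False
  have "dist x y \<le> (1 / real CARD('p)) ^ N \<longleftrightarrow> N \<le> padic_val (x - y)"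
    using False CARD_gt_1[where ?'p = 'p] by (simp add: dist_padic_int_def power_decreasing_iff)
  also have "\<dots> \<longleftrightarrow> padic_residue (x - y) N = 0"
    using False by (intro le_padic_val_iff) simp
  also have "\<dots> \<longleftrightarrow> padic_residue x N = padic_residue y N"
    by (simp only: padic_residue_eq_iff_dvd pp_power_dvd_iff)
  finally show ?thesis .
qed simp

lemma padic_eps:
  assumes "e > 0"
  obtains N where "(1 / real CARD('p :: prime_card)) ^ N < e"
  using real_arch_pow_inv[of e "1 / real CARD('p)"] assms CARD_gt_1[where ?'p = 'p] by auto

lemma padic_continuous:
  fixes f :: "'p :: prime_card padic_int \<Rightarrow> 'p padic_int"
  assumes "\<And>x y N. padic_residue x N = padic_residue y N \<Longrightarrow> padic_residue (f x) N = padic_residue (f y) N"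
  shows "continuous_on UNIV f"
  unfolding continuous_on_eq_continuous_at[OF open_UNIV] isCont_def
proof (intro ballI metric_LIM_I)
  fix x :: "'p padic_int" and e :: real
  assume "e > 0"
  then obtain N where N: "(1 / real CARD('p)) ^ N < e" by (rule padic_eps)
  show "\<exists>d>0. \<forall>x'. x' \<noteq> x \<and> dist x' x < d \<longrightarrow> dist (f x') (f x) < e"
  proof (intro exI[of _ "(1 / real CARD('p)) ^ N"] conjI allI impI)
    fix x' assume "x' \<noteq> x \<and> dist x' x < (1 / real CARD('p)) ^ N"
    then have "dist (f x') (f x) \<le> (1 / real CARD('p)) ^ N"
      using assms by (meson dist_padic_le_iff less_imp_le)
    then show "dist (f x') (f x) < e" using N by simp
  qed simp
qed

lemma padic_continuous_unique:
  fixes f g :: "'p :: prime_card padic_int \<Rightarrow> 'p padic_int"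
  assumes "continuous_on UNIV f" "continuous_on UNIV g"
    and "\<And>n. n > 0 \<Longrightarrow> f (of_nat n) = g (of_nat n)"
  shows "f = g"
proof (rule ext)
  fix x :: "'p padic_int"
  have "\<forall>n. \<exists>k>0. padic_residue (of_nat k :: 'p padic_int) n = padic_residue x n"
  proof (rule allI)
    fix n
    show "\<exists>k>0. padic_residue (of_nat k :: 'p padic_int) n = padic_residue x n"
      using padic_nat_approx[of 0 n x] by auto
  qed
  then obtain k where k: "\<And>n. k n > 0"
      "\<And>n. padic_residue (of_nat (k n) :: 'p padic_int) n = padic_residue x n"
    by metis
  define X where "X = (\<lambda>n. of_nat (k n) :: 'p padic_int)"
  have "X \<longlonglongrightarrow> x"
  proof (rule metric_LIMSEQ_I)
    fix e :: real assume "e > 0"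
    then obtain N where N: "(1 / real CARD('p)) ^ N < e" by (rule padic_eps)
    have "dist (X n) x < e" if "n \<ge> N" for n
    proof -
      have "padic_residue (X n) N = padic_residue x N"
        unfolding X_def using k(2)[of n] that by (rule padic_residue_cong_mono)
      then show ?thesis using N by (meson dist_padic_le_iff le_less_trans)
    qed
    then show "\<exists>no. \<forall>n\<ge>no. dist (X n) x < e" by blast
  qed
  then have "(\<lambda>n. f (X n)) \<longlonglongrightarrow> f x" "(\<lambda>n. g (X n)) \<longlonglongrightarrow> g x"
    using continuous_on_tendsto_compose[OF assms(1), of X x sequentially]
      continuous_on_tendsto_compose[OF assms(2), of X x sequentially] by simp_all
  moreover have "(\<lambda>n. f (X n)) = (\<lambda>n. g (X n))"
    using assms(3) k(1) by (simp add: X_def)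
  ultimately show "f x = g x" by (simp add: LIMSEQ_unique)
qed

text \<open>The extension of \<open>gamma_seq\<close> meets the description in
  \<open>padic_Gamma\<close>, and no other function does because the positive integers are dense.
  The second claim sharpens continuity to a Lipschitz bound, which replaces topology in all later
  limit arguments.\<close>

lemma padic_Gamma_char:
  fixes x y :: "'p :: prime_card padic_int"
  assumes "odd CARD('p)"
  shows "padic_Gamma (of_nat n) = (of_int (gamma_seq CARD('p) n) :: 'p padic_int)"
    and "padic_residue x N = padic_residue y N \<Longrightarrow>
         padic_residue (padic_Gamma x) N = padic_residue (padic_Gamma y) N"
proof -
  let ?p = "CARD('p)"
  obtain F :: "'p padic_int \<Rightarrow> 'p padic_int"
  where F: "\<And>n. F (of_nat n) = of_int (gamma_seq ?p n)"
    "\<And>x y N. padic_residue x N = padic_residue y N \<Longrightarrow> padic_residue (F x) N = padic_residue (F y) N"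
    using padic_extension[of "gamma_seq ?p", where ?'p = 'p] gamma_seq_cong[OF prime_card assms] by blast
  have unit: "F x dvd 1" for x
  proof -
    obtain k where k: "padic_residue (of_nat k :: 'p padic_int) 1 = padic_residue x 1"
      by (rule padic_nat_approx)
    have "\<not> int ?p dvd gamma_seq ?p k"
      using coprime_fact_prime_to[OF prime_card[where ?'a = 'p], of k]
      by (cases "even k") (simp_all add: gamma_seq_def)
    then have "\<not> pp dvd F (of_nat k)"
      by (simp add: F(1) pp_dvd_of_int_iff)
    then show ?thesis
      using F(2)[OF k] by (simp add: padic_unit_iff pp_dvd_iff)
  qed
  let ?P = "\<lambda>f :: 'p padic_int \<Rightarrow> 'p padic_int. continuous_on UNIV f \<and> range f \<subseteq> {u. u dvd 1} \<and> f 0 = 1 \<and>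
     (\<forall>n>0. f (of_nat n) = (-1) ^ n * of_nat (\<Prod>j | 0 < j \<and> j < n \<and> \<not> ?p dvd j. j))"
  have P: "?P F"
  proof (intro conjI allI impI)
    show "continuous_on UNIV F" using F(2) by (rule padic_continuous)
    show "range F \<subseteq> {u. u dvd 1}" using unit by auto
    show "F 0 = 1" using F(1)[of 0] by (simp add: gamma_seq_def)
    fix n :: nat assume "n > 0"
    then show "F (of_nat n) = (-1) ^ n * of_nat (\<Prod>j | 0 < j \<and> j < n \<and> \<not> ?p dvd j. j)"
      unfolding F(1) gamma_seq_conv[OF \<open>n > 0\<close>] by (simp del: of_nat_prod)
  qed
  have "(THE f. ?P f) = F"
  proof (rule the_equality)
    show "?P F" by (rule P)
    fix f assume f: "?P f"
    show "f = F"
      by (rule padic_continuous_unique) (use f P in auto)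
  qed
  then have eq: "padic_Gamma = F" by (simp add: padic_Gamma_def)
  show "padic_Gamma (of_nat n) = (of_int (gamma_seq ?p n) :: 'p padic_int)"
    unfolding eq by (rule F(1))
  show "padic_residue (padic_Gamma x) N = padic_residue (padic_Gamma y) N"
    if "padic_residue x N = padic_residue y N"
    unfolding eq using that by (rule F(2))
qed

lemma padic_Gamma_0:
  assumes "odd CARD('p :: prime_card)"
  shows "padic_Gamma (0 :: 'p padic_int) = 1"
  using padic_Gamma_char(1)[OF assms, of 0] by (simp add: gamma_seq_def)

lemma padic_Gamma_unit:
  fixes x :: "'p :: prime_card padic_int"
  assumes "odd CARD('p)"
  shows "padic_Gamma x dvd 1"
proof -
  let ?p = "CARD('p)"
  obtain k where k: "padic_residue (of_nat k :: 'p padic_int) 1 = padic_residue x 1"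
    by (rule padic_nat_approx)
  have "\<not> int ?p dvd gamma_seq ?p k"
    using coprime_fact_prime_to[OF prime_card[where ?'a = 'p], of k]
    by (cases "even k") (simp_all add: gamma_seq_def)
  then have "\<not> pp dvd padic_Gamma (of_nat k :: 'p padic_int)"
    by (simp add: padic_Gamma_char(1)[OF assms] pp_dvd_of_int_iff)
  then show ?thesis
    using padic_Gamma_char(2)[OF assms k] by (simp add: padic_unit_iff pp_dvd_iff)
qed

lemma padic_Gamma_add_1:
  fixes x :: "'p :: prime_card padic_int"
  assumes "odd CARD('p)"
  shows "padic_Gamma (x + 1) = (if pp dvd x then - padic_Gamma x else - (x * padic_Gamma x))"
proof (rule padic_eqI)
  let ?p = "CARD('p)"
  fix n
  \<comment> \<open>The extra digit decides whether p divides x, also when n = 0.\<close>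
  obtain k where k: "padic_residue (of_nat k :: 'p padic_int) (Suc n) = padic_residue x (Suc n)"
    by (rule padic_nat_approx)
  have kn: "padic_residue x n = padic_residue (of_nat k :: 'p padic_int) n"
    by (rule padic_residue_cong_mono[OF k[symmetric]]) simp
  have iff: "pp dvd x \<longleftrightarrow> pp dvd (of_nat k :: 'p padic_int)"
    unfolding pp_dvd_iff using padic_residue_cong_mono[OF k, of 1] by simp
  have "padic_residue (padic_Gamma (x + 1)) n = padic_residue (padic_Gamma (of_nat (Suc k) :: 'p padic_int)) n"
    using padic_residue_add_cong[OF kn refl, of 1]
    by (intro padic_Gamma_char(2)[OF assms]) (simp add: add.commute)
  also have "padic_Gamma (of_nat (Suc k) :: 'p padic_int)
      = (if pp dvd x then - padic_Gamma (of_nat k) else - (of_nat k * padic_Gamma (of_nat k)))"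
    unfolding iff padic_Gamma_char(1)[OF assms] gamma_seq_def fact_prime_to_Suc
    by (simp add: prime_to_def pp_dvd_of_nat_iff mult_ac)
  also have "padic_residue \<dots> n = padic_residue (if pp dvd x then - padic_Gamma x else - (x * padic_Gamma x)) n"
    using kn padic_Gamma_char(2)[OF assms kn]
    by (auto intro!: padic_residue_uminus_cong padic_residue_mult_cong)
  finally show "padic_residue (padic_Gamma (x + 1)) n
      = padic_residue (if pp dvd x then - padic_Gamma x else - (x * padic_Gamma x)) n" .
qed

section \<open>Teichmueller representatives\<close>

text \<open>In x^p - y^p = (x - y) S the p summands of S all agree with y^(p-1) modulo p, so S
  supplies one more factor p.\<close>

lemma pp_power_dvd_power_diff:
  fixes x y :: "'p :: prime_card padic_int"
  assumes "pp ^ N dvd x - y" "N > 0"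
  shows "pp ^ Suc N dvd x ^ CARD('p) - y ^ CARD('p)"
proof -
  let ?p = "CARD('p)"
  let ?S = "\<Sum>i<?p. y ^ (?p - Suc i) * x ^ i"
  have "pp dvd x - y"
    using assms by (meson dvd_power dvd_trans)
  then have xy: "padic_residue x 1 = padic_residue y 1"
    by (simp add: padic_residue_eq_iff_dvd)
  have "pp dvd y ^ (?p - Suc i) * x ^ i - y ^ (?p - 1)" if "i < ?p" for i
  proof -
    have "padic_residue (y ^ (?p - Suc i) * x ^ i) 1 = padic_residue (y ^ (?p - Suc i) * y ^ i) 1"
      by (intro padic_residue_mult_cong padic_residue_power_cong refl xy)
    moreover have "y ^ (?p - Suc i) * y ^ i = y ^ (?p - 1)"
      using that by (simp flip: power_add)
    ultimately show ?thesis by (simp add: padic_residue_eq_iff_dvd)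
  qed
  then have "pp dvd (\<Sum>i<?p. y ^ (?p - Suc i) * x ^ i - y ^ (?p - 1))"
    by (intro dvd_sum) auto
  then have "pp dvd ?S - pp * y ^ (?p - 1)"
    by (simp add: sum_subtractf)
  then have "pp dvd ?S"
    by (metis diff_add_cancel dvd_add dvd_triv_left)
  with assms(1) have "pp ^ N * pp dvd (x - y) * ?S"
    by (rule mult_dvd_mono)
  then show ?thesis
    by (simp add: power_diff_sumr2 mult.commute)
qed

lemma pp_power_dvd_power_power_diff:
  fixes x y :: "'p :: prime_card padic_int"
  assumes "pp dvd x - y"
  shows "pp ^ Suc k dvd x ^ CARD('p) ^ k - y ^ CARD('p) ^ k"
proof (induction k)
  case (Suc k)
  have "pp ^ Suc (Suc k) dvd (x ^ CARD('p) ^ k) ^ CARD('p) - (y ^ CARD('p) ^ k) ^ CARD('p)"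
    by (rule pp_power_dvd_power_diff[OF Suc]) simp
  then show ?case by (simp add: power_mult[symmetric] mult.commute)
qed (use assms in simp)

lemma padic_fermat:
  fixes x :: "'p :: prime_card padic_int"
  shows "pp dvd x ^ CARD('p) - x"
proof -
  let ?p = "CARD('p)"
  have p: "prime ?p" by (rule prime_card)
  obtain k where k: "padic_residue (of_nat k :: 'p padic_int) 1 = padic_residue x 1"
    by (rule padic_nat_approx)
  have "[k ^ ?p = k] (mod ?p)"
  proof (cases "?p dvd k")
    case True
    then show ?thesis
      using prime_gt_0_nat[OF p] by (metis cong_0_iff cong_sym cong_trans dvd_power dvd_trans)
  next
    case False
    have "[k * k ^ (?p - 1) = k * 1] (mod ?p)"
      by (intro cong_mult cong_refl fermat_theorem p False)
    then show ?thesis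
      using prime_gt_0_nat[OF p] by (simp add: power_eq_if)
  qed
  then have "[int (k ^ ?p) = int k] (mod int ?p)"
    by (simp only: cong_int_iff)
  then have "padic_residue (of_nat (k ^ ?p) :: 'p padic_int) 1 = padic_residue (of_nat k :: 'p padic_int) 1"
    unfolding padic_residue_of_nat by (simp add: cong_def)
  then have "padic_residue (x ^ ?p) 1 = padic_residue x 1"
    using k padic_residue_power_cong[OF k, of ?p] by simp
  then show ?thesis by (simp add: padic_residue_eq_iff_dvd)
qed

text \<open>Raising to the p-th power fixes x and y but gains a digit of agreement each
  time.\<close>

lemma padic_frobenius_fixed_unique:
  fixes x y :: "'p :: prime_card padic_int"
  assumes "x ^ CARD('p) = x" "y ^ CARD('p) = y" "pp dvd x - y"
  shows "x = y"
proof (rule padic_eqI)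
  fix n
  have *: "z ^ CARD('p) ^ k = z" if "z ^ CARD('p) = z" for z :: "'p padic_int" and k
    using that by (induction k) (simp_all add: power_mult)
  have "pp ^ Suc n dvd x - y"
    using pp_power_dvd_power_power_diff[OF assms(3), of n] *[OF assms(1)] *[OF assms(2)] by simp
  then have "padic_residue x (Suc n) = padic_residue y (Suc n)"
    by (simp only: padic_residue_eq_iff_dvd)
  then show "padic_residue x n = padic_residue y n"
    by (rule padic_residue_cong_mono) simp
qed

lemma padic_frobenius_fixed_exists:
  fixes x :: "'p :: prime_card padic_int"
  obtains w where "w ^ CARD('p) = w" "pp dvd w - x"
proof -
  let ?p = "CARD('p)"
  \<comment> \<open>The limit of x^(p^n), read off digit by digit: by \<open>padic_fermat\<close>
    consecutive terms agree to precision n + 1.\<close>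
  define f where "f = (\<lambda>n. padic_residue (x ^ ?p ^ n) n)"
  have step: "padic_residue (x ^ ?p ^ Suc n) n = padic_residue (x ^ ?p ^ n) n" for n
  proof -
    have "pp ^ Suc n dvd (x ^ ?p) ^ ?p ^ n - x ^ ?p ^ n"
      by (rule pp_power_dvd_power_power_diff[OF padic_fermat])
    then have "padic_residue (x ^ ?p ^ Suc n) (Suc n) = padic_residue (x ^ ?p ^ n) (Suc n)"
      by (simp only: padic_residue_eq_iff_dvd) (simp add: power_mult)
    then show ?thesis by (rule padic_residue_cong_mono) simp
  qed
  have "f \<in> {x. \<forall>n. x n \<in> {0..<int ?p ^ n} \<and> x (Suc n) mod int ?p ^ n = x n}"
  proof (intro CollectI allI conjI)
    fix n
    show "f n \<in> {0..<int ?p ^ n}"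
      using padic_residue_bounds[of "x ^ ?p ^ n" n] by (simp add: f_def)
    show "f (Suc n) mod int ?p ^ n = f n"
      using padic_residue_mod[of n "Suc n" "x ^ ?p ^ Suc n"] step[of n] by (simp add: f_def)
  qed
  then have rep: "padic_residue (Abs_padic_int f :: 'p padic_int) = f"
    by (rule Abs_padic_int_inverse)
  define w where "w = (Abs_padic_int f :: 'p padic_int)"
  have w: "padic_residue w n = padic_residue (x ^ ?p ^ n) n" for n
    unfolding w_def rep by (simp add: f_def)
  show ?thesis
  proof (rule that)
    show "w ^ ?p = w"
    proof (rule padic_eqI)
      fix n
      have "padic_residue (w ^ ?p) n = padic_residue ((x ^ ?p ^ n) ^ ?p) n"
        by (intro padic_residue_power_cong w)
      also have "(x ^ ?p ^ n) ^ ?p = x ^ ?p ^ Suc n"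
        by (simp add: power_mult[symmetric] mult.commute)
      finally show "padic_residue (w ^ ?p) n = padic_residue w n"
        by (simp only: step w)
    qed
    have "padic_residue w 1 = padic_residue (x ^ ?p) 1"
      using w[of 1] by simp
    also have "\<dots> = padic_residue x 1"
      using padic_fermat[of x] by (simp add: padic_residue_eq_iff_dvd)
    finally show "pp dvd w - x" by (simp add: padic_residue_eq_iff_dvd)
  qed
qed

text \<open>In contrast to \<open>teichmuller\<close>, the equation w^p = w admits w = 0, so this
  lift is multiplicative on the whole field and sends 0 to 0.\<close>

definition teich :: "'p :: prime_card mod_ring \<Rightarrow> 'p padic_int" where
  "teich a = (THE w. w ^ CARD('p) = w \<and> pp dvd w - of_int (to_int_mod_ring a))"

lemma teich_char:
  fixes a :: "'p :: prime_card mod_ring"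
  shows teich_power_card: "teich a ^ CARD('p) = teich a"
    and pp_dvd_teich_diff: "pp dvd teich a - of_int (to_int_mod_ring a)"
proof -
  let ?P = "\<lambda>w :: 'p padic_int. w ^ CARD('p) = w \<and> pp dvd w - of_int (to_int_mod_ring a)"
  obtain w where w: "?P w" by (metis padic_frobenius_fixed_exists)
  have "?P (THE w. ?P w)"
  proof (rule theI)
    show "?P w" by (rule w)
    fix v assume v: "?P v"
    have "pp dvd (v - of_int (to_int_mod_ring a)) - (w - of_int (to_int_mod_ring a))"
      by (rule dvd_diff[OF conjunct2[OF v] conjunct2[OF w]])
    then show "v = w"
      using v w by (auto intro: padic_frobenius_fixed_unique[of v w])
  qed
  then show "teich a ^ CARD('p) = teich a" "pp dvd teich a - of_int (to_int_mod_ring a)"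
    unfolding teich_def by auto
qed

lemma teich_eqI:
  fixes a :: "'p :: prime_card mod_ring"
  assumes "w ^ CARD('p) = w" "pp dvd w - of_int k" "a = of_int k"
  shows "teich a = w"
proof (rule padic_frobenius_fixed_unique[OF teich_power_card assms(1)])
  have "to_int_mod_ring a = k mod int CARD('p)"
    unfolding assms(3) by (simp add: of_int_of_int_mod_ring, transfer, simp)
  then have "int CARD('p) dvd to_int_mod_ring a - k"
    by (metis dvd_minus_mod dvd_diff_commute)
  then have "(pp :: 'p padic_int) dvd of_int (to_int_mod_ring a) - of_int k"
    unfolding of_int_diff[symmetric] pp_dvd_of_int_iff .
  then have "pp dvd (teich a - of_int (to_int_mod_ring a))
      + (of_int (to_int_mod_ring a) - of_int k) - (w - of_int k)"
    by (rule dvd_diff[OF dvd_add[OF pp_dvd_teich_diff] assms(2)])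
  then show "pp dvd teich a - w" by simp
qed

lemma mod_ring_of_int_to_int: "of_int (to_int_mod_ring a) = (a :: 'p :: prime_card mod_ring)"
  by (simp add: of_int_of_int_mod_ring)

lemma pp_dvd_teich_of_int: "pp dvd (teich (of_int k :: 'p :: prime_card mod_ring) - of_int k)"
proof -
  obtain w :: "'p padic_int" where w: "w ^ CARD('p) = w" "pp dvd w - of_int k"
    by (rule padic_frobenius_fixed_exists)
  then show ?thesis using teich_eqI[OF w refl] by simp
qed

lemma teich_0 [simp]: "teich (0 :: 'p :: prime_card mod_ring) = 0"
  by (rule teich_eqI[where k = 0]) auto

lemma teich_1 [simp]: "teich (1 :: 'p :: prime_card mod_ring) = 1"
  by (rule teich_eqI[where k = 1]) auto

lemma teich_mult: "teich (a * b) = teich a * teich (b :: 'p :: prime_card mod_ring)"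
proof (rule teich_eqI)
  let ?a = "to_int_mod_ring a" and ?b = "to_int_mod_ring b"
  show "(teich a * teich b) ^ CARD('p) = teich a * teich b"
    by (simp add: power_mult_distrib teich_power_card)
  show "a * b = of_int (?a * ?b)" by (simp add: mod_ring_of_int_to_int)
  have eq: "teich a * teich b - of_int (?a * ?b)
      = (teich a - of_int ?a) * teich b + of_int ?a * (teich b - of_int ?b)"
    by (simp add: algebra_simps)
  show "pp dvd teich a * teich b - of_int (?a * ?b)"
    unfolding eq by (rule dvd_add[OF dvd_mult2[OF pp_dvd_teich_diff] dvd_mult[OF pp_dvd_teich_diff]])
qed

lemma teich_power: "teich (a ^ k) = teich (a :: 'p :: prime_card mod_ring) ^ k"
  by (induction k) (simp_all add: teich_mult)

lemma pp_dvd_teich_add: "pp dvd teich a + teich b - teich (a + b :: 'p :: prime_card mod_ring)"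
proof -
  let ?a = "to_int_mod_ring a" and ?b = "to_int_mod_ring b"
  have "pp dvd teich (a + b) - (of_int (?a + ?b) :: 'p padic_int)"
    using pp_dvd_teich_of_int[of "?a + ?b", where ?'p = 'p] by (simp add: mod_ring_of_int_to_int)
  then have "pp dvd (teich a - of_int ?a) + (teich b - of_int ?b) - (teich (a + b) - of_int (?a + ?b))"
    by (rule dvd_diff[OF dvd_add[OF pp_dvd_teich_diff pp_dvd_teich_diff]])
  then show ?thesis by (simp add: algebra_simps)
qed

lemma teich_eq_0_iff [simp]: "teich a = 0 \<longleftrightarrow> a = (0 :: 'p :: prime_card mod_ring)"
proof
  assume "teich a = 0"
  then have "teich a * teich (inverse a) = 0" by simp
  then have "teich (a * inverse a) = 0" by (simp only: teich_mult)
  then show "a = 0" by (cases "a = 0") auto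
qed simp

lemma teich_power_card_minus_1:
  assumes "a \<noteq> (0 :: 'p :: prime_card mod_ring)"
  shows "teich a ^ (CARD('p) - Suc 0) = 1"
proof -
  have "teich a * teich a ^ (CARD('p) - Suc 0) = teich a * 1"
    using teich_power_card[of a] CARD_gt_1[where ?'p = 'p] by (simp flip: power_Suc)
  then show ?thesis using assms by simp
qed

lemma teich_inj: "teich a = teich b \<longleftrightarrow> a = (b :: 'p :: prime_card mod_ring)"
proof
  assume eq: "teich a = teich b"
  show "a = b"
  proof (cases "b = 0")
    case False
    have "pp dvd of_int (to_int_mod_ring a) - (of_int (to_int_mod_ring b) :: 'p padic_int)"
    proof -
      have "pp dvd (teich b - of_int (to_int_mod_ring b)) - (teich a - of_int (to_int_mod_ring a))"
        by (rule dvd_diff[OF pp_dvd_teich_diff pp_dvd_teich_diff])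
      then show ?thesis using eq by simp
    qed
    then have "int CARD('p) dvd to_int_mod_ring a - to_int_mod_ring b"
      unfolding of_int_diff[symmetric] pp_dvd_of_int_iff .
    then have "to_int_mod_ring a mod int CARD('p) = to_int_mod_ring b mod int CARD('p)"
      by (simp add: mod_eq_dvd_iff)
    then have "to_int_mod_ring a = to_int_mod_ring b"
      by transfer simp
    then show ?thesis by simp
  qed (use eq in simp)
qed simp

lemma teichmuller_eq_teich:
  assumes "a \<noteq> (0 :: 'p :: prime_card mod_ring)"
  shows "teichmuller a = teich a"
  unfolding teichmuller_def
proof (rule the_equality)
  show "teich a ^ (CARD('p) - 1) = 1 \<and> pp dvd teich a - of_int (to_int_mod_ring a)"
    using assms by (simp add: teich_power_card_minus_1 pp_dvd_teich_diff)
  fix w :: "'p padic_int"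
  assume w: "w ^ (CARD('p) - 1) = 1 \<and> pp dvd w - of_int (to_int_mod_ring a)"
  have "w ^ CARD('p) = w ^ Suc (CARD('p) - 1)"
    using CARD_gt_1[where ?'p = 'p] by simp
  also have "\<dots> = w" by (simp only: power_Suc conjunct1[OF w] mult_1_right)
  finally show "w = teich a"
    using w by (intro teich_eqI[symmetric, where k = "to_int_mod_ring a"]) (simp_all add: mod_ring_of_int_to_int)
qed

text \<open>Multiplying the variable by b permutes the nonzero elements and multiplies the sum by
  the k-th power of \<open>teich b\<close>. A suitable b exists because X^r - 1 has at most r < p -
  1 roots, r being the residue of k.\<close>

lemma sum_teich_power:
  "(\<Sum>a\<in>UNIV - {0 :: 'p :: prime_card mod_ring}. teich a ^ k)
    = (if (CARD('p) - 1) dvd k then of_nat (CARD('p) - 1) else 0)"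
proof (cases "(CARD('p) - 1) dvd k")
  case True
  then obtain m where "k = (CARD('p) - 1) * m" by blast
  then have "(\<Sum>a\<in>UNIV - {0 :: 'p mod_ring}. teich a ^ k) = (\<Sum>a\<in>UNIV - {0 :: 'p mod_ring}. 1)"
    by (intro sum.cong) (simp_all add: power_mult teich_power_card_minus_1)
  then show ?thesis using True by (simp add: card_Diff_singleton)
next
  case False
  let ?q = "CARD('p) - 1"
  let ?S = "\<Sum>a\<in>UNIV - {0 :: 'p mod_ring}. teich a ^ k"
  define r where "r = k mod ?q"
  have r: "0 < r" "r < ?q"
    using False CARD_gt_1[where ?'p = 'p] by (auto simp: r_def dvd_eq_mod_eq_0)
  have red: "teich b ^ k = teich b ^ r" if "b \<noteq> 0" for b :: "'p mod_ring"
  proof -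
    have "teich b ^ k = teich b ^ (?q * (k div ?q) + r)" by (simp add: r_def)
    then show ?thesis using that by (simp add: power_add power_mult teich_power_card_minus_1)
  qed
  have "\<exists>b :: 'p mod_ring. b \<noteq> 0 \<and> b ^ r \<noteq> 1"
  proof (rule ccontr)
    assume "\<not> ?thesis"
    then have sub: "UNIV - {0 :: 'p mod_ring} \<subseteq> {x. poly (monom 1 r - 1) x = 0}"
      by (auto simp: poly_monom)
    have "coeff (monom 1 r - 1 :: 'p mod_ring poly) r = 1"
      using r by simp
    then have nz: "monom 1 r - 1 \<noteq> (0 :: 'p mod_ring poly)"
      by (metis coeff_0 zero_neq_one)
    have "card (UNIV - {0 :: 'p mod_ring}) \<le> card {x :: 'p mod_ring. poly (monom 1 r - 1) x = 0}"
      using sub nz by (intro card_mono poly_roots_finite)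
    also have "\<dots> \<le> degree (monom 1 r - 1 :: 'p mod_ring poly)"
      using nz by (rule poly_roots_degree)
    also have "\<dots> \<le> r"
      by (intro degree_diff_le degree_monom_le) simp_all
    finally show False using r by (simp add: card_Diff_singleton)
  qed
  then obtain b :: "'p mod_ring" where b: "b \<noteq> 0" "b ^ r \<noteq> 1" by blast
  have "teich b ^ k * ?S = (\<Sum>a\<in>UNIV - {0 :: 'p mod_ring}. teich (b * a) ^ k)"
    by (simp add: sum_distrib_left teich_mult power_mult_distrib)
  also have "\<dots> = ?S"
    by (rule sum.reindex_bij_witness[of _ "\<lambda>a. a / b" "\<lambda>a. b * a"]) (use b in auto)
  finally have "(teich b ^ k - 1) * ?S = 0" by (simp add: algebra_simps)
  moreover have "teich b ^ k \<noteq> 1"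
    using b red[of b] teich_inj[of "b ^ r" 1] by (simp add: teich_power)
  ultimately show ?thesis using False by simp
qed

section \<open>Reflection and multiplication formulas\<close>

lemma pp_power_dvd_unit_mult_iff:
  fixes u y :: "'p :: prime_card padic_int"
  assumes "u dvd 1"
  shows "pp ^ k dvd u * y \<longleftrightarrow> pp ^ k dvd y"
proof
  assume *: "pp ^ k dvd u * y"
  obtain v where "1 = u * v" using assms by (elim dvdE)
  then have "y = v * (u * y)" by (metis mult.commute mult.left_commute mult_1)
  then show "pp ^ k dvd y" using * by (metis dvd_mult)
qed simp

text \<open>This is (p^k - 1)/(p - 1), a natural number congruent to -1/(p - 1) modulo p^k.\<close>

definition repunit :: "nat \<Rightarrow> nat \<Rightarrow> nat" where
  "repunit p k = (\<Sum>i<k. p ^ i)"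

lemma repunit_Suc: "repunit p (Suc k) = p * repunit p k + 1"
  unfolding repunit_def by (subst sum.lessThan_Suc_shift) (simp add: sum_distrib_left)

lemma repunit_Suc': "repunit p (Suc k) = repunit p k + p ^ k"
  by (simp add: repunit_def)

lemma repunit_mult:
  fixes x :: "'a :: comm_ring_1"
  shows "(of_nat p - 1) * (of_nat (repunit p k) :: 'a) = of_nat p ^ k - 1"
  by (simp add: repunit_def power_diff_1_eq)

lemma pp_minus_1_unit: "(pp - 1 :: 'p :: prime_card padic_int) dvd 1"
proof -
  have "\<not> (pp :: 'p padic_int) dvd pp - 1"
    by (metis dvd_diff_right_iff dvd_refl padic_unit_iff dvd_add_right_iff diff_add_cancel dvd_diff_commute)
  then show ?thesis by (simp add: padic_unit_iff)
qed

text \<open>\<open>r/(p - 1) = 1 + (p - 1 - r)(1 + p + p\<^sup>2 + \<dots>)\<close> in \<open>Z\<^sub>p\<close>.\<close>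

lemma fraction_approx:
  fixes x :: "'p :: prime_card padic_int"
  assumes x: "(pp - 1) * x = of_nat r" and r: "r \<le> CARD('p) - 1"
  shows "padic_residue (of_nat (1 + (CARD('p) - 1 - r) * repunit CARD('p) k) :: 'p padic_int) k
       = padic_residue x k"
proof -
  define s where "s = CARD('p) - 1 - r"
  have s: "of_nat s = (pp - 1 - of_nat r :: 'p padic_int)"
    using r CARD_gt_1[where ?'p = 'p] by (simp add: s_def of_nat_diff)
  have "(pp - 1) * (of_nat (1 + s * repunit CARD('p) k) - x)
      = (pp - 1) + of_nat s * ((pp - 1) * of_nat (repunit CARD('p) k)) - (pp - 1) * x"
    by (simp add: algebra_simps)
  also have "\<dots> = pp ^ k * of_nat s"
    unfolding x repunit_mult s by (simp add: algebra_simps)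
  finally have "pp ^ k dvd (pp - 1) * (of_nat (1 + s * repunit CARD('p) k) - x)"
    by simp
  then show ?thesis
    unfolding s_def by (simp only: pp_power_dvd_unit_mult_iff[OF pp_minus_1_unit] padic_residue_eq_iff_dvd)
qed

definition count_prime_to :: "nat \<Rightarrow> nat \<Rightarrow> nat" where
  "count_prime_to p n = (\<Sum>i<n. if p dvd i then 0 else 1)"

lemma count_prime_to_0 [simp]: "count_prime_to p 0 = 0"
  by (simp add: count_prime_to_def)

lemma count_prime_to_Suc:
  "count_prime_to p (Suc n) = count_prime_to p n + (if p dvd n then 0 else 1)"
  by (simp add: count_prime_to_def)

text \<open>Below n there are ceil(n/p) multiples of p, with 0 among them.\<close>

lemma count_prime_to_add_div: "p > 0 \<Longrightarrow> count_prime_to p n + (n + p - 1) div p = n"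
proof (induction n)
  case (Suc n)
  have "Suc (n + p - 1) = n + p" using Suc.prems by simp
  then have "(n + p) div p = (if p dvd n then Suc ((n + p - 1) div p) else (n + p - 1) div p)"
    using div_Suc[of "n + p - 1" p] by (simp add: dvd_eq_mod_eq_0)
  then show ?case
    using Suc by (auto simp: count_prime_to_Suc)
qed simp

text \<open>Along the approximations of r/(p - 1) the count is s p^k with s = p - 1 - r. Hence m to
  this count is (m^(p^k))^s, which tends to a power of the Teichmueller lift of m.\<close>

lemma count_prime_to_approx:
  assumes "s < p"
  shows "count_prime_to p (1 + s * repunit p (Suc k)) = s * p ^ k"
proof -
  let ?n = "1 + s * repunit p (Suc k)"
  have "?n + p - 1 = s + (1 + s * repunit p k) * p"
    unfolding repunit_Suc using assms by (simp add: algebra_simps)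
  then have "(?n + p - 1) div p = 1 + s * repunit p k"
    using assms by simp
  then have "count_prime_to p ?n + (1 + s * repunit p k) = 1 + s * repunit p (Suc k)"
    using count_prime_to_add_div[of p ?n] assms by simp
  then show ?thesis unfolding repunit_Suc' by (simp add: algebra_simps)
qed

text \<open>On natural numbers the functional equation flips the sign of the product exactly when n
  is prime to p. Along the approximations of x the number of flips is (p - 1 - r) p^k, which has the
  parity of r.\<close>

lemma padic_Gamma_reflection:
  fixes x :: "'p :: prime_card padic_int"
  assumes p: "odd CARD('p)" and x: "(pp - 1) * x = of_nat r" and r: "r \<le> CARD('p) - 1"
  shows "padic_Gamma x * padic_Gamma (1 - x) = - ((- 1) ^ r)"
proof (rule padic_eqI)
  fix k
  let ?p = "CARD('p)"
  define g :: "nat \<Rightarrow> 'p padic_int" where "g n = padic_Gamma (of_nat n) * padic_Gamma (1 - of_nat n)" for n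
  have g: "g n = - ((- 1) ^ count_prime_to ?p n)" for n
  proof (induction n)
    case 0
    show ?case using padic_Gamma_add_1[OF p, of 0] by (simp add: g_def padic_Gamma_0[OF p])
  next
    case (Suc n)
    have dvd: "pp dvd - (of_nat n :: 'p padic_int) \<longleftrightarrow> ?p dvd n"
      by (simp add: pp_dvd_of_nat_iff)
    have 1: "padic_Gamma (of_nat (Suc n) :: 'p padic_int)
        = (if ?p dvd n then - padic_Gamma (of_nat n) else - (of_nat n * padic_Gamma (of_nat n)))"
      using padic_Gamma_add_1[OF p, of "of_nat n"] by (simp add: pp_dvd_of_nat_iff add.commute)
    have 2: "padic_Gamma (1 - of_nat n :: 'p padic_int)
        = (if ?p dvd n then - padic_Gamma (1 - of_nat (Suc n)) else of_nat n * padic_Gamma (1 - of_nat (Suc n)))"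
      using padic_Gamma_add_1[OF p, of "- of_nat n"] unfolding dvd by simp
    have "g (Suc n) = (if ?p dvd n then g n else - g n)"
      unfolding g_def 1 2 by (simp add: mult_ac)
    then show ?case using Suc by (simp add: count_prime_to_Suc)
  qed
  let ?n = "1 + (?p - 1 - r) * repunit ?p (Suc k)"
  have approx: "padic_residue (of_nat ?n :: 'p padic_int) (Suc k) = padic_residue x (Suc k)"
    using x r by (rule fraction_approx)
  have "padic_residue (padic_Gamma x * padic_Gamma (1 - x)) (Suc k) = padic_residue (g ?n) (Suc k)"
    unfolding g_def
    by (rule padic_residue_mult_cong padic_Gamma_char(2)[OF p] padic_residue_diff_cong refl approx[symmetric])+
  also have "count_prime_to ?p ?n = (?p - 1 - r) * ?p ^ k"
    by (rule count_prime_to_approx) (use CARD_gt_1[where ?'p = 'p] in simp)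
  then have "g ?n = - ((- 1) ^ ((?p - 1 - r) * ?p ^ k))"
    by (simp only: g)
  also have "even ((?p - 1 - r) * ?p ^ k) \<longleftrightarrow> even r"
    using p r CARD_gt_1[where ?'p = 'p] by auto
  then have "(- 1) ^ ((?p - 1 - r) * ?p ^ k) = ((- 1) ^ r :: 'p padic_int)"
    by (simp only: minus_one_power_iff)
  finally show "padic_residue (padic_Gamma x * padic_Gamma (1 - x)) k = padic_residue (- ((- 1) ^ r) :: 'p padic_int) k"
    by (rule padic_residue_cong_mono) simp
qed

text \<open>Passing from y to y + 1 only replaces the factor at y/m by the one at y/m + 1. So A
  satisfies the functional equation of \<Gamma>_p up to a factor 1/m for each argument prime to p;
  these factors accumulate to m^\<open>count_prime_to\<close>, and in the limit to a power of the
  Teichmueller lift.\<close>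

lemma padic_Gamma_multiplication:
  fixes x \<mu> :: "'p :: prime_card padic_int"
  assumes p: "odd CARD('p)" and x: "(pp - 1) * x = of_nat r" and r: "r \<le> CARD('p) - 1"
    and m: "m > 0" "of_nat m * \<mu> = 1"
  shows "(\<Prod>i<m. padic_Gamma ((x + of_nat i) * \<mu>)) * teich (of_nat m) ^ (CARD('p) - 1 - r)
       = (\<Prod>i<m. padic_Gamma (of_nat i * \<mu>)) * padic_Gamma x"
proof (rule padic_eqI)
  fix k
  let ?p = "CARD('p)"
  define A :: "'p padic_int \<Rightarrow> 'p padic_int" where "A y = (\<Prod>i<m. padic_Gamma ((y + of_nat i) * \<mu>))" for y
  have \<mu>: "\<mu> dvd 1" "\<not> pp dvd \<mu>"
    using m(2) padic_unit_iff by (metis dvd_triv_right)+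
  have nz: "padic_Gamma y \<noteq> 0" for y :: "'p padic_int"
    using padic_Gamma_unit[OF p, of y] by auto
  have A_step: "of_nat m * A (y + 1) = (if pp dvd y then - of_nat m * A y else - y * A y)" for y
  proof -
    define F where "F i = padic_Gamma ((y + of_nat i) * \<mu>)" for i
    have "F 0 * A (y + 1) = F 0 * (\<Prod>i<m. F (Suc i))"
      by (simp add: A_def F_def add_ac)
    also have "\<dots> = (\<Prod>i<Suc m. F i)"
      by (subst prod.lessThan_Suc_shift) simp
    also have "\<dots> = A y * F m" by (simp add: A_def F_def)
    also have "F m = padic_Gamma (y * \<mu> + 1)"
      using m by (simp add: F_def distrib_right)
    also have "\<dots> = (if pp dvd y then - F 0 else - (y * \<mu> * F 0))"
      using \<mu>(2) by (simp add: padic_Gamma_add_1[OF p] pp_prime F_def)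
    finally have "F 0 * A (y + 1) = F 0 * (if pp dvd y then - A y else - (\<mu> * (y * A y)))"
      by (simp add: mult_ac)
    then have "A (y + 1) = (if pp dvd y then - A y else - (\<mu> * (y * A y)))"
      by (rule mult_left_cancel[THEN iffD1, rotated]) (simp add: F_def nz)
    then show ?thesis using m(2) by (simp add: mult.assoc[symmetric])
  qed
  have key: "A (of_nat n) * of_nat m ^ count_prime_to ?p n = A 0 * padic_Gamma (of_nat n)" for n
  proof (induction n)
    case 0
    show ?case by (simp add: padic_Gamma_0[OF p])
  next
    case (Suc n)
    have m0: "(of_nat m :: 'p padic_int) \<noteq> 0" using m by simp
    have step: "of_nat m * A (1 + of_nat n) = (if ?p dvd n then - of_nat m * A (of_nat n) else - of_nat n * A (of_nat n))"
      using A_step[of "of_nat n"] by (simp add: pp_dvd_of_nat_iff add.commute)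
    have G: "padic_Gamma (1 + of_nat n :: 'p padic_int)
        = (if ?p dvd n then - padic_Gamma (of_nat n) else - of_nat n * padic_Gamma (of_nat n))"
      using padic_Gamma_add_1[OF p, of "of_nat n"] by (simp add: pp_dvd_of_nat_iff add.commute)
    show ?case
    proof (cases "?p dvd n")
      case True
      then have "of_nat m * A (1 + of_nat n) = of_nat m * (- A (of_nat n))"
        using step by simp
      then have "A (1 + of_nat n) = - A (of_nat n)" using m0 by (simp only: mult_cancel_left) simp
      then show ?thesis using Suc True G by (simp add: count_prime_to_Suc)
    next
      case False
      have "A (of_nat (Suc n)) * of_nat m ^ count_prime_to ?p (Suc n)
          = (of_nat m * A (1 + of_nat n)) * of_nat m ^ count_prime_to ?p n"
        using False by (simp add: count_prime_to_Suc mult_ac)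
      also have "\<dots> = - of_nat n * (A (of_nat n) * of_nat m ^ count_prime_to ?p n)"
        using False step by simp
      also have "\<dots> = A 0 * padic_Gamma (of_nat (Suc n))"
        using False G Suc by simp
      finally show ?thesis .
    qed
  qed
  let ?n = "1 + (?p - 1 - r) * repunit ?p (Suc k)"
  have approx: "padic_residue (of_nat ?n :: 'p padic_int) (Suc k) = padic_residue x (Suc k)"
    using x r by (rule fraction_approx)
  have "pp dvd teich (of_nat m) - (of_nat m :: 'p padic_int)"
    using pp_dvd_teich_of_int[of "int m", where ?'p = 'p] by simp
  then have "pp ^ Suc k dvd teich (of_nat m) ^ ?p ^ k - (of_nat m :: 'p padic_int) ^ ?p ^ k"
    by (rule pp_power_dvd_power_power_diff)
  moreover have "teich (of_nat m :: 'p mod_ring) ^ ?p ^ k = teich (of_nat m)"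
    by (induction k) (simp_all add: power_mult teich_power_card)
  ultimately have t: "padic_residue (teich (of_nat m) :: 'p padic_int) (Suc k) = padic_residue (of_nat m ^ ?p ^ k :: 'p padic_int) (Suc k)"
    by (simp only: padic_residue_eq_iff_dvd)
  have A_cong: "padic_residue (A y) (Suc k) = padic_residue (A z) (Suc k)"
    if "padic_residue y (Suc k) = padic_residue z (Suc k)" for y z
    unfolding A_def
    by (intro padic_residue_prod_cong)
       (rule padic_residue_mult_cong padic_Gamma_char(2)[OF p] padic_residue_add_cong refl that)+
  have "padic_residue (A x * teich (of_nat m) ^ (?p - 1 - r)) (Suc k)
      = padic_residue (A (of_nat ?n) * (of_nat m ^ ?p ^ k) ^ (?p - 1 - r)) (Suc k)"
    by (rule padic_residue_mult_cong padic_residue_power_cong A_cong t approx[symmetric])+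
  also have "(of_nat m ^ ?p ^ k) ^ (?p - 1 - r) = (of_nat m :: 'p padic_int) ^ ((?p - 1 - r) * ?p ^ k)"
    by (simp only: power_mult[symmetric] mult.commute)
  also have "(?p - 1 - r) * ?p ^ k = count_prime_to ?p ?n"
    by (rule count_prime_to_approx[symmetric]) (use CARD_gt_1[where ?'p = 'p] in simp)
  also have "A (of_nat ?n) * of_nat m ^ count_prime_to ?p ?n = A 0 * padic_Gamma (of_nat ?n)"
    by (rule key)
  also have "padic_residue (A 0 * padic_Gamma (of_nat ?n)) (Suc k) = padic_residue (A 0 * padic_Gamma x) (Suc k)"
    by (rule padic_residue_mult_cong padic_Gamma_char(2)[OF p] refl approx)+
  finally have "padic_residue (A x * teich (of_nat m) ^ (?p - 1 - r)) k = padic_residue (A 0 * padic_Gamma x) k"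
    by (rule padic_residue_cong_mono) simp
  then show "padic_residue ((\<Prod>i<m. padic_Gamma ((x + of_nat i) * \<mu>)) * teich (of_nat m) ^ (?p - 1 - r)) k
      = padic_residue ((\<Prod>i<m. padic_Gamma (of_nat i * \<mu>)) * padic_Gamma x) k"
    by (simp add: A_def)
qed

section \<open>Dwork coefficients\<close>

unbundle fps_syntax

section \<open>Integrality and divisibility by powers of p inside the fraction field\<close>

definition Zp :: "'p :: prime_card padic set" where
  "Zp = range to_fract"

lemma to_fract_Zp [simp, intro]: "to_fract x \<in> Zp"
  by (simp add: Zp_def)

lemma to_fract_of_nat: "to_fract (of_nat n) = of_nat n"
  by (induction n) simp_all

lemma to_fract_of_int: "to_fract (of_int n) = of_int n"
  by (cases n) (simp_all add: to_fract_of_nat del: of_nat_Suc)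

lemma to_fract_power: "to_fract (x ^ n) = to_fract x ^ n"
  by (induction n) simp_all

lemma to_fract_prod: "to_fract (prod f A) = (\<Prod>x\<in>A. to_fract (f x))"
  by (induction A rule: infinite_finite_induct) simp_all

lemma Zp_0 [simp, intro]: "0 \<in> Zp" and Zp_1 [simp, intro]: "1 \<in> Zp"
  using to_fract_Zp[of 0] to_fract_Zp[of 1] by simp_all

lemma Zp_add [intro]: "x \<in> Zp \<Longrightarrow> y \<in> Zp \<Longrightarrow> x + y \<in> Zp"
  by (auto simp: Zp_def simp flip: to_fract_add)

lemma Zp_mult [intro]: "x \<in> Zp \<Longrightarrow> y \<in> Zp \<Longrightarrow> x * y \<in> Zp"
  by (auto simp: Zp_def simp flip: to_fract_mult)

lemma Zp_uminus [intro]: "x \<in> Zp \<Longrightarrow> - x \<in> Zp"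
  by (auto simp: Zp_def simp flip: to_fract_uminus)

lemma Zp_diff [intro]: "x \<in> Zp \<Longrightarrow> y \<in> Zp \<Longrightarrow> x - y \<in> Zp"
  by (auto simp: Zp_def simp flip: to_fract_diff)

lemma Zp_of_nat [simp, intro]: "of_nat n \<in> Zp"
  by (metis to_fract_of_nat to_fract_Zp)

lemma Zp_power [intro]: "x \<in> Zp \<Longrightarrow> x ^ n \<in> Zp"
  by (auto simp: Zp_def simp flip: to_fract_power)

lemma Zp_sum [intro]: "(\<And>x. x \<in> A \<Longrightarrow> f x \<in> Zp) \<Longrightarrow> sum f A \<in> Zp"
  by (induction A rule: infinite_finite_induct) auto

lemma Zp_inverse_unit: "u dvd 1 \<Longrightarrow> inverse (to_fract u) \<in> Zp"
  by (metis dvdE inverse_unique to_fract_1 to_fract_Zp to_fract_mult)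

definition pdvd :: "nat \<Rightarrow> 'p :: prime_card padic \<Rightarrow> bool" where
  "pdvd n x \<longleftrightarrow> x / of_nat CARD('p) ^ n \<in> Zp"

lemma of_nat_card_neq_0 [simp]: "(of_nat CARD('p :: prime_card) :: 'p padic) \<noteq> 0"
  using CARD_gt_1[where ?'p = 'p] by simp

lemma pdvd_0 [simp]: "pdvd n 0"
  by (simp add: pdvd_def)

lemma pdvd_0_iff [simp]: "pdvd 0 x \<longleftrightarrow> x \<in> Zp"
  by (simp add: pdvd_def)

lemma pdvd_add: "pdvd n x \<Longrightarrow> pdvd n y \<Longrightarrow> pdvd n (x + y)"
  by (auto simp: pdvd_def add_divide_distrib)

lemma pdvd_uminus: "pdvd n x \<Longrightarrow> pdvd n (- x)"
  by (auto simp: pdvd_def)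

lemma pdvd_diff: "pdvd n x \<Longrightarrow> pdvd n y \<Longrightarrow> pdvd n (x - y)"
  by (auto simp: pdvd_def diff_divide_distrib)

lemma pdvd_mult: "pdvd m x \<Longrightarrow> pdvd n y \<Longrightarrow> pdvd (m + n) (x * y)"
  unfolding pdvd_def power_add by (metis Zp_mult times_divide_times_eq)

lemma pdvd_mult_left: "x \<in> Zp \<Longrightarrow> pdvd n y \<Longrightarrow> pdvd n (x * y)"
  using pdvd_mult[of 0 x n y] by simp

lemma pdvd_sum: "(\<And>x. x \<in> A \<Longrightarrow> pdvd n (f x)) \<Longrightarrow> pdvd n (sum f A)"
  by (induction A rule: infinite_finite_induct) (auto intro: pdvd_add)

lemma pdvd_mono:
  assumes "pdvd n x" "m \<le> n"
  shows "pdvd m x"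
proof -
  have eq: "x / of_nat CARD('a) ^ m = x / of_nat CARD('a) ^ n * of_nat CARD('a) ^ (n - m)"
    using assms(2) by (simp add: field_simps flip: power_add)
  show ?thesis
    using assms(1) unfolding pdvd_def eq by (intro Zp_mult Zp_power Zp_of_nat)
qed

lemma pdvd_power: "pdvd n (of_nat CARD('p) ^ n :: 'p :: prime_card padic)"
  by (simp add: pdvd_def)

lemma pdvd_imp_Zp: "pdvd n x \<Longrightarrow> x \<in> Zp"
  using pdvd_mono[of n x 0] by simp

lemma pdvd_to_fract_iff:
  fixes x :: "'p :: prime_card padic_int"
  shows "pdvd n (to_fract x) \<longleftrightarrow> pp ^ n dvd x"
proof -
  have "pdvd n (to_fract x) \<longleftrightarrow> (\<exists>y. to_fract x = to_fract (pp ^ n * y))"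
    by (auto simp: pdvd_def Zp_def to_fract_power to_fract_of_nat field_simps image_iff)
  then show ?thesis by (simp only: to_fract_eq_iff dvd_def)
qed

lemma pdvd_cong_iff:
  fixes x y :: "'p :: prime_card padic_int"
  shows "pdvd n (to_fract x - to_fract y) \<longleftrightarrow> padic_residue x n = padic_residue y n"
  unfolding to_fract_diff[symmetric] pdvd_to_fract_iff padic_residue_eq_iff_dvd ..

lemma pdvd_all_imp_0:
  assumes "\<And>n. pdvd n x"
  shows "x = 0"
proof -
  obtain y where y: "x = to_fract y"
    using assms[of 0] by (auto simp: Zp_def)
  have "y = 0"
  proof (rule padic_eqI)
    fix n
    have "pdvd n (to_fract y - to_fract 0)" using assms[of n] y by simp
    then show "padic_residue y n = padic_residue (0 :: 'a padic_int) n" by (simp only: pdvd_cong_iff)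
  qed
  then show ?thesis using y by simp
qed

lemma Zp_inverse_of_nat: "\<not> CARD('p) dvd n \<Longrightarrow> inverse (of_nat n :: 'p :: prime_card padic) \<in> Zp"
  by (metis Zp_inverse_unit padic_unit_iff pp_dvd_of_nat_iff to_fract_of_nat)

lemma pdvd_div_unit:
  assumes "\<not> CARD('p) dvd n" "pdvd k (of_nat n * x)"
  shows "pdvd k (x :: 'p :: prime_card padic)"
proof -
  have "n \<noteq> 0" using assms(1) by (cases "n = 0") auto
  then have "inverse (of_nat n) * (of_nat n * x) = x" by simp
  with pdvd_mult_left[OF Zp_inverse_of_nat[OF assms(1)] assms(2)] show ?thesis by (simp only:)
qed

section \<open>Dwork's exponential and its recurrence\<close>

definition dwork_arg :: "'p :: prime_card padic fps" where
  "dwork_arg = fps_X + fps_const (1 / of_nat CARD('p)) * fps_X ^ CARD('p)"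

text \<open>For a root \<pi> of \<pi>^(p-1) = -p, substituting \<pi>X into X + X^p/p gives \<pi>(X -
  X^p). So u = 1 yields Dwork's splitting function before rescaling, with coefficients that do not
  involve \<pi>.\<close>

definition dwork_exp :: "'p :: prime_card padic \<Rightarrow> 'p padic fps" where
  "dwork_exp u = fps_compose (fps_exp u) dwork_arg"

definition dwork_coeff :: "nat \<Rightarrow> 'p :: prime_card padic" where
  "dwork_coeff n = dwork_exp 1 $ n"

lemma dwork_arg_nth_0 [simp]: "(dwork_arg :: 'p :: prime_card padic fps) $ 0 = 0"
  using CARD_gt_1[where ?'p = 'p] by (simp add: dwork_arg_def)

lemma dwork_exp_nth_0 [simp]: "dwork_exp u $ 0 = 1"
  by (simp add: dwork_exp_def)

lemma dwork_exp_add: "dwork_exp (u + v) = dwork_exp u * dwork_exp v"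
  by (simp add: dwork_exp_def fps_exp_add_mult fps_compose_mult_distrib)

lemma dwork_exp_0 [simp]: "dwork_exp 0 = 1"
  by (simp add: dwork_exp_def)

text \<open>Coefficients of the differential equation F' = u (1 + X^(p-1)) F.\<close>

lemma dwork_exp_rec:
  fixes u :: "'p :: prime_card padic"
  assumes "n > 0"
  shows "of_nat n * dwork_exp u $ n
       = u * (dwork_exp u $ (n - 1) + (if CARD('p) \<le> n then dwork_exp u $ (n - CARD('p)) else 0))"
proof -
  let ?p = "CARD('p)"
  have p: "?p > 1" by (rule CARD_gt_1)
  obtain m where m: "n = Suc m" using assms by (cases n) auto
  have "fps_deriv (dwork_arg :: 'p padic fps) = 1 + fps_X ^ (?p - 1)"
  proof -
    have "fps_deriv (dwork_arg :: 'p padic fps)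
        = 1 + fps_const (1 / of_nat ?p) * (of_nat ?p * fps_X ^ (?p - 1))"
      by (simp add: dwork_arg_def fps_deriv_power fps_of_nat)
    also have "fps_const (1 / of_nat ?p) * (of_nat ?p * fps_X ^ (?p - 1))
        = fps_const (1 / of_nat ?p * of_nat ?p) * (fps_X ^ (?p - 1) :: 'p padic fps)"
      by (simp only: fps_const_mult[symmetric] mult.assoc) (simp add: fps_of_nat)
    finally show ?thesis by simp
  qed
  moreover have "fps_deriv (fps_exp u) oo dwork_arg = fps_const u * dwork_exp u"
    by (simp add: dwork_exp_def fps_compose_mult_distrib)
  ultimately have "fps_deriv (dwork_exp u) = fps_const u * (dwork_exp u + fps_X ^ (?p - 1) * dwork_exp u)"
    unfolding dwork_exp_def by (simp add: fps_compose_deriv algebra_simps)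
  then have "fps_deriv (dwork_exp u) $ m
      = u * (dwork_exp u $ m + (if m < ?p - 1 then 0 else dwork_exp u $ (m - (?p - 1))))"
    by (simp add: fps_X_power_mult_nth)
  moreover have "m < ?p - 1 \<longleftrightarrow> \<not> ?p \<le> n" "m - (?p - 1) = n - ?p"
    using m p by auto
  ultimately show ?thesis by (simp add: m)
qed

text \<open>For u^p = u one has u(X + X^p/p) = uX + (uX)^p/p, so the parameter u merely rescales the
  variable.\<close>

lemma dwork_exp_frobenius_fixed:
  fixes u :: "'p :: prime_card padic"
  assumes "u ^ CARD('p) = u"
  shows "dwork_exp u $ n = u ^ n * dwork_coeff n"
proof (induction n rule: less_induct)
  case (less n)
  let ?p = "CARD('p)"
  have p: "?p > 1" by (rule CARD_gt_1)
  show ?case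
  proof (cases "n = 0")
    case False
    have 1: "u * u ^ (n - 1) = u ^ n"
      using False by (simp flip: power_Suc)
    have 2: "u * u ^ (n - ?p) = u ^ n" if "?p \<le> n"
    proof -
      have "u ^ ?p * u ^ (n - ?p) = u ^ n" using that by (simp flip: power_add)
      then show ?thesis by (simp only: assms)
    qed
    have "of_nat n * dwork_exp u $ n = u * (u ^ (n - 1) * dwork_coeff (n - 1)
        + (if ?p \<le> n then u ^ (n - ?p) * dwork_coeff (n - ?p) else 0))"
      using dwork_exp_rec[of n u] less[of "n - 1"] less[of "n - ?p"] False p by auto
    also have "\<dots> = u * u ^ (n - 1) * dwork_coeff (n - 1)
        + (if ?p \<le> n then u * u ^ (n - ?p) * dwork_coeff (n - ?p) else 0)"
      by (simp add: algebra_simps)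
    also have "\<dots> = u ^ n * (dwork_coeff (n - 1) + (if ?p \<le> n then dwork_coeff (n - ?p) else 0))"
      using 1 2 by (simp add: algebra_simps)
    also have "\<dots> = u ^ n * (of_nat n * dwork_coeff n)"
      using dwork_exp_rec[of n "1 :: 'p padic"] False by (simp add: dwork_coeff_def)
    finally have "of_nat n * dwork_exp u $ n = of_nat n * (u ^ n * dwork_coeff n)"
      by (simp add: mult_ac)
    then show ?thesis using False by simp
  qed (simp add: dwork_coeff_def)
qed

lemma dwork_coeff_0 [simp]: "dwork_coeff 0 = 1"
  by (simp add: dwork_coeff_def)

lemma dwork_coeff_rec:
  assumes "n > 0"
  shows "of_nat n * (dwork_coeff n :: 'p :: prime_card padic)
       = dwork_coeff (n - 1) + (if CARD('p) \<le> n then dwork_coeff (n - CARD('p)) else 0)"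
  using dwork_exp_rec[OF assms, of "1 :: 'p padic"] by (simp add: dwork_coeff_def)

section \<open>Sums of Dwork coefficients and factorials without multiples of p\<close>

definition ffact :: "'a :: comm_ring_1 \<Rightarrow> nat \<Rightarrow> 'a" where
  "ffact x i = (\<Prod>t<i. x - of_nat t)"

lemma ffact_0 [simp]: "ffact x 0 = 1"
  by (simp add: ffact_def)

lemma ffact_Suc: "ffact x (Suc i) = ffact x i * (x - of_nat i)"
  by (simp add: ffact_def)

lemma ffact_Suc': "ffact x (Suc i) = x * ffact (x - 1) i"
  unfolding ffact_def by (subst prod.lessThan_Suc_shift) (simp add: algebra_simps)

lemma ffact_of_nat_eq_0: "n < i \<Longrightarrow> ffact (of_nat n) i = 0"
  by (auto simp: ffact_def intro!: prod_zero bexI[of _ n])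

lemma ffact_add_1: "ffact (x + 1) (Suc i) = ffact x (Suc i) + of_nat (Suc i) * ffact x i"
  using ffact_Suc'[of "x + 1" i] by (simp add: ffact_Suc[of x] algebra_simps)

lemma ffact_of_nat: "(ffact (of_nat n) i :: 'a :: comm_ring_1) = of_nat (fact i * (n choose i))"
proof (induction n arbitrary: i)
  case 0
  show ?case by (cases i) (simp_all add: ffact_Suc')
next
  case (Suc n)
  show ?case
  proof (cases i)
    case (Suc j)
    have "(ffact (of_nat (Suc n)) i :: 'a) = ffact (of_nat n) (Suc j) + of_nat (Suc j) * ffact (of_nat n) j"
      unfolding Suc using ffact_add_1[of "of_nat n :: 'a" j] by (simp add: add.commute)
    also have "\<dots> = of_nat (fact (Suc j) * (n choose Suc j) + Suc j * (fact j * (n choose j)))"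
      unfolding Suc.IH by (simp only: of_nat_add of_nat_mult)
    also have "fact (Suc j) * (n choose Suc j) + Suc j * (fact j * (n choose j)) = fact i * (Suc n choose i)"
      unfolding Suc by (simp add: algebra_simps)
    finally show ?thesis .
  qed simp
qed

lemma Zp_ffact: "x \<in> Zp \<Longrightarrow> ffact x i \<in> Zp"
  by (induction i) (auto simp: ffact_Suc)

text \<open>Origin: comparing coefficients of X^(pn+a) in exp X = exp(-X^p/p) exp(X + X^p/p), for a
  < p, and multiplying by (-p)^n n! shows that this sum is (-p)^n n!/(pn+a)!. The powers of p and
  the n! cancel the multiples of p in the factorial.\<close>

definition dwork_sum :: "nat \<Rightarrow> nat \<Rightarrow> 'p :: prime_card padic" where
  "dwork_sum a n = (\<Sum>i\<le>n. (- of_nat CARD('p)) ^ i * ffact (of_nat n) i * dwork_coeff (a + CARD('p) * i))"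

text \<open>Split a + pn = (a + pi) + p(n - i) in the i-th term. The first part is resolved by the
  recurrence of the coefficients; the second raises the falling factorial to index i + 1, and it
  cancels the unwanted half of the recurrence by telescoping.\<close>

lemma dwork_sum_rec:
  assumes "0 < a" "a < CARD('p :: prime_card)"
  shows "of_nat (a + CARD('p) * n) * (dwork_sum a n :: 'p padic) = dwork_sum (a - 1) n"
proof -
  let ?p = "CARD('p)"
  \<comment> \<open>Here and in the later proofs the local \<open>\<pi>\<close> is the prime p
    itself as an element of the fraction field, not a root of -p.\<close>
  define \<pi> where "\<pi> = (of_nat ?p :: 'p padic)"
  define f where "f i = (- \<pi>) ^ i * ffact (of_nat n) i" for i
  define g where "g i = f i * (if i = 0 then 0 else dwork_coeff (a + ?p * (i - 1)))" for i
  have rec: "(of_nat a + \<pi> * of_nat i) * dwork_coeff (a + ?p * i)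
      = dwork_coeff (a - 1 + ?p * i) + (if i = 0 then 0 else dwork_coeff (a + ?p * (i - 1)))" for i
    using dwork_coeff_rec[of "a + ?p * i", where ?'p = 'p] assms
    by (cases i) (auto simp: \<pi>_def algebra_simps)
  have fS: "f i * (\<pi> * (of_nat n - of_nat i)) = - f (Suc i)" for i
    by (simp add: f_def ffact_Suc algebra_simps)
  have "of_nat (a + ?p * n) * (dwork_sum a n :: 'p padic)
      = (\<Sum>i\<le>n. (of_nat a + \<pi> * of_nat n) * (f i * dwork_coeff (a + ?p * i)))"
    by (simp add: dwork_sum_def f_def \<pi>_def sum_distrib_left)
  also have "\<dots> = (\<Sum>i\<le>n. f i * ((of_nat a + \<pi> * of_nat i) * dwork_coeff (a + ?p * i))
      + f i * (\<pi> * (of_nat n - of_nat i)) * dwork_coeff (a + ?p * i))"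
    by (intro sum.cong refl) (simp add: algebra_simps)
  also have "\<dots> = (\<Sum>i\<le>n. f i * dwork_coeff (a - 1 + ?p * i) + (g i - g (Suc i)))"
    unfolding rec fS by (intro sum.cong refl) (simp add: g_def algebra_simps)
  also have "\<dots> = dwork_sum (a - 1) n + (\<Sum>i\<le>n. g i - g (Suc i))"
    by (simp only: sum.distrib dwork_sum_def f_def \<pi>_def)
  also have "(\<Sum>i\<le>n. g i - g (Suc i)) = g 0 - g (Suc n)"
    using sum_lessThan_telescope'[of g "Suc n"] by (simp add: lessThan_Suc_atMost)
  also have "\<dots> = 0"
    by (simp add: g_def f_def ffact_of_nat_eq_0)
  finally show ?thesis by simp
qed

lemma dwork_coeff_rec_mult:
  "of_nat CARD('p) * of_nat (Suc i) * (dwork_coeff (CARD('p) * Suc i) :: 'p :: prime_card padic)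
     = dwork_coeff (CARD('p) - 1 + CARD('p) * i) + dwork_coeff (CARD('p) * i)"
proof -
  let ?p = "CARD('p)"
  have "of_nat (?p * Suc i) * (dwork_coeff (?p * Suc i) :: 'p padic)
      = dwork_coeff (?p * Suc i - 1) + dwork_coeff (?p * Suc i - ?p)"
    using dwork_coeff_rec[of "?p * Suc i", where ?'p = 'p] by simp
  moreover have "?p * Suc i - 1 = ?p - 1 + ?p * i" "?p * Suc i - ?p = ?p * i"
    using CARD_gt_1[where ?'p = 'p] by simp_all
  ultimately show ?thesis by (simp only: of_nat_mult)
qed

text \<open>The Pascal rule for falling factorials passes from n + 1 to n and brings in p(i+1)
  c_(p(i+1)). The recurrence replaces this by two coefficients, one of which cancels the original
  sum.\<close>

lemma dwork_sum_0_Suc: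
  "dwork_sum 0 (Suc n) = - (dwork_sum (CARD('p) - 1) n :: 'p :: prime_card padic)"
proof -
  let ?p = "CARD('p)"
  define \<pi> where "\<pi> = (of_nat ?p :: 'p padic)"
  define f where "f i = (- \<pi>) ^ i * ffact (of_nat n) i" for i
  define c where "c i = (dwork_coeff (?p * i) :: 'p padic)" for i
  have "dwork_sum 0 (Suc n) = (\<Sum>i\<le>Suc n. (- \<pi>) ^ i * ffact (of_nat n + 1) i * c i)"
    by (simp add: dwork_sum_def \<pi>_def c_def add.commute)
  also have "\<dots> = 1 + (\<Sum>i\<le>n. (- \<pi>) ^ Suc i * ffact (of_nat n + 1) (Suc i) * c (Suc i))"
    by (subst sum.atMost_Suc_shift) (simp add: c_def)
  also have "\<dots> = 1 + (\<Sum>i\<le>n. f (Suc i) * c (Suc i) - f i * (\<pi> * of_nat (Suc i) * c (Suc i)))"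
    unfolding ffact_add_1 f_def
    by (intro arg_cong2[of _ _ _ _ "(+)"] sum.cong refl) (simp add: algebra_simps)
  also have "\<dots> = (1 + (\<Sum>i\<le>n. f (Suc i) * c (Suc i))) - (\<Sum>i\<le>n. f i * (\<pi> * of_nat (Suc i) * c (Suc i)))"
    by (simp only: sum_subtractf add_diff_eq)
  also have "1 + (\<Sum>i\<le>n. f (Suc i) * c (Suc i)) = (\<Sum>i\<le>Suc n. f i * c i)"
    by (subst sum.atMost_Suc_shift) (simp add: c_def f_def)
  also have "\<dots> = (\<Sum>i\<le>n. f i * c i)"
    by (simp add: f_def ffact_of_nat_eq_0)
  also have "(\<Sum>i\<le>n. f i * (\<pi> * of_nat (Suc i) * c (Suc i)))
      = (\<Sum>i\<le>n. f i * dwork_coeff (?p - 1 + ?p * i)) + (\<Sum>i\<le>n. f i * c i)"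
    unfolding \<pi>_def c_def dwork_coeff_rec_mult by (simp only: sum.distrib[symmetric] distrib_left)
  finally show ?thesis by (simp add: dwork_sum_def f_def \<pi>_def)
qed

text \<open>For fixed n the index a climbs from 0 to p - 1; then \<open>dwork_sum_0_Suc\<close>
  carries over to a = 0 and n + 1, where the factor skipped is a multiple of p.\<close>

lemma dwork_sum_eq:
  assumes "a < CARD('p :: prime_card)"
  shows "(dwork_sum a n :: 'p padic) * of_nat (fact_prime_to CARD('p) (CARD('p) * n + a + 1)) = (- 1) ^ n"
  using assms
proof (induction n arbitrary: a)
  let ?p = "CARD('p)"
  have step: "(dwork_sum a n :: 'p padic) * of_nat (fact_prime_to ?p (?p * n + a + 1)) = (- 1) ^ n"
    if "(dwork_sum 0 n :: 'p padic) * of_nat (fact_prime_to ?p (?p * n + 1)) = (- 1) ^ n" "a < ?p" for a n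
    using that
  proof (induction a)
    case (Suc a)
    have "fact_prime_to ?p (?p * n + Suc a + 1) = fact_prime_to ?p (?p * n + a + 1) * (Suc a + ?p * n)"
    proof -
      have "\<not> ?p dvd Suc a" using Suc.prems(2) by (auto dest: dvd_imp_le)
      then have "\<not> ?p dvd Suc (?p * n + a)"
        using dvd_add_right_iff[of ?p "?p * n" "Suc a"] by simp
      then show ?thesis by (simp add: fact_prime_to_Suc prime_to_def)
    qed
    then have "dwork_sum (Suc a) n * of_nat (fact_prime_to ?p (?p * n + Suc a + 1))
      = (of_nat (Suc a + ?p * n) * dwork_sum (Suc a) n) * (of_nat (fact_prime_to ?p (?p * n + a + 1)) :: 'p padic)"
      by (simp only: of_nat_mult mult_ac)
    also have "\<dots> = (- 1) ^ n"
      using Suc dwork_sum_rec[of "Suc a" n, where ?'p = 'p] by simp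
    finally show ?case .
  qed simp
  {
    case 0
    show ?case by (rule step) (use 0 in \<open>simp_all add: dwork_sum_def fact_prime_to_Suc prime_to_def\<close>)
  next
    case (Suc n)
    have p: "?p > 1" by (rule CARD_gt_1)
    have "fact_prime_to ?p (?p * Suc n + 1) = fact_prime_to ?p (?p * n + (?p - 1) + 1)"
      using p by (simp add: fact_prime_to_Suc prime_to_def add.commute)
    then have "(dwork_sum 0 (Suc n) :: 'p padic) * of_nat (fact_prime_to ?p (?p * Suc n + 1)) = (- 1) ^ Suc n"
      unfolding dwork_sum_0_Suc using Suc.IH[of "?p - 1"] p by simp
    then show ?case using Suc.prems by (rule step)
  }
qed

section \<open>Growth of the Dwork coefficients\<close>

lemma dwork_sum_Zp:
  assumes "a < CARD('p :: prime_card)"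
  shows "(dwork_sum a n :: 'p padic) \<in> Zp"
proof -
  let ?P = "fact_prime_to CARD('p) (CARD('p) * n + a + 1)"
  have cop: "\<not> CARD('p) dvd ?P"
    by (rule coprime_fact_prime_to[OF prime_card])
  then have "?P \<noteq> 0" by (cases "?P = 0") auto
  then have "(dwork_sum a n :: 'p padic) = (- 1) ^ n * inverse (of_nat ?P)"
    using dwork_sum_eq[OF assms, of n] by (simp add: field_simps)
  also have "\<dots> \<in> Zp"
    using Zp_inverse_of_nat[OF cop] by (intro Zp_mult Zp_power Zp_uminus) auto
  finally show ?thesis .
qed

text \<open>The Mahler coefficients of \<open>dwork_sum a\<close>.\<close>

definition dwork_diff :: "nat \<Rightarrow> nat \<Rightarrow> 'p :: prime_card padic" where
  "dwork_diff a i = (- of_nat CARD('p)) ^ i * of_nat (fact i) * dwork_coeff (a + CARD('p) * i)"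

text \<open>Binomial inversion of an integral sequence is integral: the top binomial coefficient is
  1, so the n-th difference can be solved for recursively.\<close>

lemma dwork_diff_Zp:
  assumes "a < CARD('p :: prime_card)"
  shows "(dwork_diff a i :: 'p padic) \<in> Zp"
proof (induction i rule: less_induct)
  case (less n)
  have "dwork_sum a n = (\<Sum>i\<le>n. of_nat (n choose i) * (dwork_diff a i :: 'p padic))"
    unfolding dwork_sum_def ffact_of_nat dwork_diff_def
    by (intro sum.cong refl) (simp add: mult_ac)
  then have "dwork_diff a n = dwork_sum a n - (\<Sum>i<n. of_nat (n choose i) * (dwork_diff a i :: 'p padic))"
    by (simp add: lessThan_Suc_atMost[symmetric])
  also have "\<dots> \<in> Zp"
    using less dwork_sum_Zp[OF assms] by (intro Zp_diff Zp_sum Zp_mult) auto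
  finally show ?case .
qed

lemma dwork_diff_rec:
  assumes "0 < a" "a < CARD('p :: prime_card)"
  shows "of_nat (a + CARD('p) * i) * (dwork_diff a i :: 'p padic)
       = dwork_diff (a - 1) i - (if i = 0 then 0 else of_nat (CARD('p) * i) * dwork_diff a (i - 1))"
  using dwork_coeff_rec[of "a + CARD('p) * i", where ?'p = 'p] assms
  by (cases i) (auto simp: dwork_diff_def algebra_simps)

lemma dwork_diff_0_Suc:
  "dwork_diff 0 (Suc i) = - (dwork_diff (CARD('p) - 1) i + dwork_diff 0 i :: 'p :: prime_card padic)"
proof -
  have "dwork_diff 0 (Suc i) = - ((- of_nat CARD('p)) ^ i * of_nat (fact i)
      * (of_nat CARD('p) * of_nat (Suc i) * dwork_coeff (CARD('p) * Suc i) :: 'p padic))"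
    by (simp add: dwork_diff_def algebra_simps)
  then show ?thesis
    unfolding dwork_coeff_rec_mult by (simp add: dwork_diff_def algebra_simps)
qed

lemma not_dvd_add_mult: "0 < a \<Longrightarrow> a < p \<Longrightarrow> \<not> p dvd a + p * (i :: nat)"
  by (auto simp: dvd_add_left_iff dest: dvd_imp_le)

text \<open>Each two steps in i gain a factor p. Modulo p^(e+1) the product M(p-1) = \<Prod>(t + pj)
  carries the difference at p - 1 to that at 0, the errors being p times differences of index j - 1.
  By Wilson's theorem M(p-1) is -1 modulo p, so the two differences in
  \<open>dwork_diff_0_Suc\<close> add up to 0 modulo p^(e+1). The recurrence then spreads this from
  a = 0 to all a.\<close>

lemma dwork_diff_pdvd:
  assumes "a < CARD('p :: prime_card)"
  shows "pdvd ((i + 1) div 2) (dwork_diff a i :: 'p padic)"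
  using assms
proof (induction i arbitrary: a rule: less_induct)
  case (less i)
  let ?p = "CARD('p)"
  let ?D = "dwork_diff :: nat \<Rightarrow> nat \<Rightarrow> 'p padic"
  have p: "prime ?p" "?p > 1" using CARD_gt_1 prime_card by auto
  show ?case
  proof (cases i)
    case 0
    then show ?thesis using dwork_diff_Zp[OF less.prems] by simp
  next
    case (Suc j)
    define e where "e = j div 2"
    have IH1: "pdvd e (?D b j)" if "b < ?p" for b
      using less.IH[of j b] Suc that by (auto simp: e_def elim!: pdvd_mono)
    have IH2: "pdvd e (?D b (j - 1))" if "b < ?p" for b
      using less.IH[of "j - 1" b] Suc that by (cases j) (auto simp: e_def dwork_diff_Zp)
    have pmul: "pdvd (Suc e) (of_nat (?p * k) * x)" if "pdvd e x" for k and x :: "'p padic"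
    proof -
      have "pdvd (1 + e) (of_nat ?p * (of_nat k * x))"
        by (rule pdvd_mult[OF _ pdvd_mult_left[OF _ that]]) (use pdvd_power[of 1] in simp_all)
      then show ?thesis by (simp add: mult.assoc)
    qed
    define M where "M b = (\<Prod>t\<in>{1..b}. t + ?p * j)" for b :: nat
    have M: "pdvd (Suc e) (of_nat (M b) * ?D b j - ?D 0 j)" if "b < ?p" for b
      using that
    proof (induction b)
      case (Suc b)
      have MS: "M (Suc b) = M b * (Suc b + ?p * j)" by (simp add: M_def)
      have "of_nat (M (Suc b)) * ?D (Suc b) j
          = of_nat (M b) * (of_nat (Suc b + ?p * j) * ?D (Suc b) j)"
        unfolding MS by (simp only: of_nat_mult mult.assoc)
      also have "\<dots> = of_nat (M b) * ?D b j
          - (if j = 0 then 0 else of_nat (M b) * (of_nat (?p * j) * ?D (Suc b) (j - 1)))"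
        by (subst dwork_diff_rec) (use Suc.prems in \<open>simp_all add: right_diff_distrib\<close>)
      finally have eq: "of_nat (M (Suc b)) * ?D (Suc b) j - ?D 0 j = (of_nat (M b) * ?D b j - ?D 0 j)
          - (if j = 0 then 0 else of_nat (M b) * (of_nat (?p * j) * ?D (Suc b) (j - 1)))"
        by simp
      have "pdvd (Suc e) (of_nat (M b) * (of_nat (?p * j) * ?D (Suc b) (j - 1)))"
        by (rule pdvd_mult_left[OF _ pmul[OF IH2[OF Suc.prems]]]) simp
      then show ?case
        unfolding eq using Suc by (auto intro!: pdvd_diff simp del: of_nat_mult)
    qed (simp add: M_def)
    have cop: "\<not> ?p dvd M (?p - 1)"
    proof -
      have "\<not> ?p dvd t + ?p * j" if "t \<in> {1..?p - 1}" for t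
        using that p by (intro not_dvd_add_mult) auto
      then show ?thesis
        unfolding M_def using prime_dvd_prod_iff[of "{1..?p - 1}" ?p "\<lambda>t. t + ?p * j"] p(1) by auto
    qed
    have "[M (?p - 1) = (\<Prod>t\<in>{1..?p - 1}. t)] (mod ?p)"
      unfolding M_def by (intro cong_prod) (simp add: cong_def)
    then have "[int (M (?p - 1)) = fact (?p - 1)] (mod int ?p)"
      by (simp only: fact_prod cong_int_iff flip: of_nat_fact)
    also have "[fact (?p - 1) = - 1] (mod int ?p)"
      using p(1) by (rule wilson_theorem)
    finally have "int ?p dvd int (M (?p - 1) + 1)"
      by (simp add: cong_iff_dvd_diff add.commute)
    then obtain k where k: "M (?p - 1) + 1 = ?p * k"
      unfolding int_dvd_int_iff by blast
    have "of_nat (M (?p - 1)) * (?D (?p - 1) j + ?D 0 j)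
        = (of_nat (M (?p - 1)) * ?D (?p - 1) j - ?D 0 j) + of_nat (M (?p - 1) + 1) * ?D 0 j"
      by (simp add: algebra_simps)
    also have "pdvd (Suc e) \<dots>"
      unfolding k by (intro pdvd_add M pmul IH1) (use p in auto)
    finally have "pdvd (Suc e) (?D (?p - 1) j + ?D 0 j)"
      using cop pdvd_div_unit by blast
    then have 0: "pdvd (Suc e) (?D 0 i)"
      unfolding Suc dwork_diff_0_Suc by (rule pdvd_uminus)
    have "pdvd (Suc e) (?D a i)"
      using less.prems
    proof (induction a)
      case (Suc b)
      have "of_nat (Suc b + ?p * i) * ?D (Suc b) i = ?D b i - of_nat (?p * i) * ?D (Suc b) j"
        using dwork_diff_rec[of "Suc b" i, where ?'p = 'p] Suc.prems \<open>i = Suc j\<close> by simp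
      also have "pdvd (Suc e) \<dots>"
        using Suc by (intro pdvd_diff pmul IH1) auto
      finally show ?case
        using pdvd_div_unit not_dvd_add_mult[of "Suc b" ?p i] Suc.prems by blast
    qed (rule 0)
    then show ?thesis by (simp add: Suc e_def)
  qed
qed

lemma fact_conv_fact_prime_to:
  assumes "p > 1"
  shows "fact n = fact_prime_to p (Suc n) * p ^ (n div p) * fact (n div p)"
proof (induction n)
  case 0
  then show ?case by (simp add: fact_prime_to_Suc prime_to_def)
next
  case (Suc n)
  show ?case
  proof (cases "p dvd Suc n")
    case True
    define q where "q = n div p"
    have div: "Suc n div p = Suc q" using True by (simp add: div_Suc dvd_eq_mod_eq_0 q_def)
    have FP: "fact_prime_to p (Suc (Suc n)) = fact_prime_to p (Suc n)"
      using True by (simp add: fact_prime_to_Suc[of p "Suc n"] prime_to_def)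
    have "Suc n = p * Suc q"
      using True div by (metis dvd_mult_div_cancel)
    then have "fact (Suc n) = p * Suc q * fact n"
      by (metis fact_Suc of_nat_id)
    also have "\<dots> = fact_prime_to p (Suc n) * p ^ Suc q * fact (Suc q)"
      unfolding Suc q_def[symmetric] by (simp add: algebra_simps)
    finally show ?thesis unfolding div FP .
  next
    case False
    then have "Suc n div p = n div p" by (simp add: div_Suc dvd_eq_mod_eq_0)
    moreover have "fact_prime_to p (Suc (Suc n)) = Suc n * fact_prime_to p (Suc n)"
      using False by (simp add: fact_prime_to_Suc[of p "Suc n"] prime_to_def)
    ultimately show ?thesis
      using Suc by (simp add: algebra_simps)
  qed
qed

text \<open>n! is a unit times p^q q! with q = n div p; since p \<ge> 3, the exponent q + q div 2
  needed by induction does not exceed n div 2.\<close>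

lemma Zp_power_div_fact:
  assumes "odd CARD('p :: prime_card)"
  shows "(of_nat CARD('p) ^ (n div 2) / of_nat (fact n) :: 'p padic) \<in> Zp"
proof (induction n rule: less_induct)
  case (less n)
  let ?p = "CARD('p)"
  have p: "?p \<ge> 3"
    using assms CARD_gt_1[where ?'p = 'p] by (cases "?p = 2") auto
  define q where "q = n div ?p"
  have unit: "inverse (of_nat (fact_prime_to ?p (Suc n)) :: 'p padic) \<in> Zp"
    by (rule Zp_inverse_of_nat[OF coprime_fact_prime_to[OF prime_card]])
  have fact: "(of_nat (fact n) :: 'p padic) = of_nat (fact_prime_to ?p (Suc n)) * of_nat ?p ^ q * of_nat (fact q)"
    unfolding q_def by (subst fact_conv_fact_prime_to[of ?p n]) (use p in simp_all)
  show ?case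
  proof (cases "n = 0")
    case False
    then have "q < n" using p by (simp add: q_def)
    have "3 * q \<le> n"
      by (rule order_trans[OF mult_le_mono1[OF p]]) (simp add: q_def)
    then have "q + q div 2 \<le> n div 2" by linarith
    then have "(of_nat ?p :: 'p padic) ^ (n div 2) = of_nat ?p ^ q * of_nat ?p ^ (q div 2) * of_nat ?p ^ (n div 2 - (q + q div 2))"
      by (simp flip: power_add)
    then have "(of_nat ?p ^ (n div 2) / of_nat (fact n) :: 'p padic)
        = inverse (of_nat (fact_prime_to ?p (Suc n))) * (of_nat ?p ^ (q div 2) / of_nat (fact q))
          * of_nat ?p ^ (n div 2 - (q + q div 2))"
      unfolding fact by (simp add: field_simps)
    also have "\<dots> \<in> Zp"
      using less[OF \<open>q < n\<close>] unit by (intro Zp_mult Zp_power) auto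
    finally show ?thesis .
  qed simp
qed

text \<open>(-p)^i c_n is the i-th Mahler coefficient divided by i!; its divisibility by p^(i div 2)
  is just what the factorial requires.\<close>

lemma dwork_coeff_integral:
  assumes "odd CARD('p :: prime_card)"
  shows "(of_nat CARD('p) ^ (n div CARD('p)) * dwork_coeff n :: 'p padic) \<in> Zp"
proof -
  let ?p = "CARD('p)"
  define i a where "i = n div ?p" and "a = n mod ?p"
  have n: "n = a + ?p * i" by (simp add: i_def a_def)
  have "a < ?p" by (simp add: a_def)
  have "pdvd (i div 2) (dwork_diff a i :: 'p padic)"
    using dwork_diff_pdvd[OF \<open>a < ?p\<close>, of i] by (rule pdvd_mono) simp
  then have "dwork_diff a i / of_nat ?p ^ (i div 2) * (of_nat ?p ^ (i div 2) / of_nat (fact i)) \<in> (Zp :: 'p padic set)"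
    using Zp_power_div_fact[OF assms, of i] unfolding pdvd_def by (rule Zp_mult)
  then have "dwork_diff a i / of_nat (fact i) \<in> (Zp :: 'p padic set)"
    by simp
  then have "(- of_nat ?p) ^ i * dwork_coeff n \<in> (Zp :: 'p padic set)"
    by (simp add: dwork_diff_def n)
  from Zp_mult[OF Zp_power[OF Zp_uminus[OF Zp_1], of i] this]
  have "(- 1) ^ i * ((- of_nat ?p) ^ i * dwork_coeff n) \<in> (Zp :: 'p padic set)" .
  moreover have "(- 1) ^ i * (- of_nat ?p) ^ i = (of_nat ?p ^ i :: 'p padic)"
    by (simp flip: power_mult_distrib)
  ultimately show ?thesis
    by (simp only: i_def mult.assoc[symmetric])
qed

section \<open>The Gross-Koblitz formula\<close>

text \<open>For n = r + (p-1)i the exponent grows like i/p, which is the rate of convergence of the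
  Gross-Koblitz sums.\<close>

lemma dwork_coeff_pdvd:
  assumes "odd CARD('p :: prime_card)" "n div CARD('p) \<le> i"
  shows "pdvd (i - n div CARD('p)) ((- of_nat CARD('p)) ^ i * dwork_coeff n :: 'p padic)"
proof -
  let ?p = "CARD('p)" and ?k = "n div CARD('p)"
  have "(- of_nat ?p :: 'p padic) ^ i = (- 1) ^ i * (of_nat ?p ^ (i - ?k) * of_nat ?p ^ ?k)"
    unfolding power_minus[of "of_nat ?p"] using assms(2) by (simp flip: power_add)
  then have eq: "((- of_nat ?p) ^ i * dwork_coeff n :: 'p padic)
      = (- 1) ^ i * (of_nat ?p ^ (i - ?k) * (of_nat ?p ^ ?k * dwork_coeff n))"
    by (simp add: mult_ac)
  have "pdvd (i - ?k + 0) (of_nat ?p ^ (i - ?k) * (of_nat ?p ^ ?k * dwork_coeff n) :: 'p padic)"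
    using dwork_coeff_integral[OF assms(1)] by (intro pdvd_mult pdvd_power) simp
  then have *: "pdvd (i - ?k) (of_nat ?p ^ (i - ?k) * (of_nat ?p ^ ?k * dwork_coeff n) :: 'p padic)"
    by (simp only: add_0_right)
  show ?thesis
    unfolding eq by (rule pdvd_mult_left[OF Zp_power[OF Zp_uminus[OF Zp_1]] *])
qed

text \<open>
  Summing over \<open>l\<close> is an elementary form of Dwork's trace formula: \<open>Q 0\<close> is the eigenvalue of
  Frobenius on a one-dimensional cohomology group, and the diagonal coefficients add up to the
  trace on the space of cochains.
\<close>

lemma dwork_sum_telescope_step:
  fixes a n l :: nat
  assumes p: "odd CARD('p :: prime_card)" and a: "a < CARD('p)" and l: "l < n"
  defines "Q \<equiv> \<lambda>l. \<Sum>i\<in>{l..n}. (- of_nat CARD('p)) ^ i * ffact (of_nat n - of_nat l) (i - l)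
            * (dwork_coeff (a + CARD('p) * i - l) :: 'p padic)"
  obtains E where "E \<in> Zp"
    "Q l = Q (Suc l) + (1 - of_nat CARD('p)) * (- of_nat CARD('p)) ^ l * dwork_coeff (a + CARD('p) * l - l)
       - (of_nat a + of_nat CARD('p) * of_nat n - of_nat n) * E"
proof -
  let ?p = "CARD('p)"
  define \<pi> where "\<pi> = (of_nat ?p :: 'p padic)"
  \<comment> \<open>Equal to a + (p - 1)n, hence p-adically small when n is close to a/(1 -
    p).\<close>
  define \<epsilon> where "\<epsilon> = of_nat a + \<pi> * of_nat n - of_nat n"
  define x where "x = (of_nat n - of_nat l :: 'p padic)"
  define c where "c i j = (dwork_coeff (a + ?p * i - j) :: 'p padic)" for i j
  define A where "A i = ffact (x - 1) (i - Suc l)" for i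
  define G where "G i = (- \<pi>) ^ Suc i * A (Suc i) * c i l" for i
  define E where "E = (\<Sum>i\<in>{Suc l..n}. (- \<pi>) ^ i * A i * c i l)"
  have p1: "?p > 1" by (rule CARD_gt_1)
  have x: "x - 1 = of_nat n - of_nat (Suc l)" by (simp add: x_def)
  have A_Suc: "A (Suc i) = A i * (of_nat n - of_nat i)" if "Suc l \<le> i" for i
  proof -
    have "x - 1 - of_nat (i - Suc l) = of_nat n - of_nat i"
      using that by (simp add: x_def of_nat_diff)
    moreover have "Suc i - Suc l = Suc (i - Suc l)" using that by simp
    ultimately show ?thesis by (simp only: A_def ffact_Suc)
  qed
  have A_left: "x * A i = ffact x (i - l)" if "Suc l \<le> i" for i
  proof -
    have "i - l = Suc (i - Suc l)" using that by simp
    then show ?thesis by (simp only: A_def ffact_Suc')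
  qed
  \<comment> \<open>The recurrence multiplies c_(a+pi-l) by a + pi - l = p(i - n) + (n - l) +
    \<epsilon>. The first part raises the falling factorial and telescopes through G, the second
    completes it to one at n - l, the third is the error.\<close>
  have "(- \<pi>) ^ i * A i * c i (Suc l) + G (i - 1)
      = G i + (- \<pi>) ^ i * ffact x (i - l) * c i l + \<epsilon> * ((- \<pi>) ^ i * A i * c i l)"
    if i: "i \<in> {Suc l..n}" for i
  proof -
    have il: "Suc l \<le> i" using i by simp
    then obtain j where j: "i = Suc j" by (cases i) auto
    have "l \<le> j" using il j by simp
    \<comment> \<open>Because l < i, none of the subtractions in the indices is truncated.\<close>
    have "j \<le> ?p * j" using p1 by simp
    then have lpj: "l \<le> ?p * j" using \<open>l \<le> j\<close> by linarith
    then have pos: "0 < a + ?p * i - l" "?p \<le> a + ?p * i - l"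
      using p1 j by simp_all
    have sub: "a + ?p * i - l - 1 = a + ?p * i - Suc l" "a + ?p * i - l - ?p = a + ?p * j - l"
      using j by simp_all
    have "of_nat (a + ?p * i - l) * c i l = c i (Suc l) + c j l"
      using dwork_coeff_rec[OF pos(1), where ?'p = 'p] pos(2) unfolding sub c_def by simp
    moreover have "(of_nat (a + ?p * i - l) :: 'p padic) = \<pi> * (of_nat i - of_nat n) + x + \<epsilon>"
    proof -
      have "l \<le> a + ?p * i" using pos(1) by simp
      then show ?thesis by (simp add: \<pi>_def x_def \<epsilon>_def of_nat_diff algebra_simps)
    qed
    ultimately have rec: "c i (Suc l) + c j l = (\<pi> * (of_nat i - of_nat n) + x + \<epsilon>) * c i l"
      by simp
    have Gj: "G (i - 1) = (- \<pi>) ^ i * A i * c j l"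
      by (simp add: G_def j)
    have Gi: "G i = (- \<pi>) ^ i * A i * (\<pi> * (of_nat i - of_nat n)) * c i l"
      unfolding G_def A_Suc[OF il] by (simp add: algebra_simps)
    have "(- \<pi>) ^ i * A i * c i (Suc l) + G (i - 1) = (- \<pi>) ^ i * A i * (c i (Suc l) + c j l)"
      unfolding Gj by (simp add: algebra_simps)
    also have "\<dots> = G i + (- \<pi>) ^ i * (x * A i) * c i l + \<epsilon> * ((- \<pi>) ^ i * A i * c i l)"
      unfolding rec Gi by (simp add: algebra_simps)
    finally show ?thesis unfolding A_left[OF il] .
  qed
  then have "(\<Sum>i\<in>{Suc l..n}. (- \<pi>) ^ i * A i * c i (Suc l) + G (i - 1))
      = (\<Sum>i\<in>{Suc l..n}. G i + (- \<pi>) ^ i * ffact x (i - l) * c i l + \<epsilon> * ((- \<pi>) ^ i * A i * c i l))"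
    by (rule sum.cong[OF refl])
  then have "(\<Sum>i\<in>{Suc l..n}. (- \<pi>) ^ i * A i * c i (Suc l)) + (\<Sum>i\<in>{Suc l..n}. G (i - 1))
      = (\<Sum>i\<in>{Suc l..n}. G i) + (\<Sum>i\<in>{Suc l..n}. (- \<pi>) ^ i * ffact x (i - l) * c i l) + \<epsilon> * E"
    by (simp only: sum.distrib E_def sum_distrib_left)
  moreover have "(\<Sum>i\<in>{Suc l..n}. (- \<pi>) ^ i * A i * c i (Suc l)) = Q (Suc l)"
    unfolding Q_def A_def x c_def \<pi>_def ..
  moreover have "Q l = (- \<pi>) ^ l * c l l + (\<Sum>i\<in>{Suc l..n}. (- \<pi>) ^ i * ffact x (i - l) * c i l)"
    unfolding Q_def using l by (subst sum.atLeast_Suc_atMost) (simp_all add: x_def c_def \<pi>_def)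
  moreover have "(\<Sum>i\<in>{Suc l..n}. G i) - (\<Sum>i\<in>{Suc l..n}. G (i - 1)) = G n - G l"
    unfolding sum_subtractf[symmetric] using l by (intro sum_telescope'') simp
  moreover have "G n = 0"
    using A_Suc[of n] l by (simp add: G_def)
  moreover have "G l = (- \<pi>) ^ Suc l * c l l"
    by (simp add: G_def A_def)
  \<comment> \<open>The factor 1 - p combines the diagonal term i = l of Q l with the boundary term
    G l of the telescoping sum, which is -p times as large.\<close>
  ultimately have "Q l = Q (Suc l) + (1 - \<pi>) * (- \<pi>) ^ l * c l l - \<epsilon> * E"
    by (simp add: algebra_simps)
  moreover have "E \<in> Zp"
    unfolding E_def
  proof (rule Zp_sum)
    fix i assume i: "i \<in> {Suc l..n}"
    have "(a + ?p * i - l) div ?p \<le> (a + ?p * i) div ?p"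
      by (rule div_le_mono) simp
    also have "\<dots> = i" using a by simp
    finally have "pdvd (i - (a + ?p * i - l) div ?p) ((- \<pi>) ^ i * c i l)"
      unfolding \<pi>_def c_def by (rule dwork_coeff_pdvd[OF p])
    then have "(- \<pi>) ^ i * c i l \<in> Zp" by (rule pdvd_imp_Zp)
    moreover have "A i \<in> Zp"
      unfolding A_def x_def by (intro Zp_ffact Zp_diff Zp_of_nat Zp_1)
    ultimately have "A i * ((- \<pi>) ^ i * c i l) \<in> Zp" by (rule Zp_mult[rotated])
    then show "(- \<pi>) ^ i * A i * c i l \<in> Zp" by (simp add: mult_ac)
  qed
  ultimately show ?thesis
    using that unfolding \<epsilon>_def \<pi>_def c_def by blast
qed

text \<open>Each step splits off one diagonal coefficient; after n steps only the last diagonal term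
  remains, and the errors share the factor a + (p - 1)n.\<close>

lemma dwork_sum_telescope:
  fixes a n :: nat
  assumes p: "odd CARD('p :: prime_card)" and a: "a < CARD('p)"
  obtains E where "E \<in> (Zp :: 'p padic set)"
    "dwork_sum a n = (1 - of_nat CARD('p)) * (\<Sum>l<n. (- of_nat CARD('p)) ^ l * dwork_coeff (a + (CARD('p) - 1) * l))
       + (- of_nat CARD('p)) ^ n * dwork_coeff (a + (CARD('p) - 1) * n)
       - (of_nat a + of_nat CARD('p) * of_nat n - of_nat n) * E"
proof -
  let ?p = "CARD('p)"
  define \<pi> where "\<pi> = (of_nat ?p :: 'p padic)"
  define \<epsilon> where "\<epsilon> = of_nat a + \<pi> * of_nat n - of_nat n"
  define b where "b l = (- \<pi>) ^ l * dwork_coeff (a + (?p - 1) * l)" for l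
  define Q where "Q l = (\<Sum>i\<in>{l..n}. (- \<pi>) ^ i * ffact (of_nat n - of_nat l) (i - l)
            * (dwork_coeff (a + ?p * i - l) :: 'p padic))" for l
  have diag: "a + ?p * l - l = a + (?p - 1) * l" for l
    using CARD_gt_1[where ?'p = 'p] by (simp add: diff_mult_distrib)
  have "\<exists>E\<in>Zp. Q 0 = Q L + (1 - \<pi>) * (\<Sum>l<L. b l) - \<epsilon> * E" if "L \<le> n" for L
    using that
  proof (induction L)
    case 0
    show ?case by (intro bexI[of _ 0]) auto
  next
    case (Suc L)
    then obtain E where E: "E \<in> Zp" "Q 0 = Q L + (1 - \<pi>) * (\<Sum>l<L. b l) - \<epsilon> * E" by auto
    have "L < n" using Suc.prems by simp
    from dwork_sum_telescope_step[OF p a this]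
    obtain E' where E': "E' \<in> Zp" "Q L = Q (Suc L) + (1 - \<pi>) * (- \<pi>) ^ L * dwork_coeff (a + ?p * L - L) - \<epsilon> * E'"
      unfolding Q_def \<pi>_def \<epsilon>_def by blast
    have "Q 0 = Q (Suc L) + (1 - \<pi>) * (\<Sum>l<Suc L. b l) - \<epsilon> * (E + E')"
      unfolding E(2) E'(2) diag by (simp add: b_def algebra_simps)
    then show ?case using E(1) E'(1) by blast
  qed
  from this[of n] obtain E where E: "E \<in> Zp" "Q 0 = Q n + (1 - \<pi>) * (\<Sum>l<n. b l) - \<epsilon> * E" by auto
  have "Q 0 = dwork_sum a n"
    by (simp add: Q_def dwork_sum_def \<pi>_def atLeast0AtMost)
  moreover have "Q n = b n"
    unfolding b_def diag[symmetric] by (simp add: Q_def)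
  ultimately have "dwork_sum a n = (1 - \<pi>) * (\<Sum>l<n. b l) + b n - \<epsilon> * E"
    using E(2) by (simp add: algebra_simps)
  then show ?thesis
    using that E(1) unfolding b_def \<pi>_def \<epsilon>_def by blast
qed

lemma pdvd_div_1_minus_p:
  assumes "pdvd k ((1 - of_nat CARD('p)) * x)"
  shows "pdvd k (x :: 'p :: prime_card padic)"
proof -
  have "(1 - of_nat CARD('p) :: 'p padic) = - of_nat (CARD('p) - 1)"
    using CARD_gt_1[where ?'p = 'p] by (simp add: of_nat_diff)
  then have "pdvd k (of_nat (CARD('p) - 1) * x)"
    using pdvd_uminus[OF assms] by (simp add: algebra_simps)
  then show ?thesis
    by (rule pdvd_div_unit[rotated]) (use CARD_gt_1[where ?'p = 'p] in \<open>auto dest: dvd_imp_le\<close>)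
qed

lemma one_minus_card_neq_0: "(1 - of_nat CARD('p) :: 'p :: prime_card padic) \<noteq> 0"
  using CARD_gt_1[where ?'p = 'p] by (metis eq_iff_diff_eq_0 less_irrefl of_nat_1 of_nat_eq_iff)

text \<open>
  The Gross-Koblitz formula: \<open>dwork_coeff n\<close> times the \<open>n\<close>-th power of a root of
  \<open>\<pi>\<^sup>p\<^sup>-\<^sup>1 = -p\<close>, summed over \<open>n \<equiv> r (mod p - 1)\<close>, is a Gauss sum up to the factor \<open>p - 1\<close>.
\<close>

lemma gross_koblitz:
  fixes x :: "'p :: prime_card padic_int"
  assumes p: "odd CARD('p)" and x: "(pp - 1) * x = of_nat r" and r: "r < CARD('p)"
  shows "pdvd (k - (r + (CARD('p) - 1) * k) div CARD('p))
    (to_fract (padic_Gamma x) / (1 - of_nat CARD('p))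
      - (\<Sum>l<k. (- of_nat CARD('p)) ^ l * dwork_coeff (r + (CARD('p) - 1) * l)))"
proof -
  let ?p = "CARD('p)"
  define \<pi> where "\<pi> = (of_nat ?p :: 'p padic)"
  \<comment> \<open>The precision of the k-th partial sum: every term from index k on is divisible
    by p^w.\<close>
  define w where "w = k - (r + (?p - 1) * k) div ?p"
  define b where "b l = (- \<pi>) ^ l * dwork_coeff (r + (?p - 1) * l)" for l
  have p1: "?p > 1" by (rule CARD_gt_1)
  have b: "pdvd w (b l)" if kl: "k \<le> l" for l
  proof -
    obtain d where d: "l = k + d" using le_Suc_ex[OF kl] by blast
    have "r + (?p - 1) * l = r + (?p - 1) * k + (?p - 1) * d"
      by (simp only: d distrib_left add.assoc)
    also have "\<dots> \<le> r + (?p - 1) * k + d * ?p"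
      using mult_le_mono1[of "?p - 1" ?p d] by (simp only: mult.commute add_le_cancel_left)
    finally have "(r + (?p - 1) * l) div ?p \<le> (r + (?p - 1) * k + d * ?p) div ?p"
      by (rule div_le_mono)
    then have 1: "(r + (?p - 1) * l) div ?p \<le> (r + (?p - 1) * k) div ?p + d"
      using p1 by simp
    have "(?p - 1) * l \<le> l * ?p" by simp
    then have "r + (?p - 1) * l < Suc l * ?p"
      using r by (simp only: mult_Suc)
    then have 2: "(r + (?p - 1) * l) div ?p \<le> l"
      by (simp only: less_mult_imp_div_less flip: less_Suc_eq_le)
    have "pdvd (l - (r + (?p - 1) * l) div ?p) (b l)"
      unfolding b_def \<pi>_def by (rule dwork_coeff_pdvd[OF p 2])
    then show ?thesis by (rule pdvd_mono) (use 1 2 d in \<open>simp add: w_def\<close>)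
  qed
  \<comment> \<open>n approximates r/(1 - p) modulo p^K; the summand p^K only serves to make n at
    least k.\<close>
  define K where "K = k + w"
  define n where "n = r * repunit ?p K + ?p ^ K"
  have "K \<le> ?p ^ K" using p1 by (simp add: less_imp_le power_gt_expt)
  then have "k \<le> n" by (simp add: n_def K_def)
  \<comment> \<open>Since r + (p - 1)n vanishes modulo p^K, N = pn + r + 1 agrees with n + 1, that
    is, with 1 - x. Thus \<open>dwork_sum r n\<close>, up to sign 1/\<Gamma>_p(N), is close to
    \<Gamma>_p(x) by reflection.\<close>
  define N where "N = ?p * n + r + 1"
  have eps: "of_nat r + (pp :: 'p padic_int) * of_nat n - of_nat n = pp ^ K * (of_nat r + pp - 1)"
  proof -
    have "of_nat r + (pp :: 'p padic_int) * of_nat n - of_nat n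
        = of_nat r + of_nat r * ((pp - 1) * of_nat (repunit ?p K)) + (pp - 1) * pp ^ K"
      by (simp add: n_def algebra_simps)
    also have "\<dots> = pp ^ K * (of_nat r + pp - 1)"
      unfolding repunit_mult by (simp add: algebra_simps)
    finally show ?thesis .
  qed
  define \<epsilon> where "\<epsilon> = of_nat r + \<pi> * of_nat n - of_nat n"
  have eqe: "\<epsilon> = to_fract (of_nat r + pp * of_nat n - of_nat n)"
    by (simp add: \<epsilon>_def \<pi>_def to_fract_of_nat)
  have "pdvd K \<epsilon>"
    unfolding eqe pdvd_to_fract_iff eps by (rule dvd_triv_left)
  then have eps_w: "pdvd w \<epsilon>"
    by (rule pdvd_mono) (simp add: K_def)
  have "(pp - 1) * (of_nat N - (1 - x)) = pp * (of_nat r + pp * of_nat n - of_nat n)"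
  proof -
    have "(pp - 1) * (of_nat N - (1 - x)) = (pp - 1) * (pp * of_nat n + of_nat r) + (pp - 1) * x"
      by (simp add: N_def algebra_simps)
    then show ?thesis unfolding x by (simp add: algebra_simps)
  qed
  also have "pp ^ K dvd \<dots>" unfolding eps by simp
  finally have "pp ^ K dvd of_nat N - (1 - x)"
    by (simp only: pp_power_dvd_unit_mult_iff[OF pp_minus_1_unit])
  then have "padic_residue (of_nat N :: 'p padic_int) K = padic_residue (1 - x) K"
    by (simp only: padic_residue_eq_iff_dvd)
  then have "padic_residue (padic_Gamma (of_nat N :: 'p padic_int)) K = padic_residue (padic_Gamma (1 - x)) K"
    by (rule padic_Gamma_char(2)[OF p])
  then have G1: "pdvd K (to_fract (padic_Gamma (of_nat N :: 'p padic_int)) - to_fract (padic_Gamma (1 - x)))"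
    by (simp only: pdvd_cong_iff)
  have GN: "to_fract (padic_Gamma (of_nat N)) = (- 1) ^ N * (of_nat (fact_prime_to ?p N) :: 'p padic)"
    unfolding padic_Gamma_char(1)[OF p] gamma_seq_def
    by (simp add: to_fract_power to_fract_of_nat to_fract_of_int)
  have FP: "dwork_sum r n * (of_nat (fact_prime_to ?p N) :: 'p padic) = (- 1) ^ n"
    unfolding N_def by (rule dwork_sum_eq[OF r])
  \<comment> \<open>N + n = (p + 1)n + r + 1 has the parity of r + 1, which is the sign in the
    reflection formula.\<close>
  have "dwork_sum r n * to_fract (padic_Gamma (of_nat N)) = (- 1) ^ N * ((- 1) ^ n :: 'p padic)"
    unfolding GN by (subst mult.left_commute) (simp only: FP)
  also have "\<dots> = - ((- 1) ^ r)"
    using p by (auto simp: N_def minus_one_power_iff)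
  also have "\<dots> = to_fract (padic_Gamma x) * to_fract (padic_Gamma (1 - x))"
  proof -
    have "padic_Gamma x * padic_Gamma (1 - x) = - ((- 1) ^ r)"
      using r by (intro padic_Gamma_reflection[OF p x]) simp
    then show ?thesis by (simp add: to_fract_power flip: to_fract_mult)
  qed
  finally have prod: "dwork_sum r n * to_fract (padic_Gamma (of_nat N))
      = to_fract (padic_Gamma x) * to_fract (padic_Gamma (1 - x))" .
  have unit: "(padic_Gamma (of_nat N) :: 'p padic_int) dvd 1" by (rule padic_Gamma_unit[OF p])
  then have nz: "to_fract (padic_Gamma (of_nat N) :: 'p padic_int) \<noteq> 0" by auto
  have "to_fract (padic_Gamma x) - dwork_sum r n = inverse (to_fract (padic_Gamma (of_nat N)))
      * (to_fract (padic_Gamma x) * (to_fract (padic_Gamma (of_nat N :: 'p padic_int)) - to_fract (padic_Gamma (1 - x))))"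
    using prod nz by (simp add: field_simps)
  also have "pdvd K \<dots>"
    by (intro pdvd_mult_left Zp_inverse_unit[OF unit] to_fract_Zp G1)
  finally have G2: "pdvd w (to_fract (padic_Gamma x) - dwork_sum r n)"
    by (rule pdvd_mono) (simp add: K_def)
  obtain E where E: "E \<in> Zp" "dwork_sum r n = (1 - \<pi>) * (\<Sum>l<n. b l) + b n - \<epsilon> * E"
    using dwork_sum_telescope[OF p r, of n] unfolding b_def \<pi>_def \<epsilon>_def by blast
  have split: "(\<Sum>l<n. b l) = (\<Sum>l<k. b l) + (\<Sum>l\<in>{k..<n}. b l)"
    using \<open>k \<le> n\<close> by (simp add: lessThan_atLeast0 sum.atLeastLessThan_concat)
  have "to_fract (padic_Gamma x) - (1 - \<pi>) * (\<Sum>l<k. b l)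
      = (to_fract (padic_Gamma x) - dwork_sum r n) + (1 - \<pi>) * (\<Sum>l\<in>{k..<n}. b l) + b n - E * \<epsilon>"
    unfolding E(2) split by (simp add: algebra_simps)
  also have "pdvd w \<dots>"
  proof -
    have "pdvd w (\<Sum>l\<in>{k..<n}. b l)" by (rule pdvd_sum) (simp add: b)
    then have "pdvd w ((1 - \<pi>) * (\<Sum>l\<in>{k..<n}. b l))"
      by (rule pdvd_mult_left[rotated]) (auto simp: \<pi>_def)
    then show ?thesis
      by (rule pdvd_diff[OF pdvd_add[OF pdvd_add[OF G2] b[OF \<open>k \<le> n\<close>]] pdvd_mult_left[OF E(1) eps_w]])
  qed
  finally have "pdvd w (to_fract (padic_Gamma x) - (1 - \<pi>) * (\<Sum>l<k. b l))" .
  also have "to_fract (padic_Gamma x) - (1 - \<pi>) * (\<Sum>l<k. b l)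
      = (1 - \<pi>) * (to_fract (padic_Gamma x) / (1 - \<pi>) - (\<Sum>l<k. b l))"
    using one_minus_card_neq_0[where ?'p = 'p] by (simp add: \<pi>_def right_diff_distrib)
  finally have "pdvd w (to_fract (padic_Gamma x) / (1 - \<pi>) - (\<Sum>l<k. b l))"
    unfolding \<pi>_def by (rule pdvd_div_1_minus_p)
  then show ?thesis by (simp only: w_def b_def \<pi>_def)
qed

section \<open>The additive character\<close>

text \<open>
  Tame series converge at a root \<open>\<pi>\<close> of \<open>\<pi>\<^sup>p\<^sup>-\<^sup>1 = -p\<close>. Evaluation at \<open>\<pi>\<close> is
  replaced by congruence modulo \<open>X\<^sup>p\<^sup>-\<^sup>1 + p\<close> in the ring of tame series.
\<close>

definition tame_at :: "nat \<Rightarrow> 'p :: prime_card padic fps \<Rightarrow> bool" where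
  "tame_at d F \<longleftrightarrow> (\<forall>n. of_nat CARD('p) ^ (d + n div CARD('p)) * F $ n \<in> Zp)"

definition tame :: "'p :: prime_card padic fps \<Rightarrow> bool" where
  "tame F \<longleftrightarrow> (\<exists>d. tame_at d F)"

lemma tame_at_mono:
  assumes "tame_at d F" "d \<le> e"
  shows "tame_at e (F :: 'p :: prime_card padic fps)"
  unfolding tame_at_def
proof
  fix n
  have F: "of_nat CARD('p) ^ (d + n div CARD('p)) * F $ n \<in> Zp"
    using assms(1) unfolding tame_at_def by blast
  have "(of_nat CARD('p) ^ (e + n div CARD('p)) * F $ n :: 'p padic)
      = of_nat CARD('p) ^ (e - d) * (of_nat CARD('p) ^ (d + n div CARD('p)) * F $ n)"
    using assms(2) by (simp flip: power_add mult.assoc)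
  also have "\<dots> \<in> Zp"
    by (rule Zp_mult[OF Zp_power[OF Zp_of_nat] F])
  finally show "(of_nat CARD('p) ^ (e + n div CARD('p)) * F $ n :: 'p padic) \<in> Zp" .
qed

lemma tame_at_add: "tame_at d F \<Longrightarrow> tame_at d G \<Longrightarrow> tame_at d (F + G)"
  by (auto simp: tame_at_def distrib_left)

lemma tame_at_mult:
  fixes F G :: "'p :: prime_card padic fps"
  assumes "tame_at d F" "tame_at e G"
  shows "tame_at (d + e) (F * G)"
  unfolding tame_at_def
proof
  fix n
  let ?p = "CARD('p)"
  define \<pi> where "\<pi> = (of_nat ?p :: 'p padic)"
  have "\<pi> ^ (d + e + n div ?p) * (F $ i * G $ (n - i)) \<in> Zp" if "i \<in> {0..n}" for i
  proof -
    have "(i div ?p + (n - i) div ?p) * ?p \<le> i + (n - i)"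
      by (simp add: add_mult_distrib add_mono)
    then have le: "i div ?p + (n - i) div ?p \<le> n div ?p"
      using that CARD_gt_1[where ?'p = 'p] by (simp add: less_eq_div_iff_mult_less_eq)
    then obtain k where k: "n div ?p = i div ?p + (n - i) div ?p + k"
      using le_Suc_ex by blast
    have "\<pi> ^ (d + e + n div ?p) * (F $ i * G $ (n - i))
        = \<pi> ^ k * ((\<pi> ^ (d + i div ?p) * F $ i) * (\<pi> ^ (e + (n - i) div ?p) * G $ (n - i)))"
      unfolding k by (simp add: power_add mult_ac)
    also have "\<dots> \<in> Zp"
      using assms unfolding tame_at_def \<pi>_def by (simp add: Zp_mult Zp_power)
    finally show ?thesis .
  qed
  then show "of_nat ?p ^ (d + e + n div ?p) * (F * G) $ n \<in> Zp"
    unfolding fps_mult_nth sum_distrib_left \<pi>_def by (rule Zp_sum)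
qed

lemma tame_at_power: "tame_at 0 F \<Longrightarrow> tame_at 0 (F ^ k)"
proof (induction k)
  case 0
  show ?case by (auto simp: tame_at_def)
next
  case (Suc k)
  then show ?case using tame_at_mult[of 0 F 0 "F ^ k"] by simp
qed

lemma tame_0 [simp]: "tame 0"
  by (auto simp: tame_def tame_at_def)

lemma tame_add: "tame F \<Longrightarrow> tame G \<Longrightarrow> tame (F + G)"
  unfolding tame_def by (meson tame_at_add tame_at_mono max.cobounded1 max.cobounded2)

lemma tame_mult: "tame F \<Longrightarrow> tame G \<Longrightarrow> tame (F * G)"
  unfolding tame_def using tame_at_mult by blast

lemma tame_X: "tame_at 0 (fps_X :: 'p :: prime_card padic fps)"
  by (auto simp: tame_at_def fps_X_def)

lemma tame_X_power: "tame (fps_X ^ k)"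
  unfolding tame_def using tame_at_power[OF tame_X] by blast

text \<open>A denominator is a power of p times a unit, so a constant becomes integral after
  multiplication by that power.\<close>

lemma tame_const: "tame (fps_const (c :: 'p :: prime_card padic))"
proof -
  obtain a b where "b \<noteq> 0" and c: "c = to_fract a / to_fract b"
    by (metis Fract_conv_to_fract Fract_cases)
  define d where "d = padic_val b"
  have "pp ^ d dvd b"
    unfolding pp_power_dvd_iff d_def using \<open>b \<noteq> 0\<close> le_padic_val_iff by blast
  then obtain u where u: "b = pp ^ d * u" by blast
  have "\<not> pp dvd u"
  proof
    assume "pp dvd u"
    then have "pp ^ Suc d dvd b" unfolding u by (simp add: mult.commute mult_dvd_mono)
    then have "Suc d \<le> padic_val b"
      using le_padic_val_iff[OF \<open>b \<noteq> 0\<close>, of "Suc d"] pp_power_dvd_iff[of "Suc d" b] by blast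
    then show False by (simp add: d_def)
  qed
  then have "inverse (to_fract u) \<in> Zp" by (intro Zp_inverse_unit) (simp add: padic_unit_iff)
  moreover have "of_nat CARD('p) ^ d * c = to_fract a * inverse (to_fract u)"
    using \<open>b \<noteq> 0\<close> unfolding c u by (auto simp: to_fract_power to_fract_of_nat field_simps)
  ultimately have "of_nat CARD('p) ^ d * c \<in> Zp" by auto
  then have "tame_at d (fps_const c)" by (auto simp: tame_at_def)
  then show ?thesis by (auto simp: tame_def)
qed

lemma tame_uminus: "tame F \<Longrightarrow> tame (- F)"
  by (auto simp: tame_def tame_at_def)

lemma tame_sum: "(\<And>x. x \<in> A \<Longrightarrow> tame (f x)) \<Longrightarrow> tame (sum f A)"
  by (induction A rule: infinite_finite_induct) (auto intro: tame_add)

definition eisenstein :: "'p :: prime_card padic fps" where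
  "eisenstein = fps_X ^ (CARD('p) - 1) + fps_const (of_nat CARD('p))"

lemma eisenstein_mult_nth:
  "(eisenstein * F) $ n = of_nat CARD('p) * F $ n
     + (if n < CARD('p) - 1 then 0 else F $ (n - (CARD('p) - 1)))"
  for F :: "'p :: prime_card padic fps"
  by (simp add: eisenstein_def distrib_right fps_X_power_mult_nth)

definition tcong :: "'p :: prime_card padic fps \<Rightarrow> 'p padic fps \<Rightarrow> bool" where
  "tcong F G \<longleftrightarrow> (\<exists>H. tame H \<and> F - G = eisenstein * H)"

lemma tcong_refl [simp]: "tcong F F"
  unfolding tcong_def by (rule exI[of _ 0]) simp

lemma tcong_sym: "tcong F G \<Longrightarrow> tcong G F"
proof -
  assume "tcong F G"
  then obtain H where "tame H" "F - G = eisenstein * H" by (auto simp: tcong_def)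
  then have "tame (- H)" "G - F = eisenstein * (- H)" by (auto intro: tame_uminus simp: algebra_simps)
  then show ?thesis unfolding tcong_def by blast
qed

lemma tcong_add:
  assumes "tcong F G" "tcong F' G'"
  shows "tcong (F + F') (G + G')"
proof -
  obtain H H' where "tame H" "F - G = eisenstein * H" "tame H'" "F' - G' = eisenstein * H'"
    using assms by (auto simp: tcong_def)
  then have "tame (H + H')" "(F + F') - (G + G') = eisenstein * (H + H')"
    by (auto intro: tame_add simp: algebra_simps)
  then show ?thesis unfolding tcong_def by blast
qed

lemma tcong_trans [trans]:
  assumes "tcong F G" "tcong G H"
  shows "tcong F H"
proof -
  obtain K K' where "tame K" "F - G = eisenstein * K" "tame K'" "G - H = eisenstein * K'"
    using assms by (auto simp: tcong_def)
  then have "tame (K + K')" "F - H = eisenstein * (K + K')"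
    by (auto intro: tame_add simp: algebra_simps)
  then show ?thesis unfolding tcong_def by blast
qed

text \<open>F F' - G G' = F (F' - G') + (F - G) G', so the quotient by \<open>eisenstein\<close>
  acquires the cofactors F and G', which must be tame.\<close>

lemma tcong_mult:
  assumes "tcong F G" "tcong F' G'" "tame F" "tame G'"
  shows "tcong (F * F') (G * G')"
proof -
  obtain H H' where H: "tame H" "F - G = eisenstein * H" "tame H'" "F' - G' = eisenstein * H'"
    using assms(1,2) by (auto simp: tcong_def)
  have "F * F' - G * G' = F * (F' - G') + (F - G) * G'"
    by (simp add: algebra_simps)
  also have "\<dots> = eisenstein * (F * H' + H * G')"
    unfolding H by (simp add: algebra_simps)
  finally show ?thesis
    unfolding tcong_def using H(1,3) assms(3,4) by (blast intro: tame_add tame_mult)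
qed

lemma tcong_sum: "(\<And>x. x \<in> A \<Longrightarrow> tcong (f x) (g x)) \<Longrightarrow> tcong (sum f A) (sum g A)"
  by (induction A rule: infinite_finite_induct) (auto intro: tcong_add)

text \<open>This makes the congruence meaningful: \<open>eisenstein\<close> is invertible as a
  formal series, so only tameness of H can tell constants apart. The coefficients of H at k(p-1) are
  forced to be \<plusminus>(a - b)/p^(k+1), whereas tameness allows denominators of about
  p^(k(p-1)/p) only.\<close>

lemma tcong_const_iff: "tcong (fps_const a) (fps_const b) \<longleftrightarrow> a = (b :: 'p :: prime_card padic)"
proof
  let ?p = "CARD('p)"
  define \<pi> where "\<pi> = (of_nat ?p :: 'p padic)"
  have p: "?p > 1" by (rule CARD_gt_1)
  assume "tcong (fps_const a) (fps_const b)"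
  then obtain H d where Hd: "tame_at d H" and H: "fps_const (a - b) = eisenstein * H"
    by (auto simp: tcong_def tame_def)
  have H_nth: "(if n = 0 then a - b else 0) = \<pi> * H $ n + (if n < ?p - 1 then 0 else H $ (n - (?p - 1)))" for n
    using arg_cong[OF H, of "\<lambda>F. F $ n"] by (simp only: eisenstein_mult_nth \<pi>_def fps_nth_fps_const)
  have rec: "a - b = (- 1) ^ k * \<pi> ^ Suc k * H $ (k * (?p - 1))" for k
  proof (induction k)
    case 0
    show ?case using H_nth[of 0] p by simp
  next
    case (Suc k)
    have 1: "Suc k * (?p - 1) - (?p - 1) = k * (?p - 1)" "\<not> Suc k * (?p - 1) < ?p - 1" "Suc k * (?p - 1) \<noteq> 0"
      using p by simp_all
    have "0 = \<pi> * H $ (Suc k * (?p - 1)) + H $ (k * (?p - 1))"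
      using H_nth[of "Suc k * (?p - 1)"] by (simp only: 1 if_False)
    then have "H $ (k * (?p - 1)) = - (\<pi> * H $ (Suc k * (?p - 1)))"
      by (metis add.commute eq_neg_iff_add_eq_0)
    then show ?case unfolding Suc by simp
  qed
  have "pdvd N (a - b)" for N
  proof -
    \<comment> \<open>With this k the exponent k + 1 exceeds the tame bound d + k(p-1)/p by N +
      1.\<close>
    define k where "k = ?p * (N + d)"
    have "k * (?p - 1) div ?p = (N + d) * (?p - 1)" using p by (simp add: k_def mult.assoc)
    moreover have "Suc k = N + (d + (N + d) * (?p - 1)) + 1"
      using p by (cases ?p) (simp_all add: k_def algebra_simps)
    ultimately have "a - b = (- 1) ^ k * (\<pi> * (\<pi> ^ N * (\<pi> ^ (d + k * (?p - 1) div ?p) * H $ (k * (?p - 1)))))"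
      using rec[of k] by (simp add: power_add mult_ac)
    moreover have "pdvd (N + 0) (\<pi> ^ N * (\<pi> ^ (d + k * (?p - 1) div ?p) * H $ (k * (?p - 1))))"
      using Hd unfolding \<pi>_def tame_at_def by (intro pdvd_mult pdvd_power) simp
    ultimately show ?thesis
      by (auto simp: \<pi>_def intro!: pdvd_mult_left Zp_power Zp_uminus)
  qed
  then have "a - b = 0" by (rule pdvd_all_imp_0)
  then show "a = b" by simp
qed simp

lemma eisenstein_eq_0: "tcong (fps_X ^ ((CARD('p) - 1) * k)) (fps_const ((- of_nat CARD('p)) ^ k :: 'p :: prime_card padic))"
proof (induction k)
  case (Suc k)
  let ?p = "CARD('p)"
  have "fps_X ^ (?p - 1) - fps_const (- of_nat ?p :: 'p padic) = eisenstein * fps_const 1"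
    by (simp add: eisenstein_def flip: fps_const_neg)
  then have "tcong (fps_X ^ (?p - 1)) (fps_const (- of_nat ?p :: 'p padic))"
    unfolding tcong_def using tame_const by blast
  from tcong_mult[OF this Suc tame_X_power tame_const] show ?case
    by (simp only: mult_Suc_right power_add power_Suc fps_const_mult)
qed simp

lemma tame_dwork_arg: "tame_at 0 (dwork_arg :: 'p :: prime_card padic fps)"
  unfolding tame_at_def
proof
  fix n
  let ?p = "CARD('p)"
  have "?p > 1" by (rule CARD_gt_1)
  then show "of_nat ?p ^ (0 + n div ?p) * (dwork_arg :: 'p padic fps) $ n \<in> Zp"
    by (cases "n = ?p"; cases "n = 1") (auto simp: dwork_arg_def fps_X_power_nth)
qed

lemma dwork_arg_eq: "(dwork_arg :: 'p :: prime_card padic fps)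
   = eisenstein * (fps_X * fps_const (1 / of_nat CARD('p)))"
proof -
  let ?p = "CARD('p)"
  have "Suc (?p - 1) = ?p" using CARD_gt_1[where ?'p = 'p] by simp
  then have "fps_X * fps_X ^ (?p - 1) = (fps_X ^ ?p :: 'p padic fps)"
    by (metis power_Suc)
  moreover have "fps_const (of_nat ?p) * (fps_X * fps_const (1 / of_nat ?p)) = (fps_X :: 'p padic fps)"
    by (simp add: mult.left_commute)
  ultimately show ?thesis
    by (simp add: dwork_arg_def eisenstein_def algebra_simps)
qed

text \<open>\<open>dwork_arg\<close> is a multiple of \<open>eisenstein\<close>, but this does not
  make every \<open>dwork_exp u\<close> congruent to 1: the quotient must be tame, and the
  factorials of the exponential stand in the way. (By \<open>sum_psi\<close> the characters
  \<open>\<psi> y\<close> are not all congruent to 1.) A factor p in \<delta> absorbs the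
  factorials.\<close>

lemma dwork_exp_small:
  assumes p: "odd CARD('p :: prime_card)" and \<delta>: "pdvd 1 \<delta>"
  shows "tcong (dwork_exp \<delta>) (1 :: 'p padic fps)"
proof -
  let ?p = "CARD('p)"
  define \<pi> where "\<pi> = (of_nat ?p :: 'p padic)"
  \<comment> \<open>A factor p is split off from exp - 1, to cancel the 1/p by which
    \<open>dwork_arg\<close> differs from an integral multiple of \<open>eisenstein\<close>.\<close>
  define B where "B = Abs_fps (\<lambda>m. \<delta> ^ Suc m / (\<pi> * of_nat (fact (Suc m))))"
  have "\<pi> \<noteq> 0" by (simp add: \<pi>_def)
  have B_Zp: "B $ m \<in> Zp" for m
  proof -
    define \<delta>' where "\<delta>' = \<delta> / \<pi>"
    have \<delta>': "\<delta>' \<in> Zp" "\<delta> = \<pi> * \<delta>'"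
      using \<delta> \<open>\<pi> \<noteq> 0\<close> by (auto simp: \<delta>'_def pdvd_def \<pi>_def)
    \<comment> \<open>Of the m + 1 factors p in the power of \<delta> one cancels the denominator p;
      the other m cover the factorial.\<close>
    have "Suc m div 2 \<le> m" by (cases m) auto
    then have "\<pi> ^ m = \<pi> ^ (m - Suc m div 2) * \<pi> ^ (Suc m div 2)" by (simp flip: power_add)
    then have "B $ m = \<delta>' ^ Suc m * (\<pi> ^ (m - Suc m div 2) * (\<pi> ^ (Suc m div 2) / of_nat (fact (Suc m))))"
      using \<open>\<pi> \<noteq> 0\<close> by (simp add: B_def \<delta>'(2) power_mult_distrib del: fact_Suc)
    also have "\<dots> \<in> Zp"
      using \<delta>'(1) Zp_power_div_fact[OF p, of "Suc m"] unfolding \<pi>_def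
      by (intro Zp_mult Zp_power Zp_of_nat)
    finally show ?thesis .
  qed
  have "fps_exp \<delta> = 1 + fps_X * (fps_const \<pi> * B)"
  proof (rule fps_ext)
    fix n
    show "fps_exp \<delta> $ n = (1 + fps_X * (fps_const \<pi> * B)) $ n"
      using \<open>\<pi> \<noteq> 0\<close> by (cases n) (simp_all add: B_def del: fact_Suc)
  qed
  then have "dwork_exp \<delta> - 1 = dwork_arg * (fps_const \<pi> * fps_compose B dwork_arg)"
    by (simp add: dwork_exp_def fps_compose_add_distrib fps_compose_mult_distrib)
  also have "\<dots> = eisenstein * (fps_X * ((fps_const (1 / \<pi>) * fps_const \<pi>) * fps_compose B dwork_arg))"
    unfolding dwork_arg_eq \<pi>_def by (simp only: mult_ac)
  also have "fps_const (1 / \<pi>) * fps_const \<pi> = 1"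
    using \<open>\<pi> \<noteq> 0\<close> by simp
  finally have eq: "dwork_exp \<delta> - 1 = eisenstein * (fps_X * fps_compose B dwork_arg)"
    by simp
  have "tame_at 0 (fps_compose B dwork_arg)"
    unfolding tame_at_def
  proof
    fix n
    have "of_nat ?p ^ (0 + n div ?p) * (B $ i * (dwork_arg ^ i) $ n) \<in> Zp" for i
    proof -
      have "of_nat ?p ^ (0 + n div ?p) * (dwork_arg ^ i) $ n \<in> (Zp :: 'p padic set)"
        using tame_at_power[OF tame_dwork_arg] unfolding tame_at_def by blast
      then have "B $ i * (of_nat ?p ^ (0 + n div ?p) * (dwork_arg ^ i) $ n) \<in> Zp"
        using B_Zp by (rule Zp_mult[rotated])
      then show ?thesis by (simp only: mult_ac)
    qed
    then show "of_nat ?p ^ (0 + n div ?p) * fps_compose B dwork_arg $ n \<in> Zp"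
      unfolding fps_compose_nth sum_distrib_left by (intro Zp_sum)
  qed
  then have "tame (fps_X * fps_compose B dwork_arg)"
    using tame_mult tame_X unfolding tame_def by blast
  then show ?thesis
    unfolding tcong_def using eq by blast
qed

section \<open>The additive character and its multiplicative expansion\<close>

definition \<psi> :: "'p :: prime_card mod_ring \<Rightarrow> 'p padic fps" where
  "\<psi> t = dwork_exp (to_fract (teich t))"

lemma psi_nth: "\<psi> t $ n = to_fract (teich t) ^ n * dwork_coeff n"
  unfolding \<psi>_def
  by (rule dwork_exp_frobenius_fixed) (simp add: teich_power_card flip: to_fract_power)

lemma tame_psi:
  assumes "odd CARD('p :: prime_card)"
  shows "tame (\<psi> (t :: 'p mod_ring))"
proof -
  have "tame_at 0 (\<psi> t)"
    unfolding tame_at_def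
  proof
    fix n
    have "to_fract (teich t) ^ n * (of_nat CARD('p) ^ (n div CARD('p)) * dwork_coeff n) \<in> Zp"
      by (intro Zp_mult[OF Zp_power[OF to_fract_Zp]] dwork_coeff_integral assms)
    then show "of_nat CARD('p) ^ (0 + n div CARD('p)) * \<psi> t $ n \<in> Zp"
      by (simp add: psi_nth mult.left_commute)
  qed
  then show ?thesis by (auto simp: tame_def)
qed

lemma psi_0 [simp]: "\<psi> 0 = 1"
  by (simp add: \<psi>_def)

text \<open>The Teichmueller lift is additive only up to some \<delta> divisible by p.
  \<open>dwork_exp\<close> is exactly multiplicative, and \<open>dwork_exp_small\<close> removes
  \<delta>.\<close>

lemma psi_add:
  assumes "odd CARD('p :: prime_card)"
  shows "tcong (\<psi> a * \<psi> b) (\<psi> (a + b :: 'p mod_ring))"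
proof -
  define \<delta> where "\<delta> = teich a + teich b - teich (a + b)"
  have "pdvd 1 (to_fract \<delta>)"
    unfolding pdvd_to_fract_iff \<delta>_def using pp_dvd_teich_add[of a b] by simp
  then have "tcong (\<psi> (a + b) * dwork_exp (to_fract \<delta>)) (\<psi> (a + b) * 1)"
    using tame_const[of "1 :: 'p padic"]
    by (intro tcong_mult tcong_refl dwork_exp_small assms tame_psi) simp_all
  moreover have "\<psi> a * \<psi> b = \<psi> (a + b) * dwork_exp (to_fract \<delta>)"
    unfolding \<psi>_def dwork_exp_add[symmetric] \<delta>_def by simp
  ultimately show ?thesis by simp
qed

definition unit_frac :: "nat \<Rightarrow> 'p :: prime_card padic_int" where
  "unit_frac r = padic_of_rat (of_nat r / of_nat (CARD('p) - 1))"

lemma unit_frac: "(pp - 1) * unit_frac r = (of_nat r :: 'p :: prime_card padic_int)"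
proof -
  let ?q = "CARD('p) - 1"
  have p: "CARD('p) > 1" by (rule CARD_gt_1)
  then have "\<not> int CARD('p) dvd int ?q" by (auto simp: int_dvd_int_iff simp del: of_nat_diff dest: dvd_imp_le)
  from padic_of_rat_exists[OF this, of "int r"]
  have "of_nat ?q * unit_frac r = (of_nat r :: 'p padic_int)" by (simp add: unit_frac_def)
  then show ?thesis using p by (simp add: of_nat_diff)
qed

definition Gamma_frac :: "nat \<Rightarrow> 'p :: prime_card padic" where
  "Gamma_frac r = to_fract (padic_Gamma (unit_frac r))"

text \<open>By \<open>gross_koblitz\<close> the limit of the sums of (-p)^l c_(r+(p-1)l): the
  coefficient that X^r collects once X^(p-1) is replaced by -p.\<close>

definition gauss_coeff :: "nat \<Rightarrow> 'p :: prime_card padic" where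
  "gauss_coeff r = Gamma_frac r / (1 - of_nat CARD('p))"

text \<open>Since the lift of t is a (p-1)-th root of unity, its n-th power depends only on n modulo
  p - 1, and reducing X^(p-1) to -p collects each residue class into one coefficient. The quotient
  of this division consists of tails of the Gross-Koblitz sums, whose rate of convergence makes it
  tame.\<close>

lemma psi_expansion:
  fixes t :: "'p :: prime_card mod_ring"
  assumes p: "odd CARD('p)" and t: "t \<noteq> 0"
  shows "tcong (\<psi> t) (\<Sum>r<CARD('p) - 1. fps_const (gauss_coeff r * to_fract (teich t) ^ r) * fps_X ^ r)"
proof -
  let ?p = "CARD('p)" and ?q = "CARD('p) - 1"
  define \<pi> where "\<pi> = (of_nat ?p :: 'p padic)"
  define \<tau> where "\<tau> = to_fract (teich t)"
  define \<sigma> where "\<sigma> r k = (\<Sum>l<k. (- \<pi>) ^ l * dwork_coeff (r + ?q * l))" for r k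
  define tail where "tail r k = gauss_coeff r - \<sigma> r (Suc k)" for r k
  \<comment> \<open>The solution of p h(r,k) + h(r,k-1) = \<tau>^r c_(r+qk), which comparing
    coefficients with \<open>eisenstein * H\<close> requires. Written with tails instead of partial
    sums it shows the growth of H.\<close>
  define h where "h r k = \<tau> ^ r * (tail r k / (- \<pi>) ^ Suc k)" for r k
  define H where "H = Abs_fps (\<lambda>n. h (n mod ?q) (n div ?q))"
  have p1: "?p > 1" by (rule CARD_gt_1)
  have p2: "?p \<ge> 3" using p p1 by (cases "?p = 2") auto
  have pi0: "\<pi> \<noteq> 0" by (simp add: \<pi>_def)
  have \<tau>: "\<tau> ^ ?q = 1"
    using teich_power_card_minus_1[OF t] unfolding \<tau>_def by (simp flip: to_fract_power)
  have "tame_at 1 H"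
    unfolding tame_at_def
  proof
    fix n
    define r k where "r = n mod ?q" and "k = n div ?q"
    \<comment> \<open>The tail is divisible by p^(k+1-D), so p^D clears the denominator of h; D
      \<le> 1 + n div p is the tame bound with d = 1.\<close>
    define D where "D = (r + ?q * Suc k) div ?p"
    have r: "r < ?q" using p2 by (simp add: r_def)
    have n: "n = r + ?q * k" by (simp add: r_def k_def)
    have "?q \<le> ?p" by simp
    then have "r + ?q * Suc k \<le> n + ?p"
      unfolding mult_Suc_right using n by linarith
    then have "(r + ?q * Suc k) div ?p \<le> (n + ?p) div ?p"
      by (rule div_le_mono)
    then have D: "D \<le> 1 + n div ?p" using p1 by (simp add: D_def)
    have "?q * Suc k \<le> Suc k * ?p"
      using mult_le_mono1[OF \<open>?q \<le> ?p\<close>, of "Suc k"] by (simp only: mult.commute)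
    then have "r + ?q * Suc k < Suc (Suc k) * ?p"
      using r by (simp only: mult_Suc)
    then have D': "D \<le> Suc k"
      unfolding D_def by (simp only: less_mult_imp_div_less flip: less_Suc_eq_le)
    have "pdvd (Suc k - D) (tail r k)"
      using gross_koblitz[OF p unit_frac, of r "Suc k"] r
      unfolding D_def tail_def \<sigma>_def \<pi>_def gauss_coeff_def Gamma_frac_def by simp
    then have Zt: "tail r k / \<pi> ^ (Suc k - D) \<in> Zp" by (simp add: pdvd_def \<pi>_def)
    have "\<pi> ^ (1 + n div ?p) * h r k = \<tau> ^ r * ((- 1) ^ Suc k * (\<pi> ^ (1 + n div ?p - D) * (tail r k / \<pi> ^ (Suc k - D))))"
    proof -
      have 1: "\<pi> ^ (1 + n div ?p) = \<pi> ^ (1 + n div ?p - D) * \<pi> ^ D"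
        using D by (simp only: le_add_diff_inverse2 flip: power_add)
      have 2: "\<pi> ^ Suc k = \<pi> ^ (Suc k - D) * \<pi> ^ D"
        using D' by (simp only: le_add_diff_inverse2 flip: power_add)
      have 3: "(- \<pi>) ^ Suc k = (- 1) ^ Suc k * \<pi> ^ Suc k"
        by (rule power_minus)
      have 4: "1 / (- 1) ^ Suc k = ((- 1) ^ Suc k :: 'p padic)"
        by (simp add: minus_one_power_iff)
      have "h r k = \<tau> ^ r * (1 / (- 1) ^ Suc k * (tail r k / \<pi> ^ Suc k))"
        unfolding h_def 3 by simp
      then show ?thesis unfolding 1 2 4 using pi0 by simp
    qed
    also have "\<dots> \<in> Zp"
      using Zt by (intro Zp_mult Zp_power Zp_uminus) (auto simp: \<tau>_def \<pi>_def)
    finally show "of_nat ?p ^ (1 + n div ?p) * H $ n \<in> Zp"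
      by (simp add: H_def r_def k_def \<pi>_def)
  qed
  then have tame: "tame H" by (auto simp: tame_def)
  have "\<psi> t - (\<Sum>r<?q. fps_const (gauss_coeff r * \<tau> ^ r) * fps_X ^ r) = eisenstein * H"
  proof (rule fps_ext)
    fix n
    define r k where "r = n mod ?q" and "k = n div ?q"
    have r: "r < ?q" using p2 by (simp add: r_def)
    have n: "n = r + ?q * k" by (simp add: r_def k_def)
    have poly: "(\<Sum>r<?q. fps_const (gauss_coeff r * \<tau> ^ r) * fps_X ^ r) $ n = (if k = 0 then gauss_coeff r * \<tau> ^ r else 0)"
    proof -
      have "(\<Sum>r<?q. fps_const (gauss_coeff r * \<tau> ^ r) * fps_X ^ r) $ n
          = (\<Sum>r<?q. if r = n then gauss_coeff r * \<tau> ^ r else 0)"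
        unfolding fps_sum_nth by (intro sum.cong refl) (simp add: fps_X_power_nth)
      also have "\<dots> = (if n < ?q then gauss_coeff n * \<tau> ^ n else 0)"
        by simp
      also have "n < ?q \<longleftrightarrow> k = 0"
        using p2 by (auto simp: k_def div_eq_0_iff)
      finally show ?thesis by (simp add: n)
    qed
    have psi: "\<psi> t $ n = \<tau> ^ r * dwork_coeff n"
    proof -
      have "\<tau> ^ n = \<tau> ^ (r + ?q * k)" by (rule arg_cong[OF n])
      also have "\<dots> = \<tau> ^ r" unfolding power_add power_mult \<tau> by simp
      finally show ?thesis unfolding psi_nth \<tau>_def[symmetric] by simp
    qed
    have Hn: "H $ n = h r k" by (simp add: H_def r_def k_def)
    show "(\<psi> t - (\<Sum>r<?q. fps_const (gauss_coeff r * \<tau> ^ r) * fps_X ^ r)) $ n = (eisenstein * H) $ n"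
    proof (cases k)
      case 0
      then have "n = r" using n by simp
      have "(eisenstein * H) $ n = \<pi> * h r 0"
        unfolding eisenstein_mult_nth Hn 0 \<pi>_def using r \<open>n = r\<close> by simp
      also have "\<dots> = \<tau> ^ r * (dwork_coeff r - gauss_coeff r)"
        using pi0 by (simp add: h_def tail_def \<sigma>_def field_simps)
      finally show ?thesis
        unfolding fps_sub_nth poly psi using 0 \<open>n = r\<close> by (simp add: algebra_simps)
    next
      case (Suc j)
      have nS: "n = r + ?q * j + ?q"
        using n unfolding Suc mult_Suc_right by linarith
      have "n - ?q = r + ?q * j" "\<not> n < ?q"
        unfolding nS by simp_all
      moreover from this have "H $ (n - ?q) = h r j"
        using r by (simp add: H_def)
      ultimately have "(eisenstein * H) $ n = \<pi> * h r (Suc j) + h r j"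
        unfolding eisenstein_mult_nth Hn Suc \<pi>_def by simp
      also have "\<dots> = \<tau> ^ r * ((tail r j - tail r (Suc j)) / (- \<pi>) ^ Suc j)"
        using pi0 by (simp add: h_def field_simps)
      also have "tail r j - tail r (Suc j) = (- \<pi>) ^ Suc j * dwork_coeff n"
        by (simp add: tail_def \<sigma>_def n Suc)
      also have "\<dots> / (- \<pi>) ^ Suc j = dwork_coeff n"
        using pi0 by simp
      finally show ?thesis
        unfolding fps_sub_nth poly psi using Suc by simp
    qed
  qed
  then show ?thesis unfolding tcong_def \<tau>_def using tame by blast
qed

section \<open>Counting the roots of a trinomial\<close>

lemma unit_frac_eqI:
  assumes "(pp - 1) * x = (of_nat r :: 'p :: prime_card padic_int)"
  shows "unit_frac r = x"
proof -
  have "(pp - 1) * unit_frac r = (pp - 1) * x"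
    using assms by (simp add: unit_frac)
  moreover have "(pp - 1 :: 'p padic_int) \<noteq> 0"
    using pp_minus_1_unit[where ?'p = 'p] by auto
  ultimately show ?thesis by simp
qed

lemma Gamma_frac_0:
  assumes "odd CARD('p :: prime_card)"
  shows "(Gamma_frac 0 :: 'p padic) = 1"
proof -
  have "unit_frac 0 = (0 :: 'p padic_int)" by (rule unit_frac_eqI) simp
  then show ?thesis by (simp add: Gamma_frac_def padic_Gamma_0[OF assms])
qed

lemma gauss_coeff_0:
  assumes "odd CARD('p :: prime_card)"
  shows "of_nat (CARD('p) - 1) * (gauss_coeff 0 :: 'p padic) = - 1"
proof -
  have eq: "(of_nat (CARD('p) - 1) :: 'p padic) = - (1 - of_nat CARD('p))"
    using CARD_gt_1[where ?'p = 'p] by (simp add: of_nat_diff)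
  show ?thesis
    unfolding eq gauss_coeff_def Gamma_frac_0[OF assms] mult_minus_left
    by (simp only: times_divide_eq_right mult_1_right divide_self[OF one_minus_card_neq_0])
qed

lemma sum_to_fract_teich_power:
  "(\<Sum>a\<in>UNIV - {0 :: 'p :: prime_card mod_ring}. to_fract (teich a) ^ k)
    = (if (CARD('p) - 1) dvd k then of_nat (CARD('p) - 1) else 0)"
proof -
  have "(\<Sum>a\<in>UNIV - {0 :: 'p mod_ring}. to_fract (teich a) ^ k) = to_fract (\<Sum>a\<in>UNIV - {0 :: 'p mod_ring}. teich a ^ k)"
    by (simp add: to_fract_power)
  then show ?thesis unfolding sum_teich_power by (simp add: to_fract_of_nat)
qed

lemma fps_const_sum: "fps_const (sum f A) = (\<Sum>x\<in>A. fps_const (f x))"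
  by (induction A rule: infinite_finite_induct) (simp_all flip: fps_const_add)

lemma sum_product3:
  fixes f g h :: "_ \<Rightarrow> 'a :: semiring_0"
  shows "sum f A * sum g B * sum h C = (\<Sum>r\<in>A. \<Sum>s\<in>B. \<Sum>t\<in>C. f r * g s * h t)"
proof -
  have "sum f A * sum g B * sum h C = (\<Sum>r\<in>A. \<Sum>s\<in>B. f r * g s) * sum h C"
    by (simp only: sum_product)
  also have "\<dots> = (\<Sum>r\<in>A. \<Sum>s\<in>B. f r * g s * sum h C)"
    by (simp only: sum_distrib_right)
  finally show ?thesis by (simp only: sum_distrib_left)
qed

text \<open>Orthogonality leaves only r = 0, with coefficient (p - 1) times -1/(p - 1).\<close>

lemma sum_psi:
  assumes p: "odd CARD('p :: prime_card)"
  shows "tcong (\<Sum>y\<in>UNIV - {0 :: 'p mod_ring}. \<psi> y) (fps_const (- 1))"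
proof -
  let ?q = "CARD('p) - 1"
  have q: "?q > 0" using CARD_gt_1[where ?'p = 'p] by simp
  have "tcong (\<Sum>y\<in>UNIV - {0 :: 'p mod_ring}. \<psi> y)
      (\<Sum>y\<in>UNIV - {0 :: 'p mod_ring}. \<Sum>r<?q. fps_const (gauss_coeff r * to_fract (teich y) ^ r) * fps_X ^ r)"
    by (intro tcong_sum psi_expansion p) simp
  also have "(\<Sum>y\<in>UNIV - {0 :: 'p mod_ring}. \<Sum>r<?q. fps_const (gauss_coeff r * to_fract (teich y) ^ r) * fps_X ^ r)
      = (\<Sum>r<?q. fps_const (gauss_coeff r * (\<Sum>y\<in>UNIV - {0 :: 'p mod_ring}. to_fract (teich y) ^ r)) * fps_X ^ r)"
    by (subst sum.swap) (simp add: sum_distrib_left sum_distrib_right fps_const_sum)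
  also have "\<dots> = (\<Sum>r<?q. if r = 0 then fps_const (- 1) else 0)"
  proof (intro sum.cong refl)
    fix r assume "r \<in> {..<?q}"
    then have "?q dvd r \<longleftrightarrow> r = 0" by (auto dest: dvd_imp_le)
    then show "fps_const (gauss_coeff r * (\<Sum>y\<in>UNIV - {0 :: 'p mod_ring}. to_fract (teich y) ^ r)) * fps_X ^ r
        = (if r = 0 then fps_const (- 1) else 0)"
      unfolding sum_to_fract_teich_power using gauss_coeff_0[OF p] by (simp add: mult.commute)
  qed
  also have "\<dots> = fps_const (- 1)" using q by simp
  finally show ?thesis .
qed

section \<open>The exponential sum attached to the trinomial\<close>

definition trinomial_roots :: "'p :: prime_card mod_ring set" where
  "trinomial_roots = {x. 3 * x ^ 4 - 4 * x ^ 3 + 1 = 0}"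

text \<open>The three monomials stay in separate factors so that each can be expanded by itself.
  Restricting to nonzero x loses no root, as the trinomial is 1 at 0.\<close>

definition trinomial_sum :: "'p :: prime_card padic fps" where
  "trinomial_sum = (\<Sum>x\<in>UNIV - {0 :: 'p mod_ring}. \<Sum>y\<in>UNIV - {0 :: 'p mod_ring}.
     \<psi> (y * (3 * x ^ 4)) * \<psi> (y * (- 4 * x ^ 3)) * \<psi> y)"

text \<open>For fixed x the sum over y is p - 1 at a root and -1 elsewhere, by
  \<open>sum_psi\<close> after rescaling y.\<close>

lemma trinomial_sum_roots:
  assumes p: "odd CARD('p :: prime_card)"
  shows "tcong (trinomial_sum :: 'p padic fps)
    (fps_const (of_nat CARD('p) * of_nat (card (trinomial_roots :: 'p mod_ring set)) - of_nat (CARD('p) - 1)))"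
proof -
  let ?p = "CARD('p)"
  let ?U = "UNIV - {0 :: 'p mod_ring}"
  let ?R = "trinomial_roots :: 'p mod_ring set"
  have p1: "?p > 1" by (rule CARD_gt_1)
  define c where "c x = (if x \<in> ?R then of_nat (?p - 1) else - 1 :: 'p padic)" for x
  have R: "?R \<subseteq> ?U" by (auto simp: trinomial_roots_def)
  have "tcong trinomial_sum (\<Sum>x\<in>?U. fps_const (c x))"
    unfolding trinomial_sum_def
  proof (rule tcong_sum)
    fix x :: "'p mod_ring"
    define f where "f = 3 * x ^ 4 - 4 * x ^ 3 + 1"
    have "tcong (\<Sum>y\<in>?U. \<psi> (y * (3 * x ^ 4)) * \<psi> (y * (- 4 * x ^ 3)) * \<psi> y) (\<Sum>y\<in>?U. \<psi> (y * f))"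
    proof (rule tcong_sum)
      fix y :: "'p mod_ring"
      have "tcong (\<psi> (y * (3 * x ^ 4)) * \<psi> (y * (- 4 * x ^ 3)) * \<psi> y)
          (\<psi> (y * (3 * x ^ 4) + y * (- 4 * x ^ 3)) * \<psi> y)"
        by (rule tcong_mult[OF psi_add[OF p] tcong_refl tame_mult[OF tame_psi[OF p] tame_psi[OF p]] tame_psi[OF p]])
      also have "tcong \<dots> (\<psi> (y * (3 * x ^ 4) + y * (- 4 * x ^ 3) + y))"
        by (rule psi_add[OF p])
      also have "y * (3 * x ^ 4) + y * (- 4 * x ^ 3) + y = y * f"
        by (simp add: f_def algebra_simps)
      finally show "tcong (\<psi> (y * (3 * x ^ 4)) * \<psi> (y * (- 4 * x ^ 3)) * \<psi> y) (\<psi> (y * f))" .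
    qed
    also have "tcong (\<Sum>y\<in>?U. \<psi> (y * f)) (fps_const (c x))"
    proof (cases "f = 0")
      case True
      then have "(\<Sum>y\<in>?U. \<psi> (y * f)) = of_nat (card ?U)" by simp
      also have "card ?U = ?p - 1" by (simp add: card_Diff_singleton)
      also have "of_nat (?p - 1) = fps_const (of_nat (?p - 1) :: 'p padic)" by (rule fps_of_nat[symmetric])
      also have "of_nat (?p - 1) = c x" using True by (simp add: c_def trinomial_roots_def f_def)
      finally show ?thesis by simp
    next
      case False
      have "(\<Sum>y\<in>?U. \<psi> (y * f)) = (\<Sum>y\<in>?U. \<psi> y)"
        by (rule sum.reindex_bij_witness[of _ "\<lambda>y. y / f" "\<lambda>y. y * f"]) (use False in auto)
      then show ?thesis
        using sum_psi[OF p] False by (simp add: c_def trinomial_roots_def f_def)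
    qed
    finally show "tcong (\<Sum>y\<in>?U. \<psi> (y * (3 * x ^ 4)) * \<psi> (y * (- 4 * x ^ 3)) * \<psi> y) (fps_const (c x))" .
  qed
  also have "(\<Sum>x\<in>?U. fps_const (c x)) = fps_const (\<Sum>x\<in>?U. c x)"
    by (simp add: fps_const_sum)
  also have "(\<Sum>x\<in>?U. c x) = (\<Sum>x\<in>?R. c x) + (\<Sum>x\<in>?U - ?R. c x)"
    using R by (subst sum.subset_diff[of ?R]) (simp_all add: add.commute)
  also have "\<dots> = of_nat (card ?R) * of_nat (?p - 1) - of_nat (card (?U - ?R))"
    by (simp add: c_def)
  also have "card (?U - ?R) = (?p - 1) - card ?R"
    using R by (simp add: card_Diff_subset finite_subset[OF R] card_Diff_singleton)
  also have "of_nat (card ?R) * of_nat (?p - 1) - of_nat ((?p - 1) - card ?R)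
      = (of_nat ?p * of_nat (card ?R) - of_nat (?p - 1) :: 'p padic)"
  proof -
    have "card ?R \<le> ?p - 1"
      using card_mono[OF _ R] by (simp add: card_Diff_singleton)
    then have 1: "(of_nat ((?p - 1) - card ?R) :: 'p padic) = of_nat (?p - 1) - of_nat (card ?R)"
      by (rule of_nat_diff)
    have 2: "(of_nat (?p - 1) :: 'p padic) = of_nat ?p - 1"
      using p1 by (simp add: of_nat_diff)
    show ?thesis unfolding 1 2 by (simp add: algebra_simps)
  qed
  finally show ?thesis .
qed

text \<open>
  The exponents \<open>r, s, t\<close> of the characters surviving in the expansion of \<open>trinomial_sum\<close>
  satisfy \<open>r \<equiv> 3t\<close> and \<open>s \<equiv> -4t\<close> modulo \<open>q = p - 1\<close>.
\<close>

definition exp3 :: "nat \<Rightarrow> nat \<Rightarrow> nat" where "exp3 q t = nat ((3 * int t) mod int q)"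
definition exp4 :: "nat \<Rightarrow> nat \<Rightarrow> nat" where "exp4 q t = nat ((- 4 * int t) mod int q)"

lemma exp_less: "q > 0 \<Longrightarrow> exp3 q t < q" "q > 0 \<Longrightarrow> exp4 q t < q"
  by (simp_all add: exp3_def exp4_def nat_less_iff)

lemma int_exp: "q > 0 \<Longrightarrow> int (exp3 q t) = (3 * int t) mod int q" "q > 0 \<Longrightarrow> int (exp4 q t) = (- 4 * int t) mod int q"
  by (simp_all add: exp3_def exp4_def)

text \<open>The two divisibilities are the conditions for the sums over x and over y not to vanish.
  The coefficient matrix (4, 3; 1, 1) of r and s has determinant 1, so they can be solved over the
  integers.\<close>

lemma exp_char:
  assumes q: "q > 0" and "r < q" "s < q"
  shows "q dvd 4 * r + 3 * s \<and> q dvd r + s + t \<longleftrightarrow> r = exp3 q t \<and> s = exp4 q t"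
proof
  assume *: "q dvd 4 * r + 3 * s \<and> q dvd r + s + t"
  have 1: "int q dvd 4 * int r + 3 * int s" "int q dvd int r + int s + int t"
    using * by (simp_all flip: int_dvd_int_iff)
  have "int q dvd 4 * (int r + int s + int t) - (4 * int r + 3 * int s)"
    using 1 by (intro dvd_diff dvd_mult)
  then have s: "int q dvd int s - (- 4 * int t)" by (simp add: algebra_simps)
  have "int q dvd (4 * int r + 3 * int s) - 3 * (int r + int s + int t)"
    using 1 by (intro dvd_diff dvd_mult)
  then have r: "int q dvd int r - 3 * int t" by (simp add: algebra_simps)
  have "int r mod int q = (3 * int t) mod int q" "int s mod int q = (- 4 * int t) mod int q"
    using r s by (simp_all only: mod_eq_dvd_iff)
  then have "int r = (3 * int t) mod int q" "int s = (- 4 * int t) mod int q"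
    using assms by simp_all
  then show "r = exp3 q t \<and> s = exp4 q t"
    unfolding exp3_def exp4_def by (metis nat_int)
next
  assume *: "r = exp3 q t \<and> s = exp4 q t"
  have "int r mod int q = (3 * int t) mod int q" "int s mod int q = (- 4 * int t) mod int q"
    using * int_exp[OF q, of t] by simp_all
  then have r: "int q dvd int r - 3 * int t" and s: "int q dvd int s - (- 4 * int t)"
    by (simp_all only: mod_eq_dvd_iff)
  have "int q dvd 4 * (int r - 3 * int t) + 3 * (int s - (- 4 * int t))"
    using r s by (intro dvd_add dvd_mult)
  then have "int q dvd int (4 * r + 3 * s)" by (simp add: algebra_simps)
  moreover have "int q dvd (int r - 3 * int t) + (int s - (- 4 * int t))"
    using r s by (rule dvd_add)
  then have "int q dvd int (r + s + t)" by (simp add: algebra_simps)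
  ultimately show "q dvd 4 * r + 3 * s \<and> q dvd r + s + t"
    by (simp only: int_dvd_int_iff)
qed

text \<open>The surviving power of X is a power of X^(p-1), congruent to -p; this is its
  exponent.\<close>

definition weight :: "nat \<Rightarrow> nat \<Rightarrow> nat" where
  "weight q t = (exp3 q t + exp4 q t + t) div q"

lemma weight:
  assumes "q > 0"
  shows "exp3 q t + exp4 q t + t = q * weight q t"
  using exp_char[OF assms exp_less[OF assms], of t t t] by (simp add: weight_def)

text \<open>The sums over x and y are character sums equal to q or 0. Hence the factor q^2, a single
  pair (r, s) for each t, and a total degree divisible by p - 1, which reduces to a
  constant.\<close>

lemma trinomial_sum_expansion:
  assumes p: "odd CARD('p :: prime_card)" and p3: "CARD('p) \<ge> 5"
  defines "q \<equiv> CARD('p) - 1"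
  shows "tcong (trinomial_sum :: 'p padic fps)
    (fps_const (of_nat q ^ 2 * (\<Sum>t<q. gauss_coeff (exp3 q t) * gauss_coeff (exp4 q t) * gauss_coeff t
       * to_fract (teich 3) ^ exp3 q t * to_fract (teich (- 4)) ^ exp4 q t * (- of_nat CARD('p)) ^ weight q t)))"
proof -
  let ?p = "CARD('p)"
  let ?U = "UNIV - {0 :: 'p mod_ring}"
  have q: "q > 0" using p3 by (simp add: q_def)
  define \<tau> :: "'p mod_ring \<Rightarrow> 'p padic" where "\<tau> a = to_fract (teich a)" for a
  have \<tau>_mult: "\<tau> (a * b) = \<tau> a * \<tau> b" for a b by (simp add: \<tau>_def teich_mult)
  have \<tau>_power: "\<tau> (a ^ k) = \<tau> a ^ k" for a k by (simp add: \<tau>_def teich_power to_fract_power)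
  define P where "P a = (\<Sum>r<q. fps_const (gauss_coeff r * \<tau> a ^ r) * fps_X ^ r)" for a
  have tP: "tame (P a)" for a
    unfolding P_def by (intro tame_sum tame_mult tame_const tame_X_power)
  have psiP: "tcong (\<psi> a) (P a)" if "a \<noteq> 0" for a
    using psi_expansion[OF p that] by (simp add: P_def q_def \<tau>_def)
  have n3: "(3 :: 'p mod_ring) \<noteq> 0" and n4: "(- 4 :: 'p mod_ring) \<noteq> 0"
  proof -
    have "\<not> ?p dvd 3" "\<not> ?p dvd 4" using p3 by (auto dest: dvd_imp_le)
    then have "(of_nat 3 :: 'p mod_ring) \<noteq> 0" "(of_nat 4 :: 'p mod_ring) \<noteq> 0"
      using of_nat_0_mod_ring_dvd[where ?'a = 'p] by blast+
    then show "(3 :: 'p mod_ring) \<noteq> 0" "(- 4 :: 'p mod_ring) \<noteq> 0" by simp_all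
  qed
  define g where "g r s t = gauss_coeff r * gauss_coeff s * gauss_coeff t * \<tau> 3 ^ r * \<tau> (- 4) ^ s" for r s t
  have "tcong trinomial_sum (\<Sum>x\<in>?U. \<Sum>y\<in>?U. P (y * (3 * x ^ 4)) * P (y * (- 4 * x ^ 3)) * P y)"
    unfolding trinomial_sum_def
  proof (intro tcong_sum)
    fix x y assume xy: "x \<in> ?U" "y \<in> ?U"
    have "y * (3 * x ^ 4) \<noteq> 0" "y * (- 4 * x ^ 3) \<noteq> 0" "y \<noteq> 0"
      using xy n3 n4 by auto
    then show "tcong (\<psi> (y * (3 * x ^ 4)) * \<psi> (y * (- 4 * x ^ 3)) * \<psi> y)
        (P (y * (3 * x ^ 4)) * P (y * (- 4 * x ^ 3)) * P y)"
      using tcong_mult[OF tcong_mult[OF psiP psiP tame_psi[OF p] tP] psiP tame_mult[OF tame_psi[OF p] tame_psi[OF p]] tP]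
      by blast
  qed
  also have "(\<Sum>x\<in>?U. \<Sum>y\<in>?U. P (y * (3 * x ^ 4)) * P (y * (- 4 * x ^ 3)) * P y)
      = (\<Sum>x\<in>?U. \<Sum>y\<in>?U. \<Sum>r<q. \<Sum>s<q. \<Sum>t<q.
          fps_const (g r s t * \<tau> x ^ (4 * r + 3 * s) * \<tau> y ^ (r + s + t)) * fps_X ^ (r + s + t))"
  proof (intro sum.cong refl)
    fix x y
    have "P (y * (3 * x ^ 4)) * P (y * (- 4 * x ^ 3)) * P y
        = (\<Sum>r<q. \<Sum>s<q. \<Sum>t<q. (fps_const (gauss_coeff r * \<tau> (y * (3 * x ^ 4)) ^ r) * fps_X ^ r)
           * (fps_const (gauss_coeff s * \<tau> (y * (- 4 * x ^ 3)) ^ s) * fps_X ^ s)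
           * (fps_const (gauss_coeff t * \<tau> y ^ t) * fps_X ^ t))"
      unfolding P_def by (rule sum_product3)
    also have "\<dots> = (\<Sum>r<q. \<Sum>s<q. \<Sum>t<q.
        fps_const (g r s t * \<tau> x ^ (4 * r + 3 * s) * \<tau> y ^ (r + s + t)) * fps_X ^ (r + s + t))"
    proof (intro sum.cong refl)
      fix r s t
      have "(fps_const a * fps_X ^ r) * (fps_const b * fps_X ^ s) * (fps_const c * fps_X ^ t)
          = fps_const (a * b * c) * fps_X ^ (r + s + t)" for a b c :: "'p padic"
        by (simp add: power_add mult_ac flip: fps_const_mult)
      moreover have "(gauss_coeff r * \<tau> (y * (3 * x ^ 4)) ^ r) * (gauss_coeff s * \<tau> (y * (- 4 * x ^ 3)) ^ s) * (gauss_coeff t * \<tau> y ^ t)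
          = g r s t * \<tau> x ^ (4 * r + 3 * s) * \<tau> y ^ (r + s + t)"
        unfolding \<tau>_mult \<tau>_power g_def power_mult_distrib power_add power_mult[symmetric]
        by (simp only: mult_ac)
      ultimately show "(fps_const (gauss_coeff r * \<tau> (y * (3 * x ^ 4)) ^ r) * fps_X ^ r)
           * (fps_const (gauss_coeff s * \<tau> (y * (- 4 * x ^ 3)) ^ s) * fps_X ^ s)
           * (fps_const (gauss_coeff t * \<tau> y ^ t) * fps_X ^ t)
          = fps_const (g r s t * \<tau> x ^ (4 * r + 3 * s) * \<tau> y ^ (r + s + t)) * fps_X ^ (r + s + t)"
        by simp
    qed
    finally show "P (y * (3 * x ^ 4)) * P (y * (- 4 * x ^ 3)) * P y
        = (\<Sum>r<q. \<Sum>s<q. \<Sum>t<q.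
        fps_const (g r s t * \<tau> x ^ (4 * r + 3 * s) * \<tau> y ^ (r + s + t)) * fps_X ^ (r + s + t))" .
  qed
  also have "\<dots> = (\<Sum>r<q. \<Sum>s<q. \<Sum>t<q. \<Sum>x\<in>?U. \<Sum>y\<in>?U.
          fps_const (g r s t * \<tau> x ^ (4 * r + 3 * s) * \<tau> y ^ (r + s + t)) * fps_X ^ (r + s + t))"
  proof -
    have swap: "(\<Sum>x\<in>?U. \<Sum>y\<in>?U. \<Sum>r<q. F x y r) = (\<Sum>r<q. \<Sum>x\<in>?U. \<Sum>y\<in>?U. F x y r)"
      for F :: "'p mod_ring \<Rightarrow> 'p mod_ring \<Rightarrow> nat \<Rightarrow> 'p padic fps"
    proof -
      have "(\<Sum>x\<in>?U. \<Sum>y\<in>?U. \<Sum>r<q. F x y r) = (\<Sum>x\<in>?U. \<Sum>r<q. \<Sum>y\<in>?U. F x y r)"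
        by (intro sum.cong refl sum.swap)
      also have "\<dots> = (\<Sum>r<q. \<Sum>x\<in>?U. \<Sum>y\<in>?U. F x y r)" by (rule sum.swap)
      finally show ?thesis .
    qed
    show ?thesis unfolding swap ..
  qed
  also have "\<dots> = (\<Sum>r<q. \<Sum>s<q. \<Sum>t<q. if r = exp3 q t \<and> s = exp4 q t
      then fps_const (of_nat q ^ 2 * g r s t) * fps_X ^ (r + s + t) else 0)"
  proof (intro sum.cong refl)
    fix r s t assume rs: "r \<in> {..<q}" "s \<in> {..<q}"
    have "(\<Sum>x\<in>?U. \<Sum>y\<in>?U. fps_const (g r s t * \<tau> x ^ (4 * r + 3 * s) * \<tau> y ^ (r + s + t)) * fps_X ^ (r + s + t))
        = fps_const (g r s t * (\<Sum>x\<in>?U. \<tau> x ^ (4 * r + 3 * s)) * (\<Sum>y\<in>?U. \<tau> y ^ (r + s + t))) * fps_X ^ (r + s + t)"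
    proof -
      have "g r s t * (\<Sum>x\<in>?U. \<tau> x ^ (4 * r + 3 * s)) * (\<Sum>y\<in>?U. \<tau> y ^ (r + s + t))
          = (\<Sum>x\<in>?U. \<Sum>y\<in>?U. g r s t * \<tau> x ^ (4 * r + 3 * s) * \<tau> y ^ (r + s + t))"
        unfolding mult.assoc[of "g r s t"] sum_product unfolding sum_distrib_left ..
      then show ?thesis by (simp only: fps_const_sum sum_distrib_right)
    qed
    also have "(\<Sum>x\<in>?U. \<tau> x ^ (4 * r + 3 * s)) = (if q dvd 4 * r + 3 * s then of_nat q else 0)"
      unfolding \<tau>_def q_def by (rule sum_to_fract_teich_power)
    also have "(\<Sum>y\<in>?U. \<tau> y ^ (r + s + t)) = (if q dvd r + s + t then of_nat q else 0)"
      unfolding \<tau>_def q_def by (rule sum_to_fract_teich_power)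
    finally show "(\<Sum>x\<in>?U. \<Sum>y\<in>?U. fps_const (g r s t * \<tau> x ^ (4 * r + 3 * s) * \<tau> y ^ (r + s + t)) * fps_X ^ (r + s + t))
        = (if r = exp3 q t \<and> s = exp4 q t then fps_const (of_nat q ^ 2 * g r s t) * fps_X ^ (r + s + t) else 0)"
      using exp_char[of q r s t] q rs by (auto simp: power2_eq_square mult_ac)
  qed
  also have "\<dots> = (\<Sum>t<q. \<Sum>r<q. \<Sum>s<q. if r = exp3 q t \<and> s = exp4 q t
      then fps_const (of_nat q ^ 2 * g r s t) * fps_X ^ (r + s + t) else 0)"
  proof -
    have "(\<Sum>r<q. \<Sum>s<q. \<Sum>t<q. F r s t) = (\<Sum>t<q. \<Sum>r<q. \<Sum>s<q. F r s t)"
      for F :: "nat \<Rightarrow> nat \<Rightarrow> nat \<Rightarrow> 'p padic fps"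
    proof -
      have "(\<Sum>r<q. \<Sum>s<q. \<Sum>t<q. F r s t) = (\<Sum>r<q. \<Sum>t<q. \<Sum>s<q. F r s t)"
        by (intro sum.cong refl sum.swap)
      also have "\<dots> = (\<Sum>t<q. \<Sum>r<q. \<Sum>s<q. F r s t)" by (rule sum.swap)
      finally show ?thesis .
    qed
    then show ?thesis .
  qed
  also have "\<dots> = (\<Sum>t<q. fps_const (of_nat q ^ 2 * g (exp3 q t) (exp4 q t) t) * fps_X ^ (q * weight q t))"
  proof (intro sum.cong refl)
    fix t
    have "(\<Sum>r<q. \<Sum>s<q. if r = exp3 q t \<and> s = exp4 q t
        then fps_const (of_nat q ^ 2 * g r s t) * fps_X ^ (r + s + t) else 0)
      = (\<Sum>r<q. if r = exp3 q t then (\<Sum>s<q. if s = exp4 q t then fps_const (of_nat q ^ 2 * g r s t) * fps_X ^ (r + s + t) else 0) else 0)"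
      by (intro sum.cong refl) simp
    also have "\<dots> = fps_const (of_nat q ^ 2 * g (exp3 q t) (exp4 q t) t) * fps_X ^ (exp3 q t + exp4 q t + t)"
      using exp_less[OF q] by simp
    finally show "(\<Sum>r<q. \<Sum>s<q. if r = exp3 q t \<and> s = exp4 q t
        then fps_const (of_nat q ^ 2 * g r s t) * fps_X ^ (r + s + t) else 0)
      = fps_const (of_nat q ^ 2 * g (exp3 q t) (exp4 q t) t) * fps_X ^ (q * weight q t)"
      by (simp only: weight[OF q])
  qed
  also have "tcong \<dots> (\<Sum>t<q. fps_const (of_nat q ^ 2 * g (exp3 q t) (exp4 q t) t) * fps_const ((- of_nat ?p) ^ weight q t))"
  proof (rule tcong_sum)
    fix t
    show "tcong (fps_const (of_nat q ^ 2 * g (exp3 q t) (exp4 q t) t) * fps_X ^ (q * weight q t))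
      (fps_const (of_nat q ^ 2 * g (exp3 q t) (exp4 q t) t) * fps_const ((- of_nat ?p) ^ weight q t))"
      unfolding q_def by (rule tcong_mult[OF tcong_refl eisenstein_eq_0 tame_const tame_const])
  qed
  also have "(\<Sum>t<q. fps_const (of_nat q ^ 2 * g (exp3 q t) (exp4 q t) t) * fps_const ((- of_nat ?p) ^ weight q t))
      = fps_const (of_nat q ^ 2 * (\<Sum>t<q. g (exp3 q t) (exp4 q t) t * (- of_nat ?p) ^ weight q t))"
    by (simp add: fps_const_sum sum_distrib_left mult.assoc)
  finally show ?thesis unfolding g_def \<tau>_def .
qed

text \<open>The two evaluations of \<open>trinomial_sum\<close> are congruent constants, hence
  equal. Each of the three coefficients contributes -1/q, against the factor q^2.\<close>

lemma gauss_sum_identity: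
  assumes p: "odd CARD('p :: prime_card)" and p5: "CARD('p) \<ge> 5"
  defines "q \<equiv> CARD('p) - 1"
  shows "(of_nat CARD('p) * of_nat (card (trinomial_roots :: 'p mod_ring set)) - of_nat q) * of_nat q
    = - (\<Sum>t<q. Gamma_frac (exp3 q t) * Gamma_frac (exp4 q t) * Gamma_frac t
       * to_fract (teich 3) ^ exp3 q t * to_fract (teich (- 4)) ^ exp4 q t * (- of_nat CARD('p)) ^ weight q t :: 'p padic)"
proof -
  let ?S = "\<lambda>f :: nat \<Rightarrow> 'p padic. (\<Sum>t<q. f (exp3 q t) * f (exp4 q t) * f t
       * to_fract (teich 3) ^ exp3 q t * to_fract (teich (- 4)) ^ exp4 q t * (- of_nat CARD('p)) ^ weight q t)"
  let ?n = "of_nat CARD('p) * of_nat (card (trinomial_roots :: 'p mod_ring set)) - of_nat q :: 'p padic"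
  have "tcong (fps_const ?n) (fps_const (of_nat q ^ 2 * ?S gauss_coeff))"
    using tcong_trans[OF tcong_sym[OF trinomial_sum_roots[OF p]] trinomial_sum_expansion[OF p p5]]
    unfolding q_def .
  then have 1: "?n = of_nat q ^ 2 * ?S gauss_coeff"
    by (simp only: tcong_const_iff)
  have mq: "(1 - of_nat CARD('p) :: 'p padic) = - of_nat q"
    using p5 by (simp add: q_def of_nat_diff)
  have q0: "(of_nat q :: 'p padic) \<noteq> 0" using p5 by (simp add: q_def)
  have "?S gauss_coeff = ?S Gamma_frac * (- 1 / of_nat q ^ 3)"
    unfolding sum_distrib_right
    by (intro sum.cong refl) (simp add: gauss_coeff_def mq power3_eq_cube)
  then have "?n * of_nat q = of_nat q ^ 3 * (?S Gamma_frac * (- 1 / of_nat q ^ 3))"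
    unfolding 1 by (simp add: power2_eq_square power3_eq_cube)
  also have "\<dots> = - ?S Gamma_frac"
    using q0 by simp
  finally show ?thesis .
qed

section \<open>The hypergeometric series\<close>

text \<open>If mz = k + y with k the integral part, the fractional part of z + i/m is (y + (k + i)
  mod m)/m, and i \<mapsto> (k + i) mod m is a permutation.\<close>

lemma prod_frac_shift:
  fixes F :: "rat \<Rightarrow> 'a :: comm_monoid_mult" and z :: rat
  assumes m: "m > 0"
  shows "(\<Prod>i<m. F (frac (z + of_nat i / of_nat m))) = (\<Prod>i<m. F ((frac (of_nat m * z) + of_nat i) / of_nat m))"
proof -
  define k where "k = \<lfloor>of_nat m * z\<rfloor>"
  define y where "y = frac (of_nat m * z)"
  have z: "z = (y + of_int k) / of_nat m"
    using m by (simp add: y_def k_def frac_def)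
  have y: "0 \<le> y" "y < 1" by (simp_all add: y_def frac_lt_1)
  define \<rho> where "\<rho> i = nat ((k + int i) mod int m)" for i
  have \<rho>_less: "\<rho> i < m" for i using m by (simp add: \<rho>_def nat_less_iff)
  have frac: "frac (z + of_nat i / of_nat m) = (y + of_nat (\<rho> i)) / of_nat m" for i
  proof (rule frac_unique_iff[THEN iffD2], intro conjI)
    have "of_int (k + int i) = (of_int (int m * ((k + int i) div int m) + (k + int i) mod int m) :: rat)"
      by (simp only: mult_div_mod_eq)
    also have "\<dots> = of_nat m * of_int ((k + int i) div int m) + of_nat (\<rho> i)"
    proof -
      have "int (\<rho> i) = (k + int i) mod int m" using m by (simp add: \<rho>_def)
      then have "of_int ((k + int i) mod int m) = (of_nat (\<rho> i) :: rat)" by (metis of_int_of_nat_eq)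
      then show ?thesis by (simp only: of_int_add of_int_mult of_int_of_nat_eq)
    qed
    finally have "z + of_nat i / of_nat m - (y + of_nat (\<rho> i)) / of_nat m = of_int ((k + int i) div int m)"
      using m unfolding z by (simp add: field_simps)
    then show "z + of_nat i / of_nat m - (y + of_nat (\<rho> i)) / of_nat m \<in> \<int>" by simp
    show "0 \<le> (y + of_nat (\<rho> i)) / of_nat m" using y by simp
    have "of_nat (\<rho> i) + 1 \<le> (of_nat m :: rat)"
      using \<rho>_less[of i] by (metis Suc_leI of_nat_Suc of_nat_le_iff add.commute)
    then show "(y + of_nat (\<rho> i)) / of_nat m < 1" using y m by simp
  qed
  have "inj_on \<rho> {..<m}"
  proof (rule inj_onI)
    fix i j assume ij: "i \<in> {..<m}" "j \<in> {..<m}" "\<rho> i = \<rho> j"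
    then have "(k + int i) mod int m = (k + int j) mod int m"
      using m by (simp add: \<rho>_def eq_nat_nat_iff)
    then have "int m dvd int i - int j" by (simp add: mod_eq_dvd_iff)
    then have "int i mod int m = int j mod int m" by (simp add: mod_eq_dvd_iff)
    then show "i = j" using ij by simp
  qed
  then have "bij_betw \<rho> {..<m} {..<m}"
    using \<rho>_less by (simp add: bij_betw_def endo_inj_surj image_subset_iff)
  then have "(\<Prod>i<m. F ((y + of_nat (\<rho> i)) / of_nat m)) = (\<Prod>i<m. F ((y + of_nat i) / of_nat m))"
    by (rule prod.reindex_bij_betw)
  then show ?thesis unfolding frac y_def .
qed

definition Gamma_rat :: "rat \<Rightarrow> 'p :: prime_card padic" where
  "Gamma_rat r = to_fract (padic_Gamma (padic_of_rat r))"

lemma Gamma_rat_frac: "Gamma_rat (of_nat r / of_nat (CARD('p) - 1)) = (Gamma_frac r :: 'p :: prime_card padic)"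
  by (simp add: Gamma_rat_def Gamma_frac_def unit_frac_def)

lemma Gamma_rat_nonzero:
  assumes "odd CARD('p :: prime_card)"
  shows "(Gamma_rat r :: 'p padic) \<noteq> 0"
  using padic_Gamma_unit[OF assms, of "padic_of_rat r"] by (auto simp: Gamma_rat_def)

lemma frac_int_div:
  assumes "q > 0"
  shows "frac (of_int u / of_nat q :: rat) = of_nat (nat (u mod int q)) / of_nat q"
proof (rule frac_unique_iff[THEN iffD2], intro conjI)
  have eq: "(of_nat (nat (u mod int q)) :: rat) = of_int (u mod int q)"
    using assms by (simp add: of_nat_nat)
  have "of_int u = of_nat q * of_int (u div int q) + (of_int (u mod int q) :: rat)"
    using arg_cong[OF mult_div_mod_eq[of "int q" u], of "of_int :: int \<Rightarrow> rat"]
    by (simp only: of_int_add of_int_mult of_int_of_nat_eq)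
  then have "of_int u / of_nat q - of_nat (nat (u mod int q)) / of_nat q = (of_int (u div int q) :: rat)"
    unfolding eq using assms by (simp add: field_simps)
  then show "of_int u / of_nat q - of_nat (nat (u mod int q)) / of_nat q \<in> (\<int> :: rat set)" by simp
  show "(of_nat (nat (u mod int q)) / of_nat q :: rat) \<ge> 0" by simp
  have "(of_int (u mod int q) :: rat) < of_int (int q)"
    unfolding of_int_less_iff using assms by simp
  then show "(of_nat (nat (u mod int q)) / of_nat q :: rat) < 1"
    unfolding eq using assms by simp
qed

text \<open>\<open>prod_frac_shift\<close> brings the arguments into the form (r/q + i)/m of
  \<open>padic_Gamma_multiplication\<close>. The power q - r of the Teichmueller lift moves to the
  other side as its r-th power, the q-th being 1.\<close>

lemma Gamma_rat_multiplication:
  assumes p: "odd CARD('p :: prime_card)" and m: "m > 0" "\<not> CARD('p) dvd m"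
  defines "q \<equiv> CARD('p) - 1"
  shows "(\<Prod>i<m. Gamma_rat (frac (of_int u / of_nat q + of_nat i / of_nat m)) :: 'p padic)
    = (\<Prod>i<m. Gamma_rat (of_nat i / of_nat m)) * Gamma_frac (nat ((int m * u) mod int q))
      * to_fract (teich (of_nat m)) ^ nat ((int m * u) mod int q)"
proof -
  define r where "r = nat ((int m * u) mod int q)"
  have p1: "CARD('p) > 1" by (rule CARD_gt_1)
  then have q: "q > 0" by (simp add: q_def)
  have qp: "(of_nat q :: 'p padic_int) = pp - 1" using p1 by (simp add: q_def of_nat_diff)
  have r: "r < q" using q by (simp add: r_def nat_less_iff)
  have y: "frac (of_nat m * (of_int u / of_nat q) :: rat) = of_nat r / of_nat q"
    using frac_int_div[OF q, of "int m * u"] by (simp add: r_def)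
  have pq: "\<not> CARD('p) dvd q" using p1 by (auto simp: q_def dest: dvd_imp_le)
  have "\<not> pp dvd (of_nat m :: 'p padic_int)" using m by (simp add: pp_dvd_of_nat_iff)
  then have "(of_nat m :: 'p padic_int) dvd 1" by (simp add: padic_unit_iff)
  then obtain \<mu> :: "'p padic_int" where \<mu>: "of_nat m * \<mu> = 1" by (metis dvdE)
  have arg: "padic_of_rat ((of_nat r / of_nat q + of_nat i) / of_nat m) = (unit_frac r + of_nat i) * (\<mu> :: 'p padic_int)" for i
  proof -
    have eq: "(of_nat r / of_nat q + of_nat i) / of_nat m = (of_int (int (r + i * q)) / of_int (int (q * m)) :: rat)"
      using q m by (simp add: field_simps)
    show ?thesis unfolding eq
    proof (rule padic_of_rat_unique)
      have "of_int (int (q * m)) * ((unit_frac r + of_nat i) * \<mu>)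
          = (of_nat m * \<mu>) * ((pp - 1) * unit_frac r + of_nat q * of_nat i)"
        unfolding qp by (simp add: qp algebra_simps)
      also have "\<dots> = of_int (int (r + i * q))"
        unfolding \<mu> unit_frac by (simp add: mult.commute)
      finally show "of_int (int (q * m)) * ((unit_frac r + of_nat i) * \<mu>) = of_int (int (r + i * q))" .
      show "\<not> int CARD('p) dvd int (q * m)"
        using m pq prime_dvd_mult_iff[OF prime_card[where ?'a = 'p], of q m] by (simp only: int_dvd_int_iff) simp
    qed
  qed
  have arg0: "padic_of_rat (of_nat i / of_nat m) = of_nat i * (\<mu> :: 'p padic_int)" for i
  proof -
    have eq: "of_nat i / of_nat m = (of_int (int i) / of_int (int m) :: rat)" by simp
    show ?thesis unfolding eq
      by (rule padic_of_rat_unique) (use m \<mu> in \<open>simp_all add: mult.left_commute int_dvd_int_iff\<close>)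
  qed
  have "r \<le> CARD('p) - 1" using r by (simp add: q_def)
  from padic_Gamma_multiplication[OF p unit_frac this m(1) \<mu>]
  have mult: "(\<Prod>i<m. padic_Gamma ((unit_frac r + of_nat i) * \<mu>)) * teich (of_nat m) ^ (q - r)
       = (\<Prod>i<m. padic_Gamma (of_nat i * \<mu>)) * padic_Gamma (unit_frac r)"
    by (simp only: q_def)
  have "(of_nat m :: 'p mod_ring) \<noteq> 0"
    using m(2) of_nat_0_mod_ring_dvd by blast
  then have t: "teich (of_nat m :: 'p mod_ring) ^ (q - r) * teich (of_nat m) ^ r = 1"
    using teich_power_card_minus_1[of "of_nat m :: 'p mod_ring"] r by (simp add: q_def flip: power_add)
  have "(\<Prod>i<m. padic_Gamma ((unit_frac r + of_nat i) * \<mu>))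
      = (\<Prod>i<m. padic_Gamma ((unit_frac r + of_nat i) * \<mu>)) * teich (of_nat m) ^ (q - r) * teich (of_nat m) ^ r"
    using t by (simp add: mult.assoc)
  also have "\<dots> = (\<Prod>i<m. padic_Gamma (of_nat i * \<mu>)) * padic_Gamma (unit_frac r) * teich (of_nat m) ^ r"
    unfolding mult ..
  finally have "to_fract (\<Prod>i<m. padic_Gamma ((unit_frac r + of_nat i) * \<mu>))
      = to_fract ((\<Prod>i<m. padic_Gamma (of_nat i * \<mu>)) * padic_Gamma (unit_frac r) * teich (of_nat m) ^ r)"
    by (rule arg_cong)
  then have "(\<Prod>i<m. Gamma_rat ((of_nat r / of_nat q + of_nat i) / of_nat m) :: 'p padic)
      = (\<Prod>i<m. Gamma_rat (of_nat i / of_nat m)) * Gamma_frac r * to_fract (teich (of_nat m)) ^ r"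
    by (simp add: Gamma_rat_def Gamma_frac_def arg arg0 to_fract_prod to_fract_power)
  then show ?thesis
    unfolding prod_frac_shift[OF m(1)] y r_def[symmetric] .
qed

text \<open>For 0 < j < q the fractional part of -j/q is 1 - j/q. At j = 0 it would be 0 instead of
  1, which is why that term is treated separately.\<close>

lemma Gamma_frac_reflection:
  assumes p: "odd CARD('p :: prime_card)" and j: "0 < j" "j < CARD('p) - 1"
  shows "Gamma_frac j * Gamma_rat (frac (- (of_nat j / of_nat (CARD('p) - 1)))) = (- ((- 1) ^ j) :: 'p padic)"
proof -
  let ?q = "CARD('p) - 1"
  have q: "?q > 0" using j by simp
  have "(- int j) mod int ?q = int (?q - j)"
  proof -
    have "int (?q - j) = - int j + int ?q" using j by simp
    then have "(- int j) mod int ?q = (int (?q - j)) mod int ?q"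
      by (simp only: mod_add_self2)
    also have "\<dots> = int (?q - j)"
      by (rule mod_pos_pos_trivial) (use j in simp_all)
    finally show ?thesis .
  qed
  then have "frac (- (of_nat j / of_nat ?q)) = (of_nat (?q - j) / of_nat ?q :: rat)"
    using frac_int_div[OF q, of "- int j"] by simp
  moreover have "unit_frac (?q - j) = (1 - unit_frac j :: 'p padic_int)"
  proof (rule unit_frac_eqI)
    have "(pp - 1 :: 'p padic_int) = of_nat ?q" using q by (simp add: of_nat_diff)
    then show "(pp - 1) * (1 - unit_frac j) = (of_nat (?q - j) :: 'p padic_int)"
      using j by (simp add: right_diff_distrib unit_frac of_nat_diff)
  qed
  ultimately have "Gamma_rat (frac (- (of_nat j / of_nat ?q))) = (to_fract (padic_Gamma (1 - unit_frac j)) :: 'p padic)"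
    by (simp only: Gamma_rat_frac Gamma_frac_def)
  moreover have "padic_Gamma (unit_frac j) * padic_Gamma (1 - unit_frac j) = (- ((- 1) ^ j) :: 'p padic_int)"
    using j by (intro padic_Gamma_reflection[OF p unit_frac]) simp
  ultimately show ?thesis
    by (simp add: Gamma_frac_def to_fract_power flip: to_fract_mult)
qed

text \<open>Hermite's identity for three shifts.\<close>

lemma floor_sum_3:
  fixes x :: rat
  assumes "0 \<le> x" "x < 1"
  shows "\<lfloor>x\<rfloor> + \<lfloor>2/3 + x\<rfloor> + \<lfloor>1/3 + x\<rfloor> = \<lfloor>3 * x\<rfloor>"
proof -
  have "\<lfloor>x\<rfloor> = 0" using assms by (simp add: floor_eq_iff)
  moreover have "\<lfloor>2/3 + x\<rfloor> = (if x < 1/3 then 0 else 1)" "\<lfloor>1/3 + x\<rfloor> = (if x < 2/3 then 0 else 1)"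
    "\<lfloor>3 * x\<rfloor> = (if x < 1/3 then 0 else if x < 2/3 then 1 else 2)"
    using assms by (auto simp: floor_eq_iff)
  ultimately show ?thesis by simp
qed

text \<open>Hermite's identity for four shifts at -x; the absent term \<lfloor>-x\<rfloor> = -1
  accounts for the 1.\<close>

lemma floor_sum_4:
  fixes x :: rat
  assumes "0 < x" "x < 1"
  shows "\<lfloor>1/4 - x\<rfloor> + \<lfloor>1/2 - x\<rfloor> + \<lfloor>3/4 - x\<rfloor> = \<lfloor>- 4 * x\<rfloor> + 1"
proof -
  have "\<lfloor>1/4 - x\<rfloor> = (if x \<le> 1/4 then 0 else - 1)" "\<lfloor>1/2 - x\<rfloor> = (if x \<le> 1/2 then 0 else - 1)"
    "\<lfloor>3/4 - x\<rfloor> = (if x \<le> 3/4 then 0 else - 1)"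
    "\<lfloor>- 4 * x\<rfloor> = (if x \<le> 1/4 then - 1 else if x \<le> 1/2 then - 2 else if x \<le> 3/4 then - 3 else - 4)"
    using assms by (auto simp: floor_eq_iff)
  then show ?thesis by simp
qed

text \<open>The linear parts 3t - 4t + t cancel and only the quotients by q remain.\<close>

lemma weight_floor:
  assumes q: "q > 0"
  shows "int (weight q t) = - \<lfloor>3 * (of_nat t / of_nat q :: rat)\<rfloor> - \<lfloor>- 4 * (of_nat t / of_nat q :: rat)\<rfloor>"
proof -
  have 1: "\<lfloor>3 * (of_nat t / of_nat q :: rat)\<rfloor> = (3 * int t) div int q"
    using floor_divide_of_int_eq[of "3 * int t" "int q", where ?'a = rat] by simp
  have 2: "\<lfloor>- 4 * (of_nat t / of_nat q :: rat)\<rfloor> = (- 4 * int t) div int q"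
    using floor_divide_of_int_eq[of "- 4 * int t" "int q", where ?'a = rat] by simp
  have "int q * int (weight q t) = (3 * int t) mod int q + (- 4 * int t) mod int q + int t"
    using weight[OF q, of t] int_exp[OF q, of t] by (metis of_nat_add of_nat_mult)
  also have "\<dots> = int q * (- ((3 * int t) div int q) - (- 4 * int t) div int q)"
    using div_mult_mod_eq[of "3 * int t" "int q"] div_mult_mod_eq[of "- 4 * int t" "int q"]
    by (simp add: algebra_simps)
  finally show ?thesis using q unfolding 1 2 by simp
qed

definition nGn_term :: "nat \<Rightarrow> 'p :: prime_card padic" where
  "nGn_term j = (let x = of_nat j / (of_nat CARD('p) - 1) in
     (- 1) ^ (j * 3) * teichmuller_inv_power j (1 :: 'p mod_ring) *
     (\<Prod>i<3. let a = [1/4, 1/2, 3/4] ! i; b = [0, 1/3, 2/3] ! i in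
        (- of_nat CARD('p)) powi (- \<lfloor>frac a - x\<rfloor> - \<lfloor>frac (- b) + x\<rfloor>) *
        (Gamma_rat (frac (a - x)) / Gamma_rat (frac a)) *
        (Gamma_rat (frac (- b + x)) / Gamma_rat (frac (- b)))))"

lemma padic_nGn_conv:
  "padic_nGn [1/4, 1/2, 3/4] [0, 1/3, 2/3] (1 :: 'p :: prime_card mod_ring)
     = - 1 / (of_nat CARD('p) - 1) * (\<Sum>j<CARD('p) - 1. nGn_term j :: 'p padic)"
proof -
  have set: "{0..CARD('p) - 2} = {..<CARD('p) - 1}"
    using CARD_gt_1[where ?'p = 'p] by auto
  have len: "length [1/4, 1/2, 3/4 :: rat] = 3" by simp
  show ?thesis
    unfolding padic_nGn_def nGn_term_def Gamma_rat_def Let_def len set ..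
qed

text \<open>The fractional parts of -b are 0, 2/3, 1/3, a full set of thirds, to which the
  multiplication formula applies directly. Among the quarters a omits 0, so the formula at -x leaves
  the factor at the fractional part of -x in the denominator. The constant gamma products cancel the
  normalising ones.\<close>

lemma nGn_term_eq:
  assumes p: "odd CARD('p :: prime_card)" and p5: "CARD('p) \<ge> 5" and j: "j < CARD('p) - 1"
  defines "q \<equiv> CARD('p) - 1"
  defines "x \<equiv> (of_nat j / of_nat q :: rat)"
  shows "(nGn_term j :: 'p padic) = (- 1) ^ j
     * (- of_nat CARD('p)) powi (- \<lfloor>3 * x\<rfloor> - (\<lfloor>1/4 - x\<rfloor> + \<lfloor>1/2 - x\<rfloor> + \<lfloor>3/4 - x\<rfloor>))
     * (Gamma_frac (exp3 q j) * to_fract (teich 3) ^ exp3 q j)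
     * (Gamma_frac (exp4 q j) * to_fract (teich 4) ^ exp4 q j) / Gamma_rat (frac (- x))"
proof -
  let ?G = "Gamma_rat :: rat \<Rightarrow> 'p padic"
  define \<pi> where "\<pi> = (of_nat CARD('p) :: 'p padic)"
  have q: "q > 0" using p5 by (simp add: q_def)
  have x: "of_nat j / (of_nat CARD('p) - 1) = x"
    using p5 by (simp add: x_def q_def of_nat_diff)
  have x01: "0 \<le> x" "x < 1" using j q by (simp_all add: x_def q_def)
  have nz: "?G r \<noteq> 0" for r by (rule Gamma_rat_nonzero[OF p])
  have tm: "teichmuller_inv_power j (1 :: 'p mod_ring) = 1"
    by (simp add: teichmuller_inv_power_def teichmuller_eq_teich)
  have fr: "frac (1/4 :: rat) = 1/4" "frac (1/2 :: rat) = 1/2" "frac (3/4 :: rat) = 3/4"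
     "frac (- (1/3) :: rat) = 2/3" "frac (- (2/3) :: rat) = 1/3"
    unfolding frac_unique_iff by simp_all
  have fr2: "frac (x - 1/3) = frac (x + 2/3)" "frac (x - 2/3) = frac (x + 1/3)"
    using frac_1_eq[of "x - 1/3"] frac_1_eq[of "x - 2/3"] by (simp_all add: algebra_simps)
  have dvd: "\<not> CARD('p) dvd 3" "\<not> CARD('p) dvd 4" using p5 by (auto dest: dvd_imp_le)
  have G0: "?G 0 = 1"
    using Gamma_rat_frac[of 0, where ?'p = 'p] Gamma_frac_0[OF p] by simp
  have m3: "?G (frac x) * ?G (frac (x + 1/3)) * ?G (frac (x + 2/3))
      = ?G (1/3) * ?G (2/3) * Gamma_frac (exp3 q j) * to_fract (teich 3) ^ exp3 q j"
    using Gamma_rat_multiplication[OF p _ dvd(1), of "int j"]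
    by (simp add: numeral_3_eq_3 G0 exp3_def x_def q_def)
  have m4: "?G (frac (- x)) * ?G (frac (1/4 - x)) * ?G (frac (1/2 - x)) * ?G (frac (3/4 - x))
      = ?G (1/4) * ?G (1/2) * ?G (3/4) * Gamma_frac (exp4 q j) * to_fract (teich 4) ^ exp4 q j"
    using Gamma_rat_multiplication[OF p _ dvd(2), of "- int j"]
    by (simp add: numeral_eq_Suc G0 exp4_def x_def q_def)
  have pw: "(- \<pi>) powi a * (- \<pi>) powi b = (- \<pi>) powi (a + b)" for a b
    by (rule power_int_add[symmetric]) (simp add: \<pi>_def)
  have "nGn_term j = (- 1) ^ (j * 3) *
     ((- \<pi>) powi (- \<lfloor>1/4 - x\<rfloor> - \<lfloor>x\<rfloor>) * (- \<pi>) powi (- \<lfloor>1/2 - x\<rfloor> - \<lfloor>2/3 + x\<rfloor>)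
       * (- \<pi>) powi (- \<lfloor>3/4 - x\<rfloor> - \<lfloor>1/3 + x\<rfloor>)) *
     ((?G (frac (1/4 - x)) * ?G (frac (1/2 - x)) * ?G (frac (3/4 - x)))
       / (?G (1/4) * ?G (1/2) * ?G (3/4))) *
     ((?G (frac x) * ?G (frac (x + 1/3)) * ?G (frac (x + 2/3))) / (?G (1/3) * ?G (2/3)))"
    unfolding nGn_term_def Let_def x tm
    by (simp add: numeral_3_eq_3 fr fr2 G0 \<pi>_def mult_ac)
  also have "(- \<pi>) powi (- \<lfloor>1/4 - x\<rfloor> - \<lfloor>x\<rfloor>) * (- \<pi>) powi (- \<lfloor>1/2 - x\<rfloor> - \<lfloor>2/3 + x\<rfloor>)
       * (- \<pi>) powi (- \<lfloor>3/4 - x\<rfloor> - \<lfloor>1/3 + x\<rfloor>)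
      = (- \<pi>) powi (- \<lfloor>3 * x\<rfloor> - (\<lfloor>1/4 - x\<rfloor> + \<lfloor>1/2 - x\<rfloor> + \<lfloor>3/4 - x\<rfloor>))"
    unfolding pw floor_sum_3[OF x01, symmetric] by (rule arg_cong[of _ _ "(powi) (- \<pi>)"]) simp
  also have "(?G (frac x) * ?G (frac (x + 1/3)) * ?G (frac (x + 2/3))) / (?G (1/3) * ?G (2/3))
      = Gamma_frac (exp3 q j) * to_fract (teich 3) ^ exp3 q j"
    unfolding m3 using nz by simp
  also have "(?G (frac (1/4 - x)) * ?G (frac (1/2 - x)) * ?G (frac (3/4 - x))) / (?G (1/4) * ?G (1/2) * ?G (3/4))
      = Gamma_frac (exp4 q j) * to_fract (teich 4) ^ exp4 q j / ?G (frac (- x))"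
    using m4 nz by (simp add: field_simps)
  also have "(- 1) ^ (j * 3) = ((- 1) ^ j :: 'p padic)"
    by (simp add: minus_one_power_iff)
  finally show ?thesis by (simp add: \<pi>_def mult_ac)
qed

lemma nGn_term_0:
  assumes p: "odd CARD('p :: prime_card)" and p5: "CARD('p) \<ge> 5"
  shows "(nGn_term 0 :: 'p padic) = 1"
proof -
  have "Gamma_rat 0 = (1 :: 'p padic)"
    using Gamma_rat_frac[of 0, where ?'p = 'p] Gamma_frac_0[OF p] by simp
  moreover have "\<lfloor>1/4 :: rat\<rfloor> = 0" "\<lfloor>1/2 :: rat\<rfloor> = 0" "\<lfloor>3/4 :: rat\<rfloor> = 0"
    by (simp_all add: floor_eq_iff)
  ultimately show ?thesis
    using nGn_term_eq[OF p p5, of 0] p5 Gamma_frac_0[OF p]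
    by (simp add: exp3_def exp4_def)
qed

text \<open>Reflection turns the remaining denominator into \<open>Gamma_frac j\<close>. The 1 in
  \<open>floor_sum_4\<close> makes the exponent of -p equal to the weight minus 1, hence the factor
  p on the left; its sign cancels the sign of the reflection.\<close>

lemma nGn_term_gauss:
  assumes p: "odd CARD('p :: prime_card)" and p5: "CARD('p) \<ge> 5" and j: "0 < j" "j < CARD('p) - 1"
  defines "q \<equiv> CARD('p) - 1"
  shows "of_nat CARD('p) * (nGn_term j :: 'p padic) = Gamma_frac (exp3 q j) * Gamma_frac (exp4 q j) * Gamma_frac j
     * to_fract (teich 3) ^ exp3 q j * to_fract (teich (- 4)) ^ exp4 q j * (- of_nat CARD('p)) ^ weight q j"
proof -
  define \<pi> where "\<pi> = (of_nat CARD('p) :: 'p padic)"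
  define x where "x = (of_nat j / of_nat q :: rat)"
  have q: "q > 0" using p5 by (simp add: q_def)
  have x01: "0 < x" "0 \<le> x" "x < 1" using j q by (simp_all add: x_def q_def)
  have pi0: "- \<pi> \<noteq> 0" by (simp add: \<pi>_def)
  have refl: "Gamma_frac j * Gamma_rat (frac (- x)) = (- ((- 1) ^ j) :: 'p padic)"
    using Gamma_frac_reflection[OF p j] by (simp add: x_def q_def)
  define P where "P = (- \<pi>) powi (- \<lfloor>3 * x\<rfloor> - (\<lfloor>1/4 - x\<rfloor> + \<lfloor>1/2 - x\<rfloor> + \<lfloor>3/4 - x\<rfloor>))"
  have sign: "(- 1) ^ j / Gamma_rat (frac (- x)) = (- Gamma_frac j :: 'p padic)"
  proof -
    have "(- 1) ^ j = (- Gamma_frac j * Gamma_rat (frac (- x)) :: 'p padic)"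
      using refl by simp
    then show ?thesis using Gamma_rat_nonzero[OF p, of "frac (- x)"] by simp
  qed
  have P: "\<pi> * P = - ((- \<pi>) ^ weight q j)"
  proof -
    have "- \<lfloor>3 * x\<rfloor> - (\<lfloor>1/4 - x\<rfloor> + \<lfloor>1/2 - x\<rfloor> + \<lfloor>3/4 - x\<rfloor>) = int (weight q j) - 1"
      unfolding floor_sum_4[OF x01(1,3)] unfolding weight_floor[OF q] x_def by simp
    then have "\<pi> * P = \<pi> * ((- \<pi>) powi int (weight q j) / (- \<pi>))"
      using power_int_diff[of "- \<pi>" "int (weight q j)" 1] pi0 by (simp only: P_def power_int_1_right simp_thms)
    then show ?thesis using pi0 by simp
  qed
  \<comment> \<open>The exponent is even because q is, so the sign of 4 does not matter.\<close>
  have four: "to_fract (teich (- 4)) ^ exp4 q j = (to_fract (teich 4) ^ exp4 q j :: 'p padic)"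
  proof -
    have "even q" using p by (simp add: q_def)
    then have "even (exp4 q j)"
      using weight[OF q, of j] int_exp[OF q, of j]
      by (metis dvd_mod_iff even_mult_iff even_numeral even_of_nat int_exp(2) q dvd_minus_iff mult_minus_left)
    moreover have "teich (- 4 :: 'p mod_ring) ^ 2 = teich 4 ^ 2"
      by (simp flip: teich_power)
    ultimately have "teich (- 4 :: 'p mod_ring) ^ exp4 q j = teich 4 ^ exp4 q j"
      by (metis evenE power_mult)
    then show ?thesis by (simp flip: to_fract_power)
  qed
  have "\<pi> * nGn_term j = (\<pi> * P) * (Gamma_frac (exp3 q j) * to_fract (teich 3) ^ exp3 q j)
      * (Gamma_frac (exp4 q j) * to_fract (teich 4) ^ exp4 q j) * ((- 1) ^ j / Gamma_rat (frac (- x)))"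
    using nGn_term_eq[OF p p5 j(2)] unfolding q_def[symmetric] x_def[symmetric] \<pi>_def[symmetric] P_def[symmetric]
    by (simp add: mult_ac)
  then show ?thesis
    unfolding P sign four \<pi>_def[symmetric] by (simp add: mult_ac)
qed

text \<open>The Gauss sum terms are p times the terms of the series except at j = 0, where both are
  1; so their sum is 1 + p(S - 1), and the identity can be solved for S.\<close>

lemma padic_nGn_roots:
  assumes p: "odd CARD('p :: prime_card)" and p5: "CARD('p) \<ge> 5"
  shows "padic_nGn [1/4, 1/2, 3/4] [0, 1/3, 2/3] (1 :: 'p mod_ring)
     = of_nat (card (trinomial_roots :: 'p mod_ring set)) - 1"
proof -
  define q where "q = CARD('p) - 1"
  define \<pi> where "\<pi> = (of_nat CARD('p) :: 'p padic)"
  define N where "N = (of_nat (card (trinomial_roots :: 'p mod_ring set)) :: 'p padic)"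
  define S where "S = (\<Sum>j<q. nGn_term j :: 'p padic)"
  define T :: "nat \<Rightarrow> 'p padic" where "T t = Gamma_frac (exp3 q t) * Gamma_frac (exp4 q t) * Gamma_frac t
       * to_fract (teich 3) ^ exp3 q t * to_fract (teich (- 4)) ^ exp4 q t * (- \<pi>) ^ weight q t" for t
  have q: "q > 0" using p5 by (simp add: q_def)
  have qp: "(of_nat q :: 'p padic) = \<pi> - 1" using p5 by (simp add: q_def \<pi>_def of_nat_diff)
  have pi0: "\<pi> \<noteq> 0" "\<pi> - 1 \<noteq> 0"
    using q qp by (auto simp: \<pi>_def)
  have T0: "T 0 = 1"
    using Gamma_frac_0[OF p] by (simp add: T_def exp3_def exp4_def weight_def)
  obtain q' where q': "q = Suc q'" using q by (cases q) auto
  have "(\<Sum>t<q. T t) = 1 + (\<Sum>t<q'. T (Suc t))"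
    unfolding q' by (subst sum.lessThan_Suc_shift) (simp add: T0)
  also have "(\<Sum>t<q'. T (Suc t)) = (\<Sum>t<q'. \<pi> * nGn_term (Suc t))"
  proof (intro sum.cong refl)
    fix t assume "t \<in> {..<q'}"
    then have "Suc t < CARD('p) - 1" using q' q_def by simp
    then show "T (Suc t) = \<pi> * nGn_term (Suc t)"
      using nGn_term_gauss[OF p p5, of "Suc t"] by (simp add: T_def \<pi>_def q_def)
  qed
  also have "\<dots> = \<pi> * (S - 1)"
    unfolding S_def q' by (subst sum.lessThan_Suc_shift) (simp add: nGn_term_0[OF p p5] sum_distrib_left)
  finally have sum_T: "(\<Sum>t<q. T t) = 1 + \<pi> * (S - 1)" .
  have "(\<pi> * N - (\<pi> - 1)) * (\<pi> - 1) = - (\<Sum>t<q. T t)"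
    using gauss_sum_identity[OF p p5] unfolding q_def[symmetric] \<pi>_def[symmetric] N_def[symmetric] qp T_def .
  then have "\<pi> * S = \<pi> * ((1 - N) * (\<pi> - 1))"
    unfolding sum_T by (simp add: algebra_simps)
  then have "S = (1 - N) * (\<pi> - 1)" using pi0 by simp
  then have "- 1 / (\<pi> - 1) * S = N - 1" using pi0 by simp
  then show ?thesis unfolding padic_nGn_conv S_def q_def \<pi>_def N_def .
qed

text \<open>Besides the double root 1 there are the solutions of (3x + 1)^2 = -2, of which there are
  1 + \<phi>(-2). At x = 1 the difference of both sides is 18, nonzero for p \<ge> 5, so 1 is not
  counted twice.\<close>

lemma card_trinomial_roots:
  assumes p: "odd CARD('p :: prime_card)" and p5: "CARD('p) \<ge> 5"
  shows "int (card (trinomial_roots :: 'p mod_ring set)) = 2 + quadratic_char (- 2 :: 'p mod_ring)"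
proof -
  have nz: "(of_nat k :: 'p mod_ring) \<noteq> 0" if "\<not> CARD('p) dvd k" for k
    using that of_nat_0_mod_ring_dvd by blast
  have "\<not> CARD('p) dvd 2" "\<not> CARD('p) dvd 3" using p5 by (auto dest: dvd_imp_le)
  then have n2: "(2 :: 'p mod_ring) \<noteq> 0" and n3: "(3 :: 'p mod_ring) \<noteq> 0"
    using nz[of 2] nz[of 3] by simp_all
  then have n6: "(6 :: 'p mod_ring) \<noteq> 0"
    by (metis mult_eq_0_iff mult_numeral_1 numeral_times_numeral num_double mult_numeral_1_right semiring_norm(13))
  define R where "R = {x :: 'p mod_ring. (3 * x + 1) ^ 2 = - 2}"
  have "3 * x ^ 4 - 4 * x ^ 3 + 1 = 0 \<longleftrightarrow> x = 1 \<or> (3 * x + 1) ^ 2 = - 2" for x :: "'p mod_ring"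
  proof -
    \<comment> \<open>The factor 3 completes the square: 3(3x^2 + 2x + 1) = (3x + 1)^2 + 2.\<close>
    have "3 * (3 * x ^ 4 - 4 * x ^ 3 + 1) = (x - 1) ^ 2 * ((3 * x + 1) ^ 2 + 2)"
      by (simp add: power2_eq_square power3_eq_cube power4_eq_xxxx algebra_simps)
    then have "3 * x ^ 4 - 4 * x ^ 3 + 1 = 0 \<longleftrightarrow> (x - 1) ^ 2 * ((3 * x + 1) ^ 2 + 2) = 0"
      using n3 by (metis mult_eq_0_iff)
    then show ?thesis by (simp add: eq_neg_iff_add_eq_0)
  qed
  then have "trinomial_roots = insert 1 R" by (auto simp: trinomial_roots_def R_def)
  moreover have "1 \<notin> R"
  proof
    assume "1 \<in> R"
    then have "(18 :: 'p mod_ring) = 0" by (simp add: R_def eq_neg_iff_add_eq_0)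
    moreover have "(18 :: 'p mod_ring) = 6 * 3" by simp
    ultimately show False using n6 n3 by (metis mult_eq_0_iff)
  qed
  then have "card (insert 1 R) = Suc (card R)"
    by (intro card_insert_disjoint) simp_all
  ultimately have card: "card (trinomial_roots :: 'p mod_ring set) = Suc (card R)"
    by (simp only:)
  define a where "a = to_int_mod_ring (- 2 :: 'p mod_ring)"
  have a: "of_int a = (- 2 :: 'p mod_ring)" by (simp add: a_def mod_ring_of_int_to_int)
  have of_int_eq: "(of_int u :: 'p mod_ring) = of_int v \<longleftrightarrow> [u = v] (mod int CARD('p))" for u v
    by (simp add: of_int_of_int_mod_ring cong_def, transfer, simp)
  have "\<not> [a = 0] (mod int CARD('p))"
    using of_int_eq[of a 0] a n2 by simp
  moreover have QR: "QuadRes (int CARD('p)) a \<longleftrightarrow> (\<exists>y :: 'p mod_ring. y ^ 2 = - 2)"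
  proof
    assume "QuadRes (int CARD('p)) a"
    then obtain y where "[y ^ 2 = a] (mod int CARD('p))" by (auto simp: QuadRes_def)
    then have "(of_int (y ^ 2) :: 'p mod_ring) = of_int a" by (simp only: of_int_eq)
    then show "\<exists>y :: 'p mod_ring. y ^ 2 = - 2" using a by (intro exI[of _ "of_int y"]) simp
  next
    assume "\<exists>y :: 'p mod_ring. y ^ 2 = - 2"
    then obtain y :: "'p mod_ring" where y: "y ^ 2 = - 2" by blast
    have "of_int (to_int_mod_ring y ^ 2) = (of_int a :: 'p mod_ring)"
      using y a by (simp add: mod_ring_of_int_to_int)
    then show "QuadRes (int CARD('p)) a"
      unfolding QuadRes_def of_int_eq by blast
  qed
  ultimately have qc: "quadratic_char (- 2 :: 'p mod_ring) = (if \<exists>y :: 'p mod_ring. y ^ 2 = - 2 then 1 else - 1)"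
    by (simp add: quadratic_char_def Legendre_def a_def)
  have "int (card R) = 1 + quadratic_char (- 2 :: 'p mod_ring)"
  proof (cases "\<exists>y :: 'p mod_ring. y ^ 2 = - 2")
    case True
    then obtain y :: "'p mod_ring" where y: "y ^ 2 = - 2" by blast
    have "y \<noteq> 0" using y n2 by auto
    have "R = {(y - 1) / 3, (- y - 1) / 3}"
    proof -
      have "(3 * x + 1) ^ 2 = - 2 \<longleftrightarrow> x = (y - 1) / 3 \<or> x = (- y - 1) / 3" for x
      proof -
        have "(3 * x + 1) ^ 2 = - 2 \<longleftrightarrow> 3 * x + 1 = y \<or> 3 * x + 1 = - y"
          unfolding y[symmetric] by (rule power2_eq_iff)
        also have "\<dots> \<longleftrightarrow> x = (y - 1) / 3 \<or> x = (- y - 1) / 3"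
          using n3 by (simp add: eq_divide_eq eq_diff_eq mult.commute)
        finally show ?thesis .
      qed
      then show ?thesis by (auto simp: R_def)
    qed
    moreover have "(y - 1) / 3 \<noteq> (- y - 1) / 3"
    proof
      assume "(y - 1) / 3 = (- y - 1) / 3"
      then have "2 * y = 0" using n3 by (simp add: eq_neg_iff_add_eq_0 flip: mult_2)
      then show False using n2 \<open>y \<noteq> 0\<close> by simp
    qed
    ultimately show ?thesis using True qc by simp
  next
    case False
    then have "R = {}" by (auto simp: R_def)
    then show ?thesis using False qc by simp
  qed
  then show ?thesis by (simp add: card)
qed

theorem theorem5p4:
  assumes "CARD('p :: prime_card) \<ge> 5"
  shows "padic_nGn [1/4, 1/2, 3/4] [0, 1/3, 2/3] (1 :: 'p mod_ring) =
           1 + of_int (quadratic_char (- 2 :: 'p mod_ring))"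
proof -
  have p: "odd CARD('p)"
    using assms prime_card[where ?'a = 'p] by (intro prime_odd_nat) auto
  have "(of_nat (card (trinomial_roots :: 'p mod_ring set)) :: 'p padic)
      = of_int (int (card (trinomial_roots :: 'p mod_ring set)))" by simp
  then show ?thesis
    unfolding padic_nGn_roots[OF p assms] card_trinomial_roots[OF p assms] by simp
qed

end
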